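(* Consider a $\mathbb Z^d$-periodic finite-volume partition $\mathcal T=\{(x,K_x):x\in\mathcal X\}$ of $\mathbb R^d$ with induced graph $(\mathcal X,\mathcal E)$, let $\mathfrak m:\mathbb R_+\to\mathbb R_+$ be a concave upper semicontinuous mobility with admissible versions $(\mathfrak m_{xy})_{(x,y)\in\mathcal E}$, and let $f$, $F$, $f_{\rm hom}$ be as in the context. The following assertions hold: (i) $f_{\rm hom}(\rho,j)\le f(\rho,j)$ for all $\rho\in\mathbb R_+$ and $j\in\mathbb R^d$. (ii) Suppose that for every $\rho\in\mathbb R_+$ and $j\in\mathbb R^d$ there is a family of vectors $(p^{xy})_{(x,y)\in\mathcal E}\subseteq\mathbb R^2$ such that $p^{xy}=(p^{xy}_1,p^{xy}_2)\in\partial^+\mathfrak m_{xy}(\rho,\rho)$ for all $(x,y)\in\mathcal E$, and $$\frac1{|K_x|}\sum_{y\sim x}(p^{xy}_1+p^{yx}_2)\,d_{xy}s_{xy}\,(n_{xy}\cdot j)^2\quad\text{is independent of }x\in\mathcal X.$$ Then $f_{\rm hom}=f$. (iii) Suppose that all $\mathfrak m_{xy}$ are differentiable in a neighbourhood of the diagonal in $(0,\infty)^2$. Then $f_{\rm hom}=f$ if and only if $$\sum_{y\sim x}\frac{\partial_1\mathfrak m_{xy}(\rho,\rho)}{\mathfrak m'(\rho)}\,d_{xy}s_{xy}\,n_{xy}\otimes n_{xy}=|K_x|\,\mathrm{id}\quad\text{for all }x\in\mathcal X\text{ and }\rho>0.$$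
   Context: $\mathbb R_+=[0,\infty)$. **Finite-volume partition.** $\mathcal X\subseteq\mathbb R^d$ is a countable, locally finite, $\mathbb Z^d$-periodic family of points and $K_x\subseteq\mathbb R^d$ ($x\in\mathcal X$) are nonempty open bounded convex polytopes with $K_{x+z}=K_x+z$ for all $x\in\mathcal X$, $z\in\mathbb Z^d$. $\mathcal T=\{(x,K_x):x\in\mathcal X\}$ is called a $\mathbb Z^d$-periodic finite-volume partition of $\mathbb R^d$ if (1) $\bigcup_{x\in\mathcal X}\overline{K_x}=\mathbb R^d$; (2) $K_x\cap K_y=\emptyset$ whenever $x\ne y$; (3) $y-x\perp\partial K_x\cap\partial K_y$ whenever $\mathscr H^{d-1}(\partial K_x\cap\partial K_y)>0$. The graph structure: $(x,y)\in\mathcal E$ (also written $x\sim y$) iff $x\ne y$ and $\mathscr H^{d-1}(\partial K_x\cap\partial K_y)>0$. Notation: $|K_x|=\mathscr L^d(K_x)$, $d_{xy}=|y-x|$, $s_{xy}=\mathscr H^{d-1}(\partial K_x\cap\partial K_y)$, $n_{xy}=(y-x)/d_{xy}$. For $x\in\mathcal X$, $x_{\mathsf z}\in\mathbb Z^d$ is the unique vector with $x-x_{\mathsf z}\in[0,1)^d$; $\mathcal X^Q=\{x\in\mathcal X:x_{\mathsf z}=0\}$, $\mathcal E^Q=\{(x,y)\in\mathcal E:x_{\mathsf z}=0\}$. **Energies.** $\mathfrak m:\mathbb R_+\to\mathbb R_+$ is concave and upper semicontinuous, and for $\rho\in\mathbb R_+$, $j\in\mathbb R^d$, $f(\rho,j)=\frac{|j|_2^2}{\mathfrak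 m(\rho)}$ if $\mathfrak m(\rho)>0$, $f(\rho,j)=+\infty$ if $\mathfrak m(\rho)=0$ and $j\ne0$, and $f(\rho,j)=0$ if $\mathfrak m(\rho)=0$ and $j=0$. Admissible versions: for every $(x,y)\in\mathcal E$, $\mathfrak m_{xy}:\mathbb R_+\times\mathbb R_+\to\mathbb R_+$ is a nonnegative concave upper semicontinuous function with $\mathfrak m_{xy}(\rho,\rho)=\mathfrak m(\rho)$ for all $\rho\in\mathbb R_+$; it is always assumed that $\mathfrak m_{xy}(\rho_1,\rho_2)=\mathfrak m_{yx}(\rho_2,\rho_1)$ for all $\rho_1,\rho_2\in\mathbb R_+$. For $m:\mathcal X\to\mathbb R_+$ and antisymmetric $J:\mathcal E\to\mathbb R$, $$F(m,J)=\frac12\sum_{(x,y)\in\mathcal E^Q}\frac{d_{xy}}{s_{xy}}\,\frac{J(x,y)^2}{\mathfrak m_{xy}\big(\frac{m(x)}{|K_x|},\frac{m(y)}{|K_y|}\big)},$$ where, if the denominator $\mathfrak m_{xy}(\cdot,\cdot)$ vanishes, the quotient is $+\infty$ if $J(x,y)\ne0$ and $0$ if $J(x,y)=0$. $\partial^+g(a)=\{p:g(b)\le g(a)+p\cdot(b-a)\ \forall b\in\mathbb R_+^2\}$ denotes the superdifferential of a concave function $g$ on $\mathbb R_+^2$. **Homogenised density.** $f_{\rm hom}(\rho,j)=\inf F(m,J)$ over all $\mathbb Z^d$-periodic $m:\mathcal X\to\mathbb R_+$ with $\sum_{x\in\mathcal X^Q}m(x)=\rho$ and all $\mathbb Z^d$-periodic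 antisymmetric $J:\mathcal E\to\mathbb R$ with $\sum_{y\sim x}J(x,y)=0$ for all $x\in\mathcal X$ and $\frac12\sum_{(x,y)\in\mathcal E^Q}J(x,y)(y_{\mathsf z}-x_{\mathsf z})=j$.
   Formalization: Added: n_xy is the outer normal of K_x on each shared face, and m_{x+z,y+z}=m_xy for all z in Z^d (without these (i), resp. (iii), fails); in (iii) the displayed identity is required only at those ρ>0 with m'(ρ)≠0, where the quotient is defined. *)

theory Defs
  imports "HOL-Analysis.Analysis"
begin

subsection \<open>Hausdorff measure\<close>

text \<open>
  The Hausdorff measure of integer dimension \<open>k\<close>, normalised by the volume of the Euclidean unit
  ball, so that it agrees with Lebesgue measure on \<open>k\<close>-planes and with counting measure for
  \<open>k = 0\<close>. Boundedness of the covering sets is required because \<^const>\<open>diameter\<close> is unspecified on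
  unbounded sets; the empty set must contribute \<open>0\<close> also for \<open>k = 0\<close>, where \<open>0 ^ 0 = 1\<close>.
\<close>

definition hausdorff_gauge :: "nat \<Rightarrow> 'a::metric_space set \<Rightarrow> ennreal" where
  "hausdorff_gauge k C =
     (if C = {} then 0 else ennreal (unit_ball_vol (real k) * (diameter C / 2) ^ k))"

definition hausdorff_content :: "nat \<Rightarrow> real \<Rightarrow> 'a::metric_space set \<Rightarrow> ennreal" where
  "hausdorff_content k \<delta> A =
     (INF C \<in> {C :: nat \<Rightarrow> 'a set. A \<subseteq> (\<Union>i. C i) \<and> (\<forall>i. bounded (C i) \<and> diameter (C i) \<le> \<delta>)}.
        (\<Sum>i. hausdorff_gauge k (C i)))"

definition hausdorff_measure :: "nat \<Rightarrow> 'a::metric_space set \<Rightarrow> ennreal" where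
  "hausdorff_measure k A = (SUP \<delta> \<in> {0<..}. hausdorff_content k \<delta> A)"


subsection \<open>Periodic finite-volume partitions\<close>

definition int_lattice :: "(real ^ 'd) set" where
  "int_lattice = {z. \<forall>i. z $ i \<in> \<int>}"

definition lattice_part :: "real ^ 'd \<Rightarrow> real ^ 'd" where
  "lattice_part x = (\<chi> i. of_int \<lfloor>x $ i\<rfloor>)"

lemma lattice_part_eq_iff:
  "lattice_part x = z \<longleftrightarrow> z \<in> int_lattice \<and> (\<forall>i. 0 \<le> (x - z) $ i \<and> (x - z) $ i < 1)"
proof
  assume "lattice_part x = z"
  then show "z \<in> int_lattice \<and> (\<forall>i. 0 \<le> (x - z) $ i \<and> (x - z) $ i < 1)"
    by (auto simp: lattice_part_def int_lattice_def) linarith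
next
  assume R: "z \<in> int_lattice \<and> (\<forall>i. 0 \<le> (x - z) $ i \<and> (x - z) $ i < 1)"
  have "of_int \<lfloor>x $ i\<rfloor> = z $ i" for i
  proof -
    obtain k :: int where k: "z $ i = of_int k"
      using R unfolding int_lattice_def by (metis Ints_cases mem_Collect_eq)
    moreover have "0 \<le> x $ i - z $ i" "x $ i - z $ i < 1" using R by auto
    ultimately have "\<lfloor>x $ i\<rfloor> = k" by (intro floor_unique) auto
    then show ?thesis using k by simp
  qed
  then show "lattice_part x = z"
    by (simp add: lattice_part_def vec_eq_iff)
qed

definition face :: "(real ^ 'd \<Rightarrow> (real ^ 'd) set) \<Rightarrow> real ^ 'd \<Rightarrow> real ^ 'd \<Rightarrow> (real ^ 'd) set" where
  "face K x y = frontier (K x) \<inter> frontier (K y)"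

definition face_measure :: "(real ^ 'd \<Rightarrow> (real ^ 'd) set) \<Rightarrow> real ^ 'd \<Rightarrow> real ^ 'd \<Rightarrow> ennreal" where
  "face_measure K x y = hausdorff_measure (CARD('d) - 1) (face K x y)"

definition edges ::
  "(real ^ 'd) set \<Rightarrow> (real ^ 'd \<Rightarrow> (real ^ 'd) set) \<Rightarrow> ((real ^ 'd) \<times> (real ^ 'd)) set" where
  "edges X K = {(x, y). x \<in> X \<and> y \<in> X \<and> x \<noteq> y \<and> face_measure K x y > 0}"

definition nbrs ::
  "(real ^ 'd) set \<Rightarrow> (real ^ 'd \<Rightarrow> (real ^ 'd) set) \<Rightarrow> real ^ 'd \<Rightarrow> (real ^ 'd) set" where
  "nbrs X K x = {y. (x, y) \<in> edges X K}"

definition fv_partition :: "(real ^ 'd) set \<Rightarrow> (real ^ 'd \<Rightarrow> (real ^ 'd) set) \<Rightarrow> bool" where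
  "fv_partition X K \<longleftrightarrow>
     countable X \<and> (\<forall>B. bounded B \<longrightarrow> finite (X \<inter> B)) \<and>
     (\<forall>x\<in>X. \<forall>z\<in>int_lattice. x + z \<in> X \<and> K (x + z) = (\<lambda>w. w + z) ` K x) \<and>
     (\<forall>x\<in>X. K x \<noteq> {} \<and> open (K x) \<and> bounded (K x) \<and> convex (K x) \<and> polytope (closure (K x))) \<and>
     (\<Union>x\<in>X. closure (K x)) = UNIV \<and>
     (\<forall>x\<in>X. \<forall>y\<in>X. x \<noteq> y \<longrightarrow> K x \<inter> K y = {}) \<and>
     (\<forall>x\<in>X. \<forall>y\<in>X. x \<noteq> y \<longrightarrow> face_measure K x y > 0 \<longrightarrow>
        (\<forall>a\<in>face K x y. \<forall>b\<in>face K x y. orthogonal (y - x) (a - b)))"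

text \<open>
  The vector \<open>y - x\<close> is an \<^emph>\<open>outer\<close> normal of \<open>K x\<close> at the face shared with \<open>K y\<close>. This is automatic
  when every \<open>x\<close> lies in the closure of its own cell, but it does not follow from \<^const>\<open>fv_partition\<close>,
  which would also allow the centres of two adjacent cells to be exchanged: on the real line, take
  the points \<open>0, 1/3, 2/3\<close> with the cells \<open>(1/3, 2/3), (0, 1/3), (2/3, 1)\<close>, extended periodically.
\<close>

definition outward_oriented :: "(real ^ 'd) set \<Rightarrow> (real ^ 'd \<Rightarrow> (real ^ 'd) set) \<Rightarrow> bool" where
  "outward_oriented X K \<longleftrightarrow>
     (\<forall>(x, y)\<in>edges X K. \<forall>a\<in>K x. \<forall>b\<in>face K x y. (y - x) \<bullet> (a - b) \<le> 0)"

definition vol :: "(real ^ 'd \<Rightarrow> (real ^ 'd) set) \<Rightarrow> real ^ 'd \<Rightarrow> real" where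
  "vol K x = measure lborel (K x)"

definition area :: "(real ^ 'd \<Rightarrow> (real ^ 'd) set) \<Rightarrow> real ^ 'd \<Rightarrow> real ^ 'd \<Rightarrow> real" where
  "area K x y = enn2real (face_measure K x y)"

definition normal :: "real ^ 'd \<Rightarrow> real ^ 'd \<Rightarrow> real ^ 'd" where
  "normal x y = (1 / dist x y) *\<^sub>R (y - x)"

definition outer_prod :: "real ^ 'd \<Rightarrow> real ^ 'd \<Rightarrow> real ^ 'd ^ 'd" where
  "outer_prod u v = (\<chi> i k. u $ i * v $ k)"

definition cellsQ :: "(real ^ 'd) set \<Rightarrow> (real ^ 'd) set" where
  "cellsQ X = {x \<in> X. lattice_part x = 0}"

definition edgesQ ::
  "(real ^ 'd) set \<Rightarrow> (real ^ 'd \<Rightarrow> (real ^ 'd) set) \<Rightarrow> ((real ^ 'd) \<times> (real ^ 'd)) set" where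
  "edgesQ X K = {(x, y) \<in> edges X K. lattice_part x = 0}"


subsection \<open>Mobilities and energies\<close>

text \<open>
  Functions on \<open>[0,\<infinity>)\<close> and on \<open>[0,\<infinity>) \<times> [0,\<infinity>)\<close> are total functions on \<open>real\<close> and \<open>real \<times> real\<close>
  whose values elsewhere are irrelevant.
\<close>

definition quadrant :: "(real \<times> real) set" where
  "quadrant = {0..} \<times> {0..}"

definition usc_on :: "'a::topological_space set \<Rightarrow> ('a \<Rightarrow> real) \<Rightarrow> bool" where
  "usc_on S g \<longleftrightarrow> (\<forall>a\<in>S. \<forall>c>g a. \<forall>\<^sub>F b in at a within S. g b < c)"

definition mobility :: "(real \<Rightarrow> real) \<Rightarrow> bool" where
  "mobility mob \<longleftrightarrow> (\<forall>\<rho>\<ge>0. mob \<rho> \<ge> 0) \<and> concave_on {0..} mob \<and> usc_on {0..} mob"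

text \<open>
  The last conjunct, periodicity of the edge mobilities, expresses that the whole setting is
  periodic. Without it the energy, which only involves the edges issuing from the unit cube,
  does not determine the mobilities of the remaining edges.
\<close>

definition admissible_mobilities ::
  "(real ^ 'd) set \<Rightarrow> (real ^ 'd \<Rightarrow> (real ^ 'd) set) \<Rightarrow> (real \<Rightarrow> real) \<Rightarrow>
   (real ^ 'd \<Rightarrow> real ^ 'd \<Rightarrow> real \<times> real \<Rightarrow> real) \<Rightarrow> bool" where
  "admissible_mobilities X K mob mobE \<longleftrightarrow>
     (\<forall>(x, y)\<in>edges X K.
        (\<forall>r\<in>quadrant. mobE x y r \<ge> 0) \<and>
        concave_on quadrant (mobE x y) \<and> usc_on quadrant (mobE x y) \<and>
        (\<forall>\<rho>\<ge>0. mobE x y (\<rho>, \<rho>) = mob \<rho>) \<and>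
        (\<forall>\<rho>1\<ge>0. \<forall>\<rho>2\<ge>0. mobE x y (\<rho>1, \<rho>2) = mobE y x (\<rho>2, \<rho>1)) \<and>
        (\<forall>z\<in>int_lattice. \<forall>r\<in>quadrant. mobE (x + z) (y + z) r = mobE x y r))"

definition superdiff :: "(real \<times> real \<Rightarrow> real) \<Rightarrow> real \<times> real \<Rightarrow> (real \<times> real) set" where
  "superdiff g a = {p. \<forall>b\<in>quadrant. g b \<le> g a + p \<bullet> (b - a)}"

definition action_quot :: "real \<Rightarrow> real \<Rightarrow> ennreal" where
  "action_quot v \<mu> = (if \<mu> > 0 then ennreal (v / \<mu>) else if v = 0 then 0 else \<infinity>)"

definition action_density :: "(real \<Rightarrow> real) \<Rightarrow> real \<Rightarrow> real ^ 'd \<Rightarrow> ennreal" where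
  "action_density mob \<rho> j = action_quot ((norm j)\<^sup>2) (mob \<rho>)"

definition discrete_energy ::
  "(real ^ 'd) set \<Rightarrow> (real ^ 'd \<Rightarrow> (real ^ 'd) set) \<Rightarrow>
   (real ^ 'd \<Rightarrow> real ^ 'd \<Rightarrow> real \<times> real \<Rightarrow> real) \<Rightarrow>
   (real ^ 'd \<Rightarrow> real) \<Rightarrow> (real ^ 'd \<Rightarrow> real ^ 'd \<Rightarrow> real) \<Rightarrow> ennreal" where
  "discrete_energy X K mobE m J =
     (\<Sum>(x, y)\<in>edgesQ X K. ennreal (dist x y / area K x y) *
        action_quot ((J x y)\<^sup>2) (mobE x y (m x / vol K x, m y / vol K y))) / 2"

definition competitor ::
  "(real ^ 'd) set \<Rightarrow> (real ^ 'd \<Rightarrow> (real ^ 'd) set) \<Rightarrow> real \<Rightarrow> real ^ 'd \<Rightarrow>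
   (real ^ 'd \<Rightarrow> real) \<Rightarrow> (real ^ 'd \<Rightarrow> real ^ 'd \<Rightarrow> real) \<Rightarrow> bool" where
  "competitor X K \<rho> j m J \<longleftrightarrow>
     (\<forall>x\<in>X. m x \<ge> 0 \<and> (\<forall>z\<in>int_lattice. m (x + z) = m x)) \<and>
     (\<Sum>x\<in>cellsQ X. m x) = \<rho> \<and>
     (\<forall>(x, y)\<in>edges X K. J y x = - J x y \<and> (\<forall>z\<in>int_lattice. J (x + z) (y + z) = J x y)) \<and>
     (\<forall>x\<in>X. (\<Sum>y\<in>nbrs X K x. J x y) = 0) \<and>
     (1 / 2) *\<^sub>R (\<Sum>(x, y)\<in>edgesQ X K. J x y *\<^sub>R (lattice_part y - lattice_part x)) = j"

definition f_hom ::
  "(real ^ 'd) set \<Rightarrow> (real ^ 'd \<Rightarrow> (real ^ 'd) set) \<Rightarrow>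
   (real ^ 'd \<Rightarrow> real ^ 'd \<Rightarrow> real \<times> real \<Rightarrow> real) \<Rightarrow> real \<Rightarrow> real ^ 'd \<Rightarrow> ennreal" where
  "f_hom X K mobE \<rho> j = (INF (m, J) \<in> {(m, J). competitor X K \<rho> j m J}. discrete_energy X K mobE m J)"

end

theory Submission
  imports Defs
begin

text \<open>
  The uniform flux through the faces, \<open>J(x,y) = s_xy (n_xy \<bullet> j)\<close>, with mass proportional to the cell volumes is a
  competitor with energy \<open>|j|\<^sup>2 / m(\<rho>)\<close>, because \<open>\<Sum> s_xy n_xy = 0\<close> on every cell and
  \<open>\<Sum> s_xy (n_xy \<bullet> j) (y - x) = 2 j\<close> over a period. Both identities come from moving the cells by a small vector
  \<open>t e\<close>: the part of \<open>K x + t e\<close> inside \<open>K y\<close> has volume \<open>t s_xy (n_xy \<bullet> e)\<^sup>+ + o(t)\<close>, translation preserves the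
  volume of \<open>K x\<close>, and the piecewise constant map with value \<open>x\<close> on \<open>K x\<close> is displaced by \<open>t e\<close> on average.
  The first order term involves the Hausdorff measure of a convex subset of a hyperplane, which equals its Lebesgue
  measure by the isodiametric inequality (Steiner symmetrisation) and the Vitali covering theorem.

  The lower bound follows from \<open>v\<^sup>2 / \<mu> \<ge> 2 a v - a\<^sup>2 \<mu>\<close> with \<open>a\<close> taken from the uniform flux, as soon as the mean of
  \<open>m_xy - m(\<rho>)\<close>, weighted by \<open>d_xy s_xy (n_xy \<bullet> j)\<^sup>2\<close>, is nonpositive. The supergradients in (ii) need not be
  periodic; averaging them over large boxes of the lattice makes them so up to a boundary term. For the converse in
  (iii) the uniform flux must be optimal among perturbations of the mass, and the first variation of
  \<open>F\<close> in the densities is the balance condition tested against all mean zero densities.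
\<close>

section \<open>Hausdorff measure under isometries\<close>

text \<open>The lower bound works because of its cross term. For
  \<open>a = uniform_flux / mob\<close> the factor \<open>dist x y / area K x y\<close> cancels the
  area, and what remains is the sum of \<open>J x y * ((y - x) \<bullet> j)\<close>, which is the
  same for all competitors. Their constraint is written with lattice parts, but these may be
  replaced by the points: the difference is the gradient of a periodic function, and
  \<open>J\<close> is divergence free. Orientation enters where two cells are separated by a
  hyperplane: its unit normal has to be identified, sign included, with the direction of
  \<open>y - x\<close>. Vanishing mobilities are governed by concavity: a zero of an edge mobility
  at an interior point makes it vanish everywhere, so for \<open>j \<noteq> 0\<close> the energy and
  the density are infinite together. In (iii) nothing is demanded where m' vanishes; there the
  partial derivatives, nonnegative with sum m', are 0 and the balance is trivial. For the converse
  in (iii) one test density suffices, the deviation of the balance per volume from its mean: the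
  first variation then says that its volume-weighted square sum is 0.\<close>

lemma hausdorff_gauge_mono:
  assumes "bounded C" "C \<noteq> {} \<Longrightarrow> D \<noteq> {}" "diameter C \<le> diameter D"
  shows "hausdorff_gauge k C \<le> hausdorff_gauge k D"
  using assms unfolding hausdorff_gauge_def
  by (auto intro!: ennreal_leI mult_left_mono power_mono divide_right_mono
      simp: diameter_ge_0 unit_ball_vol_nonneg)

lemma diameter_isometric_image:
  assumes "\<And>x y. dist (f x) (f y) = dist x y"
  shows "diameter (f ` C) = diameter C"
proof -
  have "(SUP (x,y)\<in>f ` C \<times> f ` C. dist x y) = (SUP (x,y)\<in>C \<times> C. dist x y)"
    by (rule arg_cong[where f = Sup]) (force simp: assms image_iff)
  then show ?thesis by (simp add: diameter_def)
qed

lemma bounded_isometric_image: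
  assumes "\<And>x y. dist (f x) (f y) = dist x y"
  shows "bounded (f ` C) \<longleftrightarrow> bounded C"
proof
  assume "bounded (f ` C)"
  then obtain e where "\<forall>x\<in>C. \<forall>y\<in>C. dist x y \<le> e"
    unfolding bounded_two_points by (auto simp: assms)
  then show "bounded C" unfolding bounded_two_points by blast
next
  assume "bounded C"
  then obtain e where "\<forall>x\<in>C. \<forall>y\<in>C. dist x y \<le> e"
    unfolding bounded_two_points by auto
  then show "bounded (f ` C)" unfolding bounded_two_points by (intro exI[of _ e]) (auto simp: assms)
qed

lemma hausdorff_content_isometric_image:
  assumes f: "\<And>x y. dist (f x) (f y) = dist x y"
  shows "hausdorff_content k \<delta> (f ` A) = hausdorff_content k \<delta> A"
proof (rule antisym)
  show "hausdorff_content k \<delta> (f ` A) \<le> hausdorff_content k \<delta> A"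
    unfolding hausdorff_content_def
  proof (rule INF_mono, safe)
    fix C :: "nat \<Rightarrow> _" assume C: "A \<subseteq> (\<Union>i. C i)" "\<forall>i. bounded (C i) \<and> diameter (C i) \<le> \<delta>"
    show "\<exists>D\<in>{D. f ` A \<subseteq> (\<Union>i. D i) \<and> (\<forall>i. bounded (D i) \<and> diameter (D i) \<le> \<delta>)}.
      (\<Sum>i. hausdorff_gauge k (D i)) \<le> (\<Sum>i. hausdorff_gauge k (C i))"
    proof (intro bexI[of _ "\<lambda>i. f ` C i"] suminf_le)
      have "f ` A \<subseteq> (\<Union>i. f ` C i)" using C(1) by blast
      then show "(\<lambda>i. f ` C i) \<in> {D. f ` A \<subseteq> (\<Union>i. D i) \<and> (\<forall>i. bounded (D i) \<and> diameter (D i) \<le> \<delta>)}"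
        using C(2) by (simp add: diameter_isometric_image[OF f] bounded_isometric_image[OF f])
    qed (auto simp: diameter_isometric_image[OF f] hausdorff_gauge_def)
  qed
  show "hausdorff_content k \<delta> A \<le> hausdorff_content k \<delta> (f ` A)"
    unfolding hausdorff_content_def
  proof (rule INF_mono, safe)
    fix C :: "nat \<Rightarrow> _" assume C: "f ` A \<subseteq> (\<Union>i. C i)" "\<forall>i. bounded (C i) \<and> diameter (C i) \<le> \<delta>"
    \<comment> \<open>\<open>f\<close> need not be onto, as for the embedding of a hyperplane.
      Covers of the image are therefore pulled back by preimages, whose images lie in the given
      sets, so that no diameter grows.\<close>
    have cov: "A \<subseteq> (\<Union>i. f -` C i)" using C(1) by blast
    have im: "f ` (f -` C i) \<subseteq> C i" for i by auto
    have b: "bounded (f -` C i)" and d: "diameter (f -` C i) \<le> diameter (C i)" for i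
      using C(2) im[of i] bounded_isometric_image[OF f, of "f -` C i"] bounded_subset
        diameter_isometric_image[OF f, of "f -` C i"] diameter_subset by metis+
    show "\<exists>D\<in>{D. A \<subseteq> (\<Union>i. D i) \<and> (\<forall>i. bounded (D i) \<and> diameter (D i) \<le> \<delta>)}.
      (\<Sum>i. hausdorff_gauge k (D i)) \<le> (\<Sum>i. hausdorff_gauge k (C i))"
    proof (intro bexI[of _ "\<lambda>i. f -` C i"] suminf_le hausdorff_gauge_mono)
      show "(\<lambda>i. f -` C i) \<in> {D. A \<subseteq> (\<Union>i. D i) \<and> (\<forall>i. bounded (D i) \<and> diameter (D i) \<le> \<delta>)}"
        using cov b order_trans[OF d] C(2) by simp
    qed (use b d in auto)
  qed
qed

lemma hausdorff_measure_isometric_image: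
  assumes f: "\<And>x y. dist (f x) (f y) = dist x y"
  shows "hausdorff_measure k (f ` A) = hausdorff_measure k A"
  by (simp add: hausdorff_measure_def hausdorff_content_isometric_image[OF f])

lemma hausdorff_content_le_suminf:
  assumes "A \<subseteq> (\<Union>i. C i)" "\<And>i::nat. bounded (C i)" "\<And>i. diameter (C i) \<le> \<delta>"
  shows "hausdorff_content k \<delta> A \<le> (\<Sum>i. hausdorff_gauge k (C i))"
  unfolding hausdorff_content_def using assms by (intro INF_lower) auto

text \<open>Covers in the definition are sequences. A countable index set is embedded into the
  naturals, and the free indices receive the empty set, which has gauge 0 even for
  \<open>k = 0\<close> and diameter 0, whence \<open>0 \<le> \<delta>\<close>.\<close>

lemma hausdorff_content_le_count_space:
  assumes I: "countable I" and cov: "A \<subseteq> (\<Union>i\<in>I. C i)"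
    and C: "\<And>i. i \<in> I \<Longrightarrow> bounded (C i) \<and> diameter (C i) \<le> \<delta>" and "0 \<le> \<delta>"
  shows "hausdorff_content k \<delta> A \<le> (\<integral>\<^sup>+i. hausdorff_gauge k (C i) \<partial>count_space I)"
proof -
  define J where "J = to_nat_on I ` I"
  define D where "D n = (if n \<in> J then C (the_inv_into I (to_nat_on I) n) else {})" for n
  have inj: "inj_on (to_nat_on I) I" by (rule inj_on_to_nat_on[OF I])
  have "A \<subseteq> (\<Union>n. D n)"
  proof
    fix x assume "x \<in> A"
    then obtain i where "i \<in> I" "x \<in> C i" using cov by auto
    then have "x \<in> D (to_nat_on I i)" by (simp add: D_def J_def the_inv_into_f_f[OF inj])
    then show "x \<in> (\<Union>n. D n)" by auto
  qed
  moreover have "bounded (D n)" "diameter (D n) \<le> \<delta>" for n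
    using C the_inv_into_into[OF inj, of n I] \<open>0 \<le> \<delta>\<close> by (auto simp: D_def J_def the_inv_into_f_f[OF inj])
  ultimately have "hausdorff_content k \<delta> A \<le> (\<Sum>n. hausdorff_gauge k (D n))"
    by (rule hausdorff_content_le_suminf)
  also have "\<dots> = (\<integral>\<^sup>+n. hausdorff_gauge k (D n) \<partial>count_space UNIV)"
    by (simp add: nn_integral_count_space_nat)
  also have "\<dots> = (\<integral>\<^sup>+n. hausdorff_gauge k (D n) \<partial>count_space J)"
    by (subst (2) nn_integral_count_space_indicator) (auto intro!: nn_integral_cong simp: D_def hausdorff_gauge_def indicator_def)
  also have "\<dots> = (\<integral>\<^sup>+i. hausdorff_gauge k (D (to_nat_on I i)) \<partial>count_space I)"
    by (rule nn_integral_bij_count_space[symmetric]) (auto simp: J_def bij_betw_def inj)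
  also have "\<dots> = (\<integral>\<^sup>+i. hausdorff_gauge k (C i) \<partial>count_space I)"
    by (rule nn_integral_cong) (simp add: D_def J_def the_inv_into_f_f[OF inj])
  finally show ?thesis .
qed

text \<open>Strict bounds provide actual covers with smaller gauge sums, although the infimum need
  not be attained; the two covers are joined along the index set
  \<open>bool \<times> nat\<close>.\<close>

lemma hausdorff_content_Un_le:
  assumes "0 \<le> \<delta>" "hausdorff_content k \<delta> A < a" "hausdorff_content k \<delta> B < b"
  shows "hausdorff_content k \<delta> (A \<union> B) \<le> a + b"
proof -
  obtain C where C: "A \<subseteq> (\<Union>i. C i)" "\<And>i. bounded (C i) \<and> diameter (C i) \<le> \<delta>"
    "(\<Sum>i. hausdorff_gauge k (C i)) < a"
    using assms(2) unfolding hausdorff_content_def INF_less_iff by auto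
  obtain D where D: "B \<subseteq> (\<Union>i. D i)" "\<And>i. bounded (D i) \<and> diameter (D i) \<le> \<delta>"
    "(\<Sum>i. hausdorff_gauge k (D i)) < b"
    using assms(3) unfolding hausdorff_content_def INF_less_iff by auto
  let ?E = "\<lambda>p::bool \<times> nat. if fst p then C (snd p) else D (snd p)"
  have "A \<union> B \<subseteq> (\<Union>p. ?E p)"
  proof
    fix x assume "x \<in> A \<union> B"
    then obtain i where "x \<in> C i \<or> x \<in> D i"
      using C(1) D(1) by auto
    then show "x \<in> (\<Union>p. ?E p)"
      using UN_I[of "(True, i)" UNIV x ?E] UN_I[of "(False, i)" UNIV x ?E] by auto
  qed
  then have "hausdorff_content k \<delta> (A \<union> B) \<le> (\<integral>\<^sup>+p. hausdorff_gauge k (?E p) \<partial>count_space UNIV)"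
    using C D assms(1) by (intro hausdorff_content_le_count_space) auto
  also have "\<dots> = (\<integral>\<^sup>+ t. \<integral>\<^sup>+ i. hausdorff_gauge k (?E (t, i)) \<partial>count_space UNIV \<partial>count_space UNIV)"
    by (rule nn_integral_fst_count_space[symmetric])
  also have "\<dots> = (\<Sum>i. hausdorff_gauge k (C i)) + (\<Sum>i. hausdorff_gauge k (D i))"
    by (simp add: nn_integral_count_space_finite UNIV_bool nn_integral_count_space_nat)
  also have "\<dots> \<le> a + b" using C(3) D(3) by (intro add_mono) auto
  finally show ?thesis .
qed

section \<open>The isodiametric inequality\<close>

text \<open>Length in the parameter \<open>s\<close>, not in space: the factor \<open>norm b\<close>
  is left out, which suits the oblique directions used later for prisms.\<close>

definition slice_length :: "'a::euclidean_space set \<Rightarrow> 'a \<Rightarrow> 'a \<Rightarrow> ennreal" where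
  "slice_length A b v = emeasure lborel {s::real. v + s *\<^sub>R b \<in> A}"

section \<open>Translation invariance and Fubini along parallel lines\<close>

lemma emeasure_lborel_translate:
  assumes "T \<in> sets borel"
  shows "emeasure lborel {v::'a::euclidean_space. v + a \<in> T} = emeasure lborel T"
proof -
  have "emeasure lborel T = emeasure (distr lborel borel ((+) a)) T"
    by (simp add: lborel_distr_plus)
  also have "\<dots> = emeasure lborel {v. v + a \<in> T}"
    using assms by (subst emeasure_distr) (auto simp: vimage_def add.commute)
  finally show ?thesis by simp
qed

lemma emeasure_lborel_translation_image:
  "emeasure lborel ((\<lambda>w::'a::euclidean_space. w + a) ` A) = emeasure lborel A" if "A \<in> sets borel"
proof -
  have "(\<lambda>w. w + a) ` A = {v. v + (-a) \<in> A}" by (auto simp: image_iff) (metis diff_add_cancel)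
  then show ?thesis using emeasure_lborel_translate[OF that, of "-a"] by simp
qed

lemma nn_integral_lborel_translate:
  fixes f :: "'a::euclidean_space \<Rightarrow> ennreal"
  assumes [measurable]: "f \<in> borel_measurable borel"
  shows "(\<integral>\<^sup>+v. f (v + a) \<partial>lborel) = (\<integral>\<^sup>+v. f v \<partial>lborel)"
proof -
  have "(\<integral>\<^sup>+v. f v \<partial>lborel) = (\<integral>\<^sup>+v. f v \<partial>distr lborel borel ((+) a))"
    by (simp add: lborel_distr_plus)
  also have "\<dots> = (\<integral>\<^sup>+v. f (v + a) \<partial>lborel)"
    by (subst nn_integral_distr) (auto simp: add.commute)
  finally show ?thesis by simp
qed

lemma sets_slice [measurable]:
  fixes v :: "'a::euclidean_space"
  shows "A \<in> sets borel \<Longrightarrow> {s::real. v + s *\<^sub>R b \<in> A} \<in> sets borel"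
proof -
  assume "A \<in> sets borel"
  moreover have "(\<lambda>s::real. v + s *\<^sub>R b) \<in> borel_measurable borel"
    by (intro borel_measurable_continuous_onI continuous_intros)
  ultimately have "(\<lambda>s::real. v + s *\<^sub>R b) -` A \<inter> space borel \<in> sets borel"
    by (rule measurable_sets[rotated])
  then show ?thesis by (simp add: vimage_def)
qed

lemma slice_length_conv_nn_integral:
  assumes "A \<in> sets borel"
  shows "slice_length A b v = (\<integral>\<^sup>+s. indicator A (v + s *\<^sub>R b) \<partial>lborel)"
proof -
  have "slice_length A b v = (\<integral>\<^sup>+s. indicator {s::real. v + s *\<^sub>R b \<in> A} s \<partial>lborel)"
    using sets_slice[OF assms] by (simp add: slice_length_def)
  also have "\<dots> = (\<integral>\<^sup>+s. indicator A (v + s *\<^sub>R b) \<partial>lborel)"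
    by (intro nn_integral_cong) (auto simp: indicator_def)
  finally show ?thesis .
qed

lemma borel_measurable_slice_length [measurable]:
  fixes A :: "'a::euclidean_space set"
  assumes [measurable]: "A \<in> sets borel"
  shows "slice_length A b \<in> borel_measurable borel"
proof -
  have "(\<lambda>v. \<integral>\<^sup>+s. indicator A (v + s *\<^sub>R b) \<partial>(lborel::real measure)) \<in> borel_measurable borel"
    by measurable
  then show ?thesis by (simp add: slice_length_conv_nn_integral[OF assms, abs_def])
qed

lemma slice_length_translate:
  assumes "A \<in> sets borel"
  shows "slice_length A b (v + a *\<^sub>R b) = slice_length A b v"
  using emeasure_lborel_translate[OF sets_slice[OF assms, of v b], of a]
  by (simp add: slice_length_def algebra_simps)

text \<open>
  Fubini in the direction \<open>b\<close> without a choice of coordinates: the slab meets every line in direction \<open>b\<close> in a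
  segment of parameter length \<open>1\<close>.
\<close>

lemma emeasure_slab_slices:
  fixes A :: "'a::euclidean_space set"
  assumes [measurable]: "A \<in> sets borel" and \<tau>: "b \<bullet> n = \<tau>" "\<tau> > 0"
  shows "emeasure lborel A =
    (\<integral>\<^sup>+v. indicator {v. c \<le> v \<bullet> n \<and> v \<bullet> n \<le> c + \<tau>} v * slice_length A b v \<partial>lborel)"
proof -
  define S where "S = {v. c \<le> v \<bullet> n \<and> v \<bullet> n \<le> c + \<tau>}"
  have "closed S" unfolding S_def
    by (intro closed_Collect_conj closed_Collect_le continuous_intros)
  then have [measurable]: "S \<in> sets borel" by simp
  have "(\<integral>\<^sup>+v. indicator S v * slice_length A b v \<partial>lborel) =
      (\<integral>\<^sup>+v. (\<integral>\<^sup>+s. indicator S v * indicator A (v + s *\<^sub>R b) \<partial>lborel) \<partial>(lborel::'a measure))"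
    by (simp add: slice_length_conv_nn_integral nn_integral_cmult)
  also have "\<dots> = (\<integral>\<^sup>+s. (\<integral>\<^sup>+v. indicator S v * indicator A (v + s *\<^sub>R b) \<partial>(lborel::'a measure)) \<partial>(lborel::real measure))"
    by (rule lborel_pair.Fubini') (simp add: split_beta')
  also have "\<dots> = (\<integral>\<^sup>+s. (\<integral>\<^sup>+v. indicator S (v - s *\<^sub>R b) * indicator A v \<partial>(lborel::'a measure)) \<partial>(lborel::real measure))"
  proof (rule nn_integral_cong)
    fix s :: real
    show "(\<integral>\<^sup>+v. indicator S v * indicator A (v + s *\<^sub>R b) \<partial>(lborel::'a measure)) =
        (\<integral>\<^sup>+v. indicator S (v - s *\<^sub>R b) * indicator A v \<partial>lborel)"
      using nn_integral_lborel_translate[of "\<lambda>v. indicator S (v - s *\<^sub>R b) * indicator A v" "s *\<^sub>R b"]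
      by simp
  qed
  also have "\<dots> = (\<integral>\<^sup>+v. (\<integral>\<^sup>+s. indicator S (v - s *\<^sub>R b) * indicator A v \<partial>(lborel::real measure)) \<partial>(lborel::'a measure))"
    by (rule lborel_pair.Fubini'[symmetric]) (simp add: split_beta')
  also have "\<dots> = (\<integral>\<^sup>+v. indicator A v \<partial>lborel)"
  proof (rule nn_integral_cong)
    fix v :: 'a
    have "(\<integral>\<^sup>+s. indicator S (v - s *\<^sub>R b) \<partial>(lborel::real measure)) =
        (\<integral>\<^sup>+s. indicator {(v \<bullet> n - c) / \<tau> - 1 .. (v \<bullet> n - c) / \<tau>} s \<partial>(lborel::real measure))"
      using \<tau> by (intro nn_integral_cong) (auto simp: S_def indicator_def inner_diff_left field_simps)
    also have "\<dots> = 1" by simp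
    finally show "(\<integral>\<^sup>+s. indicator S (v - s *\<^sub>R b) * indicator A v \<partial>(lborel::real measure)) = indicator A v"
      by (simp add: nn_integral_multc)
  qed
  finally show ?thesis by (simp add: S_def)
qed

section \<open>Steiner symmetrisation\<close>

text \<open>The strict inequality removes the lines that miss \<open>A\<close>, so that the diameter does not increase.\<close>

definition steiner :: "'a::euclidean_space \<Rightarrow> 'a set \<Rightarrow> 'a set" where
  "steiner b A = {v. ennreal (2 * \<bar>v \<bullet> b\<bar>) < slice_length A b v}"

lemma sets_steiner [measurable]:
  assumes [measurable]: "A \<in> sets borel"
  shows "steiner b A \<in> sets borel"
proof -
  have "{v \<in> space borel. ennreal (2 * \<bar>v \<bullet> b\<bar>) < slice_length A b v} \<in> sets borel"
    by measurable
  then show ?thesis by (simp add: steiner_def)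
qed

lemma bounded_slice:
  assumes "bounded A" "norm b = 1"
  shows "bounded {s::real. v + s *\<^sub>R b \<in> A}"
proof -
  obtain B where B: "\<And>x. x \<in> A \<Longrightarrow> norm x \<le> B" using assms(1) by (auto simp: bounded_iff)
  have "\<bar>s\<bar> \<le> B + norm v" if "v + s *\<^sub>R b \<in> A" for s
    using B[OF that] norm_triangle_ineq4[of "v + s *\<^sub>R b" v] assms(2) by simp
  then show ?thesis by (auto simp: bounded_iff)
qed

lemma slice_length_finite:
  assumes "A \<in> sets borel" "bounded A" "norm b = 1"
  shows "slice_length A b v < \<infinity>"
proof -
  obtain B where "\<forall>s\<in>{s::real. v + s *\<^sub>R b \<in> A}. norm s \<le> B"
    using bounded_slice[OF assms(2,3), of v] unfolding bounded_iff by blast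
  then have "{s::real. v + s *\<^sub>R b \<in> A} \<subseteq> cball 0 B"
    by (simp only: subset_iff mem_cball_0) simp
  then have "slice_length A b v \<le> emeasure lborel (cball (0::real) B)"
    unfolding slice_length_def by (rule emeasure_mono) simp
  also have "\<dots> < \<infinity>" by (rule emeasure_lborel_cball_finite)
  finally show ?thesis .
qed

text \<open>The slice length \<open>L\<close> is constant along a line in direction
  \<open>b\<close>, so the line meets the symmetrised set in the open interval of length
  \<open>L\<close> centred at its point orthogonal to \<open>b\<close>; for \<open>L = 0\<close> the
  interval is empty.\<close>

lemma slice_length_steiner:
  fixes A :: "'a::euclidean_space set"
  assumes A: "A \<in> sets borel" "bounded A" and b: "norm b = 1"
  shows "slice_length (steiner b A) b v = slice_length A b v"
proof -
  have bb: "b \<bullet> b = 1" using b by (simp add: norm_eq_1)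
  obtain L where L: "slice_length A b v = ennreal L" "L \<ge> 0"
    using slice_length_finite[OF A b, of v] by (cases "slice_length A b v") auto
  have "slice_length (steiner b A) b v = emeasure lborel {- L / 2 - v \<bullet> b <..< L / 2 - v \<bullet> b}"
    unfolding slice_length_def[of "steiner b A"]
    by (rule arg_cong[where f = "emeasure lborel"])
      (auto simp: steiner_def slice_length_translate[OF A(1)] L ennreal_less_iff inner_add_left bb abs_if split: if_splits)
  also have "\<dots> = ennreal L" using L(2) by (subst emeasure_lborel_Ioo) (auto simp: field_simps)
  finally show ?thesis by (simp add: L)
qed

lemma emeasure_steiner:
  fixes A :: "'a::euclidean_space set"
  assumes A: "A \<in> sets borel" "bounded A" and b: "norm b = 1"
  shows "emeasure lborel (steiner b A) = emeasure lborel A"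
proof -
  have bb: "b \<bullet> b = 1" using b by (simp add: norm_eq_1)
  show ?thesis
    using emeasure_slab_slices[OF A(1) bb, of 0] emeasure_slab_slices[OF sets_steiner[OF A(1)] bb, of b 0]
    by (simp add: slice_length_steiner[OF A b])
qed

lemma emeasure_le_Sup_minus_Inf:
  fixes T :: "real set"
  assumes "bounded T" "T \<noteq> {}"
  shows "emeasure lborel T \<le> ennreal (Sup T - Inf T)"
proof -
  have "bdd_above T" "bdd_below T" using assms(1) bounded_imp_bdd_above bounded_imp_bdd_below by auto
  then have "T \<subseteq> {Inf T..Sup T}" by (auto intro: cInf_lower cSup_upper)
  then have "emeasure lborel T \<le> emeasure lborel {Inf T..Sup T}" by (rule emeasure_mono) simp
  also have "\<dots> \<le> ennreal (Sup T - Inf T)" by (simp add: emeasure_lborel_Icc_eq)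
  finally show ?thesis .
qed

text \<open>The lines through \<open>p\<close> and \<open>q\<close> meet \<open>A\<close> in
  parameter sets whose spans exceed twice the absolute heights of \<open>p\<close> and
  \<open>q\<close> along \<open>b\<close>. If all pairs of points of \<open>A\<close> on the two
  lines differed in height by less than \<delta>, the inequalities between suprema and infima would
  add up to spans of total at most 2 \<delta>, and 2 \<delta> does not exceed twice the sum of the
  absolute heights. So some pair in \<open>A\<close> is at least as far apart in height, with the
  same component orthogonal to \<open>b\<close>.\<close>

lemma steiner_dist_le:
  fixes A :: "'a::euclidean_space set"
  assumes A: "A \<in> sets borel" "bounded A" and b: "norm b = 1"
    and D: "\<And>x y. x \<in> A \<Longrightarrow> y \<in> A \<Longrightarrow> dist x y \<le> D"
    and p: "p \<in> steiner b A" and q: "q \<in> steiner b A"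
  shows "dist p q \<le> D"
proof -
  have bb: "b \<bullet> b = 1" using b by (simp add: norm_eq_1)
  define T where "T u = {s::real. u + s *\<^sub>R b \<in> A}" for u
  have T: "bounded (T u)" for u unfolding T_def by (rule bounded_slice[OF A(2) b])
  have sl: "slice_length A b u = emeasure lborel (T u)" for u by (simp add: slice_length_def T_def)
  have ne: "T u \<noteq> {}" and len: "2 * \<bar>u \<bullet> b\<bar> < Sup (T u) - Inf (T u)" if u: "u \<in> steiner b A" for u
  proof -
    show "T u \<noteq> {}" using u by (auto simp: steiner_def sl)
    have "ennreal (2 * \<bar>u \<bullet> b\<bar>) < emeasure lborel (T u)" using u by (simp add: steiner_def sl)
    also note emeasure_le_Sup_minus_Inf[OF T \<open>T u \<noteq> {}\<close>]
    finally show "2 * \<bar>u \<bullet> b\<bar> < Sup (T u) - Inf (T u)" by (simp add: ennreal_less_iff)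
  qed
  define \<delta> where "\<delta> = \<bar>p \<bullet> b - q \<bullet> b\<bar>"
  have "\<exists>s\<in>T p. \<exists>s'\<in>T q. \<delta> \<le> \<bar>(p \<bullet> b + s) - (q \<bullet> b + s')\<bar>"
  proof (rule ccontr)
    assume "\<not> ?thesis"
    then have far: "\<not> \<delta> \<le> \<bar>(p \<bullet> b + s) - (q \<bullet> b + s')\<bar>" if "s \<in> T p" "s' \<in> T q" for s s'
      using that by blast
    then have lt: "s \<le> \<delta> - p \<bullet> b + q \<bullet> b + s'" "s' \<le> \<delta> + p \<bullet> b - q \<bullet> b + s"
      if "s \<in> T p" "s' \<in> T q" for s s'
      using far[OF that] by linarith+
    have "Sup (T p) \<le> \<delta> - p \<bullet> b + q \<bullet> b + s'" if "s' \<in> T q" for s'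
      using lt(1)[OF _ that] by (rule cSup_least[OF ne[OF p]])
    from this have "Sup (T p) - \<delta> + p \<bullet> b - q \<bullet> b \<le> s'" if "s' \<in> T q" for s'
      using that by fastforce
    then have "Sup (T p) - \<delta> + p \<bullet> b - q \<bullet> b \<le> Inf (T q)"
      by (rule cInf_greatest[OF ne[OF q]])
    moreover have "Sup (T q) \<le> \<delta> + p \<bullet> b - q \<bullet> b + s" if "s \<in> T p" for s
      using lt(2)[OF that] by (rule cSup_least[OF ne[OF q]])
    from this have "Sup (T q) - \<delta> - p \<bullet> b + q \<bullet> b \<le> s" if "s \<in> T p" for s
      using that by fastforce
    then have "Sup (T q) - \<delta> - p \<bullet> b + q \<bullet> b \<le> Inf (T p)"
      by (rule cInf_greatest[OF ne[OF p]])
    ultimately show False using len[OF p] len[OF q] unfolding \<delta>_def by linarith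
  qed
  then obtain s s' where s: "s \<in> T p" "s' \<in> T q" "\<delta> \<le> \<bar>(p \<bullet> b + s) - (q \<bullet> b + s')\<bar>" by auto
  \<comment> \<open>Pythagoras with respect to \<open>b\<close>: a shift along \<open>b\<close>
    changes only the component in direction \<open>b\<close>.\<close>
  have sq: "(norm (w + r *\<^sub>R b))\<^sup>2 = (norm w)\<^sup>2 - (w \<bullet> b)\<^sup>2 + (w \<bullet> b + r)\<^sup>2" for w :: 'a and r
    unfolding power2_norm_eq_inner
    by (simp add: inner_add_left inner_add_right bb inner_commute power2_eq_square algebra_simps)
  have "\<delta>\<^sup>2 \<le> ((p \<bullet> b + s) - (q \<bullet> b + s'))\<^sup>2"
    using power_mono[OF s(3), of 2] by (simp add: \<delta>_def)
  then have "(norm (p - q))\<^sup>2 \<le> (norm ((p - q) + (s - s') *\<^sub>R b))\<^sup>2"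
    unfolding sq by (simp add: \<delta>_def inner_diff_left algebra_simps)
  then have "norm (p - q) \<le> norm ((p - q) + (s - s') *\<^sub>R b)" by (rule power2_le_imp_le) simp
  also have "\<dots> = dist (p + s *\<^sub>R b) (q + s' *\<^sub>R b)" by (simp add: dist_norm algebra_simps)
  also have "\<dots> \<le> D" using s by (intro D) (auto simp: T_def)
  finally show ?thesis by (simp add: dist_norm)
qed

lemma steiner_reflection_self:
  assumes "A \<in> sets borel" "norm b = 1" "v \<in> steiner b A"
  shows "v - (2 * (v \<bullet> b)) *\<^sub>R b \<in> steiner b A"
proof -
  have bb: "b \<bullet> b = 1" using assms(2) by (simp add: norm_eq_1)
  show ?thesis
    using assms(3) slice_length_translate[OF assms(1), of b v "- (2 * (v \<bullet> b))"]
    by (simp add: steiner_def inner_diff_left bb)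
qed

text \<open>The reflection along \<open>c\<close> fixes \<open>b\<close>, so it carries the slice
  through \<open>v\<close> into the slice through the mirror image. Symmetries gained in earlier
  directions therefore survive the symmetrisation in an orthogonal direction.\<close>

lemma steiner_reflection_other:
  fixes A :: "'a::euclidean_space set"
  assumes A: "A \<in> sets borel" and c: "norm c = 1" "b \<bullet> c = 0"
    and R: "\<And>v. v \<in> A \<Longrightarrow> v - (2 * (v \<bullet> c)) *\<^sub>R c \<in> A" and v: "v \<in> steiner b A"
  shows "v - (2 * (v \<bullet> c)) *\<^sub>R c \<in> steiner b A"
proof -
  have cc: "c \<bullet> c = 1" "c \<bullet> b = 0" using c by (auto simp: norm_eq_1 inner_commute)
  have "{s::real. v + s *\<^sub>R b \<in> A} \<subseteq> {s. (v - (2 * (v \<bullet> c)) *\<^sub>R c) + s *\<^sub>R b \<in> A}"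
    using R[of "v + s *\<^sub>R b" for s] by (auto simp: inner_add_left c(2) algebra_simps)
  then have "slice_length A b v \<le> slice_length A b (v - (2 * (v \<bullet> c)) *\<^sub>R c)"
    unfolding slice_length_def by (rule emeasure_mono) (simp add: sets_slice[OF A])
  then show ?thesis using v by (auto simp: steiner_def inner_diff_left cc)
qed

lemma steiner_symmetrise:
  fixes A B :: "'a::euclidean_space set"
  assumes A: "A \<in> sets borel" "bounded A" "\<And>x y. x \<in> A \<Longrightarrow> y \<in> A \<Longrightarrow> dist x y \<le> D"
    and B: "finite B" "B \<subseteq> Basis"
  shows "\<exists>S. S \<in> sets borel \<and> bounded S \<and> (\<forall>x\<in>S. \<forall>y\<in>S. dist x y \<le> D) \<and>
    emeasure lborel S = emeasure lborel A \<and> (\<forall>b\<in>B. \<forall>v\<in>S. v - (2 * (v \<bullet> b)) *\<^sub>R b \<in> S)"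
  using B
proof (induction B rule: finite_induct)
  case empty
  from A have "\<forall>x\<in>A. \<forall>y\<in>A. dist x y \<le> D" by blast
  then show ?case using A(1,2) by blast
next
  case (insert b B)
  then have "B \<subseteq> Basis" by simp
  from insert.IH[OF this]
  obtain S where S: "S \<in> sets borel" "bounded S" "\<forall>x\<in>S. \<forall>y\<in>S. dist x y \<le> D"
    "emeasure lborel S = emeasure lborel A" "\<forall>c\<in>B. \<forall>v\<in>S. v - (2 * (v \<bullet> c)) *\<^sub>R c \<in> S"
    by blast
  have b: "norm b = 1" using insert.prems by simp
  have D': "dist x y \<le> D" if "x \<in> steiner b S" "y \<in> steiner b S" for x y
    using S(3) by (intro steiner_dist_le[OF S(1,2) b _ that]) simp
  show ?case
  proof (intro exI[of _ "steiner b S"] conjI ballI)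
    show "bounded (steiner b S)" unfolding bounded_two_points using D' by blast
    show "emeasure lborel (steiner b S) = emeasure lborel A"
      using emeasure_steiner[OF S(1,2) b] S(4) by simp
    fix c v assume c: "c \<in> insert b B" and v: "v \<in> steiner b S"
    show "v - (2 * (v \<bullet> c)) *\<^sub>R c \<in> steiner b S"
    proof (cases "c = b")
      case True
      then show ?thesis using steiner_reflection_self[OF S(1) b v] by simp
    next
      case False
      then show ?thesis using insert.prems c
        by (intro steiner_reflection_other[OF S(1) _ _ _ v] S(5)[rule_format]) (auto simp: inner_not_same_Basis)
    qed
  qed (use S(1) sets_steiner D' in auto)
qed

text \<open>Composing the reflections in all coordinates makes the symmetrised set invariant under
  negation. Antipodal points are \<open>2 * norm v\<close> apart, so this set lies in the ball of
  radius \<open>diameter A / 2\<close>, although \<open>A\<close> itself need not lie in any ball of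
  that radius.\<close>

theorem isodiametric_inequality:
  fixes A :: "'a::euclidean_space set"
  assumes A: "A \<in> sets borel" "bounded A"
  shows "emeasure lborel A \<le> ennreal (unit_ball_vol DIM('a) * (diameter A / 2) ^ DIM('a))"
proof -
  obtain S :: "'a set" where S: "S \<in> sets borel" "\<forall>x\<in>S. \<forall>y\<in>S. dist x y \<le> diameter A"
    "emeasure lborel S = emeasure lborel A" "\<forall>c\<in>Basis. \<forall>v\<in>S. v - (2 * (v \<bullet> c)) *\<^sub>R c \<in> S"
    using steiner_symmetrise[OF A diameter_bounded_bound[OF A(2)] finite_Basis order_refl] by blast
  have refl: "v - (2::real) *\<^sub>R (\<Sum>c\<in>B. (v \<bullet> c) *\<^sub>R c) \<in> S" if "v \<in> S" "finite B" "B \<subseteq> Basis" for v B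
    using that(2,3)
  proof (induction B rule: finite_induct)
    case (insert b B)
    let ?w = "v - (2::real) *\<^sub>R (\<Sum>c\<in>B. (v \<bullet> c) *\<^sub>R c)"
    \<comment> \<open>The directions reflected so far are orthogonal to \<open>b\<close>, so the
      component along \<open>b\<close> is still that of \<open>v\<close>.\<close>
    have "(\<Sum>c\<in>B. (v \<bullet> c) * (c \<bullet> b)) = 0"
    proof (intro sum.neutral ballI)
      fix c assume "c \<in> B"
      then have "c \<bullet> b = 0" using insert by (intro inner_not_same_Basis) auto
      then show "(v \<bullet> c) * (c \<bullet> b) = 0" by simp
    qed
    then have "?w \<bullet> b = v \<bullet> b" by (simp add: inner_diff_left inner_sum_left)
    then show ?case using S(4)[rule_format, of b ?w] insert by (simp add: algebra_simps)
  qed (use that in simp)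
  have "S \<subseteq> cball 0 (diameter A / 2)"
  proof
    fix v assume v: "v \<in> S"
    have "v - 2 *\<^sub>R v \<in> S" using refl[OF v, of Basis] by (simp add: euclidean_representation)
    moreover have "v - 2 *\<^sub>R v = - v" by (simp add: scaleR_2)
    ultimately have "dist v (- v) \<le> diameter A" using S(2) v by metis
    moreover have "dist v (- v) = 2 * norm v" by (simp add: dist_norm flip: scaleR_2)
    ultimately show "v \<in> cball 0 (diameter A / 2)" by simp
  qed
  then have "emeasure lborel S \<le> emeasure lborel (cball (0::'a) (diameter A / 2))"
    by (rule emeasure_mono) simp
  also have "\<dots> = ennreal (unit_ball_vol DIM('a) * (diameter A / 2) ^ DIM('a))"
    by (rule emeasure_cball) (use diameter_ge_0[OF A(2)] in simp)
  finally show ?thesis using S(3) by simp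
qed

section \<open>Hausdorff and Lebesgue measure\<close>

lemma hausdorff_gauge_cball:
  fixes a :: "'a::euclidean_space"
  assumes "r > 0"
  shows "hausdorff_gauge DIM('a) (cball a r) = emeasure lborel (cball a r)"
  using assms by (simp add: hausdorff_gauge_def emeasure_cball)

text \<open>The isodiametric inequality is applied to each covering set. Covering sets are
  arbitrary; their closures are Borel and have the same diameters. The bound holds at every scale
  \<delta>.\<close>

lemma emeasure_lborel_le_hausdorff_content:
  fixes A :: "'a::euclidean_space set"
  shows "emeasure lborel A \<le> hausdorff_content DIM('a) \<delta> A"
  unfolding hausdorff_content_def
proof (rule INF_greatest, safe)
  fix C :: "nat \<Rightarrow> 'a set"
  assume C: "A \<subseteq> (\<Union>i. C i)" "\<forall>i. bounded (C i) \<and> diameter (C i) \<le> \<delta>"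
  have "A \<subseteq> (\<Union>i. closure (C i))" using C(1) closure_subset by blast
  then have "emeasure lborel A \<le> emeasure lborel (\<Union>i. closure (C i))"
    by (rule emeasure_mono) simp
  also have "\<dots> \<le> (\<Sum>i. emeasure lborel (closure (C i)))"
    by (rule emeasure_subadditive_countably) auto
  also have "\<dots> \<le> (\<Sum>i. hausdorff_gauge DIM('a) (C i))"
  proof (rule suminf_le)
    fix i
    have "bounded (C i)" using C(2) by simp
    then show "emeasure lborel (closure (C i)) \<le> hausdorff_gauge DIM('a) (C i)"
      using isodiametric_inequality[of "closure (C i)"]
      by (simp add: hausdorff_gauge_def diameter_closure bounded_closure)
  qed auto
  finally show "emeasure lborel A \<le> (\<Sum>i. hausdorff_gauge DIM('a) (C i))" .
qed

text \<open>Needed for the exceptional set in the Vitali covering theorem. The covering lemma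
  selects disjoint balls in a small open set \<open>V\<close> whose fivefold enlargements cover
  \<open>Z\<close>. The enlargement multiplies the gauges by \<open>5 ^ DIM('a)\<close>, for which
  the choice of \<open>V\<close> compensates.\<close>

lemma lborel_null_imp_hausdorff_content_0:
  fixes Z :: "'a::euclidean_space set"
  assumes Z: "Z \<in> sets borel" "emeasure lborel Z = 0" and "\<delta> > 0"
  shows "hausdorff_content DIM('a) \<delta> Z = 0"
proof -
  have "hausdorff_content DIM('a) \<delta> Z \<le> 0"
  proof (rule ennreal_le_epsilon)
    fix e :: real assume "e > 0"
    obtain V where V: "open V" "Z \<subseteq> V" "emeasure lborel (V - Z) < ennreal (e / 5 ^ DIM('a))"
      using outer_regular_lborel[OF Z(1), of "e / 5 ^ DIM('a)"] \<open>e > 0\<close> by auto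
    have "emeasure lborel V = emeasure lborel ((V - Z) \<union> Z)"
      using V(2) by (intro arg_cong[where f = "emeasure lborel"]) auto
    also have "\<dots> = emeasure lborel (V - Z)"
      using V Z by (intro emeasure_Un_null_set) (auto simp: null_sets_def)
    finally have V': "emeasure lborel V \<le> ennreal (e / 5 ^ DIM('a))" using V(3) by simp
    \<comment> \<open>The enlarged ball of radius \<open>5 * r\<close> is the one that enters the
      cover, so \<open>10 * r\<close> is the diameter to be controlled.\<close>
    define K where "K = {(a, r). a \<in> Z \<and> 0 < r \<and> 10 * r \<le> \<delta> \<and> cball a r \<subseteq> V}"
    have cov: "Z \<subseteq> (\<Union>i\<in>K. cball (fst i) (snd i))"
    proof
      fix x assume x: "x \<in> Z"
      then obtain r where r: "r > 0" "cball x r \<subseteq> V" using V by (meson open_contains_cball subset_iff)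
      then have "(x, min r (\<delta> / 10)) \<in> K" using x \<open>\<delta> > 0\<close> by (auto simp: K_def)
      then show "x \<in> (\<Union>i\<in>K. cball (fst i) (snd i))"
        using r(1) \<open>\<delta> > 0\<close> by (intro UN_I[of "(x, min r (\<delta> / 10))"]) auto
    qed
    have "0 < snd i \<and> snd i \<le> \<delta>" if "i \<in> K" for i using that by (auto simp: K_def)
    from Vitali_covering_lemma_cballs[OF cov this]
    obtain C where C: "countable C" "C \<subseteq> K"
      "pairwise (\<lambda>i j. disjnt (cball (fst i) (snd i)) (cball (fst j) (snd j))) C"
      "Z \<subseteq> (\<Union>i\<in>C. cball (fst i) (5 * snd i))" .
    have K: "0 < snd i" "10 * snd i \<le> \<delta>" "cball (fst i) (snd i) \<subseteq> V" if "i \<in> C" for i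
      using subsetD[OF C(2) that] by (simp_all add: K_def split_beta)
    have disj: "disjoint_family_on (\<lambda>i. cball (fst i) (snd i)) C"
      using C(3) by (auto simp: disjoint_family_on_def pairwise_def disjnt_def)
    have "hausdorff_content DIM('a) \<delta> Z
        \<le> (\<integral>\<^sup>+i. hausdorff_gauge DIM('a) (cball (fst i) (5 * snd i)) \<partial>count_space C)"
      using K(1,2) \<open>\<delta> > 0\<close> by (intro hausdorff_content_le_count_space C) (auto simp: less_imp_le)
    also have "\<dots> = (\<integral>\<^sup>+i. ennreal (5 ^ DIM('a)) * emeasure lborel (cball (fst i) (snd i)) \<partial>count_space C)"
    proof (rule nn_integral_cong)
      fix i assume "i \<in> space (count_space C)"
      then have "0 < snd i" using K by simp
      then show "hausdorff_gauge DIM('a) (cball (fst i) (5 * snd i)) =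
          ennreal (5 ^ DIM('a)) * emeasure lborel (cball (fst i) (snd i))"
        by (simp add: hausdorff_gauge_cball emeasure_cball power_mult_distrib mult_ac flip: ennreal_mult')
    qed
    also have "\<dots> = ennreal (5 ^ DIM('a)) * emeasure lborel (\<Union>i\<in>C. cball (fst i) (snd i))"
      by (subst nn_integral_cmult) (auto simp: emeasure_UN_countable[OF _ C(1) disj])
    also have "emeasure lborel (\<Union>i\<in>C. cball (fst i) (snd i)) \<le> emeasure lborel V"
      using K(3) V(1) by (intro emeasure_mono) auto
    also note V'
    also have "ennreal (5 ^ DIM('a)) * ennreal (e / 5 ^ DIM('a)) = ennreal e"
      by (simp flip: ennreal_mult')
    finally show "hausdorff_content DIM('a) \<delta> Z \<le> 0 + ennreal e" by (simp add: mult_left_mono)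
  qed
  then show ?thesis by simp
qed

text \<open>Balls are the extremal sets: their gauge is their volume. Small disjoint balls inside
  \<open>U\<close> fill \<open>A\<close> up to a null set at a cost of at most the volume of
  \<open>U\<close>, and the null set costs nothing.\<close>

lemma hausdorff_content_le_emeasure_lborel:
  fixes A :: "'a::euclidean_space set"
  assumes A: "A \<in> sets borel" "emeasure lborel A < \<infinity>" and "\<delta> > 0"
  shows "hausdorff_content DIM('a) \<delta> A \<le> emeasure lborel A"
proof (rule ennreal_le_epsilon)
  fix e :: real assume "e > 0"
  obtain U where U: "open U" "A \<subseteq> U" "emeasure lborel (U - A) < ennreal (e / 4)"
    using outer_regular_lborel[OF A(1), of "e / 4"] \<open>e > 0\<close> by auto
  have "emeasure lborel U = emeasure lborel (A \<union> (U - A))"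
    using U(2) by (intro arg_cong[where f = "emeasure lborel"]) auto
  also have "\<dots> \<le> emeasure lborel A + emeasure lborel (U - A)"
    using U A by (intro emeasure_subadditive) auto
  finally have U': "emeasure lborel U \<le> emeasure lborel A + ennreal (e / 4)"
    using U(3) by (meson add_left_mono less_imp_le order_trans)
  define K where "K = {(a, r). a \<in> A \<and> 0 < r \<and> 2 * r \<le> \<delta> \<and> cball a r \<subseteq> U}"
  have cov: "\<exists>i. i \<in> K \<and> x \<in> cball (fst i) (snd i) \<and> snd i < d" if x: "x \<in> A" "0 < d" for x d
  proof -
    obtain r where r: "r > 0" "cball x r \<subseteq> U" using U x by (meson open_contains_cball subset_iff)
    define r' where "r' = min r (min (\<delta> / 2) (d / 2))"
    have r': "0 < r'" "r' \<le> r" "2 * r' \<le> \<delta>" "r' < d" using r \<open>\<delta> > 0\<close> x by (auto simp: r'_def)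
    then have "cball x r' \<subseteq> U" using r(2) subset_cball[of r' r x] by blast
    then show ?thesis using r' x by (intro exI[of _ "(x, r')"]) (auto simp: K_def)
  qed
  have "0 < snd i" if "i \<in> K" for i using that by (auto simp: K_def)
  from Vitali_covering_theorem_cballs[where a = fst, OF this cov]
  obtain C where C: "countable C" "C \<subseteq> K"
    "pairwise (\<lambda>i j. disjnt (cball (fst i) (snd i)) (cball (fst j) (snd j))) C"
    "negligible (A - (\<Union>i\<in>C. cball (fst i) (snd i)))" .
  have K: "0 < snd i" "2 * snd i \<le> \<delta>" "cball (fst i) (snd i) \<subseteq> U" if "i \<in> C" for i
    using subsetD[OF C(2) that] by (simp_all add: K_def split_beta)
  have disj: "disjoint_family_on (\<lambda>i. cball (fst i) (snd i)) C"
    using C(3) by (auto simp: disjoint_family_on_def pairwise_def disjnt_def)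
  let ?W = "\<Union>i\<in>C. cball (fst i) (snd i)"
  have W: "?W \<in> sets borel" using C(1) by (intro sets.countable_UN') auto
  have "hausdorff_content DIM('a) \<delta> ?W \<le> (\<integral>\<^sup>+i. hausdorff_gauge DIM('a) (cball (fst i) (snd i)) \<partial>count_space C)"
    using K(1,2) \<open>\<delta> > 0\<close> by (intro hausdorff_content_le_count_space C) (auto simp: less_imp_le)
  also have "\<dots> = (\<integral>\<^sup>+i. emeasure lborel (cball (fst i) (snd i)) \<partial>count_space C)"
    using K(1) by (intro nn_integral_cong) (simp add: hausdorff_gauge_cball)
  also have "\<dots> = emeasure lborel ?W"
    by (rule emeasure_UN_countable[OF _ C(1) disj, symmetric]) simp
  also have "\<dots> \<le> emeasure lborel U"
    using K(3) U(1) by (intro emeasure_mono) auto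
  also note U'
  \<comment> \<open>\<open>hausdorff_content_Un_le\<close> asks for strict bounds; since
    \<open>A\<close> has finite measure, passing from \<open>e / 4\<close> to \<open>e / 2\<close>
    is a strict increase.\<close>
  also have "emeasure lborel A + ennreal (e / 4) < emeasure lborel A + ennreal (e / 2)"
    using A(2) \<open>e > 0\<close> by (simp add: ennreal_add_left_cancel_less ennreal_lessI)
  finally have 1: "hausdorff_content DIM('a) \<delta> ?W < emeasure lborel A + ennreal (e / 2)" .
  have "A - ?W \<in> sets borel" using A(1) W by auto
  moreover from this have "emeasure lborel (A - ?W) = 0"
    using C(4) by (simp add: negligible_iff_null_sets null_sets_completion_iff null_sets_def)
  ultimately have "hausdorff_content DIM('a) \<delta> (A - ?W) = 0"
    using \<open>\<delta> > 0\<close> by (rule lborel_null_imp_hausdorff_content_0)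
  then have 2: "hausdorff_content DIM('a) \<delta> (A - ?W) < ennreal (e / 2)" using \<open>e > 0\<close> by simp
  have "hausdorff_content DIM('a) \<delta> A \<le> hausdorff_content DIM('a) \<delta> (?W \<union> (A - ?W))"
    unfolding hausdorff_content_def by (rule INF_superset_mono) auto
  also have "\<dots> \<le> emeasure lborel A + ennreal (e / 2) + ennreal (e / 2)"
    using \<open>\<delta> > 0\<close> by (intro hausdorff_content_Un_le 1 2) simp
  also have "\<dots> = emeasure lborel A + ennreal e"
    using \<open>e > 0\<close> by (simp add: add.assoc flip: ennreal_plus)
  finally show "hausdorff_content DIM('a) \<delta> A \<le> emeasure lborel A + ennreal e" .
qed

theorem hausdorff_measure_eq_lborel:
  fixes A :: "'a::euclidean_space set"
  assumes A: "A \<in> sets borel" "emeasure lborel A < \<infinity>"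
  shows "hausdorff_measure DIM('a) A = emeasure lborel A"
proof (rule antisym)
  show "hausdorff_measure DIM('a) A \<le> emeasure lborel A"
    unfolding hausdorff_measure_def
    using hausdorff_content_le_emeasure_lborel[OF A] by (intro SUP_least) auto
  show "emeasure lborel A \<le> hausdorff_measure DIM('a) A"
    unfolding hausdorff_measure_def
    using emeasure_lborel_le_hausdorff_content by (intro SUP_upper2[of 1]) auto
qed

section \<open>Prisms over subsets of a hyperplane\<close>

text \<open>
  The index type of the hyperplanes of \<open>real ^ 'd\<close>. Types are nonempty, so for \<open>CARD('d) = 1\<close> it has one element
  too many; that case is treated separately.
\<close>

typedef 'd pre = "{..<max 1 (CARD('d::finite) - 1)}"
  by (rule exI[of _ 0]) simp

instance pre :: (finite) finite
proof
  interpret type_definition "Rep_pre :: 'a pre \<Rightarrow> nat" Abs_pre "{..<max 1 (CARD('a) - 1)}"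
    by (rule type_definition_pre)
  show "finite (UNIV :: 'a pre set)" unfolding univ by simp
qed

lemma card_pre: "CARD('d::finite pre) = max 1 (CARD('d) - 1)"
  using type_definition.card[OF type_definition_pre[where 'd = 'd]] by simp

lemma hausdorff_measure_compact:
  fixes A :: "'a::euclidean_space set"
  assumes "compact A"
  shows "hausdorff_measure DIM('a) A = emeasure lborel A"
  using borel_compact[OF assms] emeasure_compact_finite[OF assms] by (rule hausdorff_measure_eq_lborel)

text \<open>Hausdorff measure depends on the metric alone, so it compares Lebesgue measures on
  different types of equal dimension. This admits \<open>(real ^ 'd pre) \<times> real\<close> as a
  coordinate space for prisms in \<open>real ^ 'd\<close>.\<close>

lemma emeasure_lborel_isometric_image:
  fixes f :: "'a::euclidean_space \<Rightarrow> 'b::euclidean_space"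
  assumes dim: "DIM('a) = DIM('b)" and f: "\<And>x y. dist (f x) (f y) = dist x y" and A: "compact A"
  shows "emeasure lborel (f ` A) = emeasure lborel A"
proof -
  have "continuous_on A f"
    unfolding continuous_on_iff by (auto simp: f)
  then have fA: "compact (f ` A)" using A by (rule compact_continuous_image)
  have "emeasure lborel (f ` A) = hausdorff_measure DIM('b) (f ` A)"
    by (rule hausdorff_measure_compact[OF fA, symmetric])
  also have "\<dots> = hausdorff_measure DIM('a) A"
    by (simp add: dim hausdorff_measure_isometric_image[OF f])
  also have "\<dots> = emeasure lborel A"
    by (rule hausdorff_measure_compact[OF A])
  finally show ?thesis .
qed

text \<open>This is the face measure for partitions of the line. Every nonempty bounded set has
  gauge 1 in dimension 0, so covering a point costs at least 1, and exactly 1 when the remaining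
  sets of the cover are empty.\<close>

lemma hausdorff_measure_0_singleton: "hausdorff_measure 0 {h} = 1"
proof -
  have "hausdorff_content 0 \<delta> {h} = 1" if "\<delta> > 0" for \<delta>
  proof (rule antisym)
    have "hausdorff_content 0 \<delta> {h} \<le> (\<Sum>i. hausdorff_gauge 0 (if i = (0::nat) then {h} else {}))"
      using that by (intro hausdorff_content_le_suminf) auto
    also have "\<dots> = (\<Sum>i\<in>{0}. hausdorff_gauge 0 (if i = (0::nat) then {h} else {}))"
      by (rule suminf_finite) (auto simp: hausdorff_gauge_def)
    also have "\<dots> = 1" by (simp add: hausdorff_gauge_def)
    finally show "hausdorff_content 0 \<delta> {h} \<le> 1" .
    show "1 \<le> hausdorff_content 0 \<delta> {h}"
      unfolding hausdorff_content_def
    proof (rule INF_greatest, safe)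
      fix C :: "nat \<Rightarrow> 'a set" assume "{h} \<subseteq> (\<Union>i. C i)"
      then obtain i where "h \<in> C i" by auto
      then have "1 = (\<Sum>j\<in>{i}. hausdorff_gauge 0 (C j))" by (auto simp: hausdorff_gauge_def)
      also have "\<dots> \<le> (\<Sum>j. hausdorff_gauge 0 (C j))" by (rule sum_le_suminf) auto
      finally show "1 \<le> (\<Sum>j. hausdorff_gauge 0 (C j))" .
    qed
  qed
  then have "hausdorff_measure 0 {h} = (SUP \<delta>\<in>{0::real<..}. 1)"
    unfolding hausdorff_measure_def by (intro SUP_cong) auto
  also have "\<dots> = 1" by simp
  finally show ?thesis .
qed

lemma hausdorff_measure_empty: "hausdorff_measure k {} = 0"
proof -
  have "hausdorff_content k \<delta> ({}::'a set) \<le> (\<Sum>i::nat. hausdorff_gauge k ({}::'a set))" if "\<delta> > 0" for \<delta>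
    using that by (intro hausdorff_content_le_suminf) auto
  then have "hausdorff_measure k ({}::'a set) \<le> 0"
    unfolding hausdorff_measure_def by (intro SUP_least) (auto simp: hausdorff_gauge_def)
  then show ?thesis by simp
qed

text \<open>The region swept by \<open>G\<close> when it moves with velocity \<open>e\<close> for
  unit time; \<open>e\<close> may be oblique to the plane of \<open>G\<close>.\<close>

definition prism :: "'a::real_vector set \<Rightarrow> 'a \<Rightarrow> 'a set" where
  "prism G e = (\<lambda>(h, s::real). h + s *\<^sub>R e) ` (G \<times> {0..1})"

lemma compact_prism:
  fixes G :: "'a::real_normed_vector set"
  assumes "compact G"
  shows "compact (prism G e)"
  unfolding prism_def case_prod_unfold
  using assms by (intro compact_continuous_image continuous_intros compact_Times) auto

lemma hyperplane_isometry:
  fixes n :: "real ^ 'd"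
  assumes d: "CARD('d) \<ge> 2" and n: "norm n = 1"
  obtains f :: "real ^ 'd pre \<Rightarrow> real ^ 'd"
  where "linear f" "\<And>a. norm (f a) = norm a" "range f = {v. n \<bullet> v = 0}"
proof -
  have "n \<noteq> 0" using n by auto
  then have "dim {v. n \<bullet> v = 0} = CARD('d) - 1" by (simp add: dim_hyperplane)
  moreover have "dim (UNIV :: (real ^ 'd pre) set) = CARD('d) - 1"
    using d by (simp add: dim_UNIV card_pre)
  ultimately obtain f :: "real ^ 'd pre \<Rightarrow> real ^ 'd" where "linear f" "f ` UNIV = {v. n \<bullet> v = 0}"
    "\<And>x. x \<in> UNIV \<Longrightarrow> norm (f x) = norm x"
    using isometry_subspaces[OF subspace_UNIV subspace_hyperplane[of n]] by metis
  then show thesis using that by blast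
qed

text \<open>Cavalieri's principle in the isometric coordinates \<open>(a, t)\<close> of the point
  \<open>f a + t *\<^sub>R n + c *\<^sub>R n\<close>: there the section at height \<open>t\<close>
  is a translate of the base for \<open>0 \<le> t \<le> \<tau>\<close> and empty otherwise.\<close>

lemma emeasure_prism_aux:
  fixes G :: "(real ^ 'd) set" and n e :: "real ^ 'd"
  assumes G: "compact G" "G \<subseteq> {v. v \<bullet> n = c}" and n: "norm n = 1"
    and e: "e \<bullet> n = \<tau>" "\<tau> > 0" and d: "CARD('d) \<ge> 2"
  shows "emeasure lborel (prism G e) = ennreal \<tau> * hausdorff_measure (CARD('d) - 1) G"
proof -
  obtain f :: "real ^ 'd pre \<Rightarrow> real ^ 'd" where f: "linear f" "\<And>a. norm (f a) = norm a"
    and rf: "range f = {v. n \<bullet> v = 0}"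
    using hyperplane_isometry[OF d n] by metis
  interpret f: linear f by fact
  have nn: "n \<bullet> n = 1" using n by (simp add: norm_eq_1)
  have fn: "f a \<bullet> n = 0" for a
  proof -
    have "f a \<in> {v. n \<bullet> v = 0}" unfolding rf[symmetric] by simp
    then show ?thesis by (simp add: inner_commute)
  qed
  have df: "dist (f x) (f y) = dist x y" for x y by (simp add: dist_norm f(2) flip: f.diff)
  have cf: "continuous_on S f" for S by (rule linear_continuous_on) (rule linear_conv_bounded_linear[THEN iffD1, OF f(1)])
  define G' where "G' = {a. f a + c *\<^sub>R n \<in> G}"
  have "G' = (\<lambda>a. f a + c *\<^sub>R n) -` G" by (auto simp: G'_def)
  also have "closed \<dots>"
    using G(1) by (intro closed_vimage continuous_intros cf) (rule compact_imp_closed)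
  finally have "closed G'" .
  have img: "(\<lambda>a. f a + c *\<^sub>R n) ` G' = G"
  proof
    show "G \<subseteq> (\<lambda>a. f a + c *\<^sub>R n) ` G'"
    proof
      fix h assume h: "h \<in> G"
      then have "n \<bullet> (h - c *\<^sub>R n) = 0" using G(2) by (auto simp: inner_diff_right nn inner_commute)
      then have "h - c *\<^sub>R n \<in> range f" unfolding rf by simp
      then obtain a where "f a = h - c *\<^sub>R n" by (metis rangeE)
      then show "h \<in> (\<lambda>a. f a + c *\<^sub>R n) ` G'" using h by (auto simp: G'_def intro!: image_eqI[of _ _ a])
    qed
  qed (auto simp: G'_def)
  have "bounded G'"
    using bounded_isometric_image[of "\<lambda>a. f a + c *\<^sub>R n" G'] compact_imp_bounded[OF G(1)] by (simp add: img df)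
  then have cG': "compact G'" using \<open>closed G'\<close> by (simp add: compact_eq_bounded_closed)
  have "hausdorff_measure (CARD('d) - 1) G = hausdorff_measure (CARD('d) - 1) G'"
    using hausdorff_measure_isometric_image[of "\<lambda>a. f a + c *\<^sub>R n" _ G'] by (simp add: img df)
  also have "\<dots> = hausdorff_measure DIM(real ^ 'd pre) G'" using d by (simp add: card_pre)
  also have "\<dots> = emeasure lborel G'"
    by (rule hausdorff_measure_compact[OF cG'])
  finally have H: "hausdorff_measure (CARD('d) - 1) G = emeasure lborel G'" .
  have "n \<bullet> (e - \<tau> *\<^sub>R n) = 0" using e by (simp add: inner_diff_right nn inner_commute)
  then have "e - \<tau> *\<^sub>R n \<in> range f" unfolding rf by simp
  \<comment> \<open>\<open>w\<close> is the tangential part of \<open>e\<close> in the coordinates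
    of the hyperplane. It shears the prism and leaves the volume of each section unchanged.\<close>
  then obtain w where w: "f w = e - \<tau> *\<^sub>R n" by (metis rangeE)
  define P where "P = (\<lambda>(a, s::real). (a + s *\<^sub>R w, s * \<tau>)) ` (G' \<times> {0..1})"
  have cP: "compact P"
    unfolding P_def case_prod_unfold
    using cG' by (intro compact_continuous_image continuous_intros compact_Times) auto
  have F: "f (a + s *\<^sub>R w) + (s * \<tau>) *\<^sub>R n + c *\<^sub>R n = (f a + c *\<^sub>R n) + s *\<^sub>R e" for a s
    by (simp add: f.add f.scale w algebra_simps)
  have "prism G e = (\<lambda>x. (f (fst x) + c *\<^sub>R n) + snd x *\<^sub>R e) ` (G' \<times> {0..1})"
  proof (intro set_eqI iffI)
    fix v assume "v \<in> prism G e"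
    then obtain h s where h: "h \<in> G" "s \<in> {0..1}" "v = h + s *\<^sub>R e" unfolding prism_def by auto
    then obtain a where "a \<in> G'" "h = f a + c *\<^sub>R n" unfolding img[symmetric] by auto
    then show "v \<in> (\<lambda>x. (f (fst x) + c *\<^sub>R n) + snd x *\<^sub>R e) ` (G' \<times> {0..1})"
      using h by (intro image_eqI[of _ _ "(a, s)"]) simp_all
  next
    fix v assume "v \<in> (\<lambda>x. (f (fst x) + c *\<^sub>R n) + snd x *\<^sub>R e) ` (G' \<times> {0..1})"
    then obtain a s where a: "a \<in> G'" "s \<in> {0..1}" "v = (f a + c *\<^sub>R n) + s *\<^sub>R e" by auto
    have "f a + c *\<^sub>R n \<in> G" using a(1) by (simp add: G'_def)
    then show "v \<in> prism G e" unfolding prism_def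
      using a by (intro image_eqI[of _ _ "(f a + c *\<^sub>R n, s)"]) simp_all
  qed
  also have "\<dots> = (\<lambda>(a, t). f a + t *\<^sub>R n + c *\<^sub>R n) ` P"
    unfolding P_def image_image by (rule image_cong) (simp_all add: case_prod_unfold F)
  also have "emeasure lborel \<dots> = emeasure lborel P"
  proof (rule emeasure_lborel_isometric_image)
    show "DIM((real ^ 'd pre) \<times> real) = DIM(real ^ 'd)" using d by (simp add: card_pre)
    have "norm (f a + t *\<^sub>R n) = norm (a, t)" for a t
    proof -
      have "(norm (f a + t *\<^sub>R n))\<^sup>2 = (norm (f a))\<^sup>2 + t\<^sup>2"
        unfolding power2_norm_eq_inner
        using fn[of a] by (simp add: inner_add_left inner_add_right inner_commute[of n "f a"] nn power2_eq_square)
      then have "(norm (f a + t *\<^sub>R n))\<^sup>2 = (norm (a, t))\<^sup>2" by (simp add: norm_Pair f(2))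
      then show ?thesis by simp
    qed
    note N = this
    have "dist (f a + t *\<^sub>R n + c *\<^sub>R n) (f b + u *\<^sub>R n + c *\<^sub>R n) = dist (a, t) (b, u)" for a b t u
    proof -
      have "f a + t *\<^sub>R n + c *\<^sub>R n - (f b + u *\<^sub>R n + c *\<^sub>R n) = f (a - b) + (t - u) *\<^sub>R n"
        by (simp add: f.diff algebra_simps)
      then show ?thesis using N[of "a - b" "t - u"] by (simp add: dist_norm)
    qed
    then show "dist ((\<lambda>(a, t). f a + t *\<^sub>R n + c *\<^sub>R n) x) ((\<lambda>(a, t). f a + t *\<^sub>R n + c *\<^sub>R n) y) = dist x y" for x y
      by (cases x; cases y) simp
  qed fact
  also have "\<dots> = emeasure (lborel \<Otimes>\<^sub>M lborel) P" by (simp add: lborel_prod)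
  also have "\<dots> = (\<integral>\<^sup>+t. emeasure lborel ((\<lambda>a. (a, t)) -` P) \<partial>(lborel :: real measure))"
  proof (rule lborel_pair.emeasure_pair_measure_alt2)
    show "P \<in> sets (lborel \<Otimes>\<^sub>M lborel)" using borel_compact[OF cP] unfolding lborel_prod by simp
  qed
  also have "\<dots> = (\<integral>\<^sup>+t. emeasure lborel G' * indicator {0..\<tau>} t \<partial>(lborel :: real measure))"
  proof (rule nn_integral_cong)
    fix t :: real
    show "emeasure lborel ((\<lambda>a. (a, t)) -` P) = emeasure lborel G' * indicator {0..\<tau>} t"
    proof (cases "t \<in> {0..\<tau>}")
      case True
      have "(\<lambda>a. (a, t)) -` P = (\<lambda>a. a + (t / \<tau>) *\<^sub>R w) ` G'"
      proof (intro set_eqI iffI)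
        fix a assume "a \<in> (\<lambda>a. a + (t / \<tau>) *\<^sub>R w) ` G'"
        then obtain a' where a': "a' \<in> G'" "a = a' + (t / \<tau>) *\<^sub>R w" by auto
        then have "(a, t) = (\<lambda>(a, s::real). (a + s *\<^sub>R w, s * \<tau>)) (a', t / \<tau>)" using e(2) by simp
        then have "(a, t) \<in> P" unfolding P_def using a'(1) True e(2)
          by (intro image_eqI[of _ _ "(a', t / \<tau>)"]) auto
        then show "a \<in> (\<lambda>a. (a, t)) -` P" by simp
      qed (use e(2) in \<open>auto simp: P_def\<close>)
      then show ?thesis
        using True cG' by (simp add: emeasure_lborel_translation_image compact_imp_closed)
    next
      case False
      then have "(\<lambda>a. (a, t)) -` P = {}" using e(2) by (auto simp: P_def mult_left_le_one_le)
      then show ?thesis using False by simp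
    qed
  qed
  also have "\<dots> = ennreal \<tau> * emeasure lborel G'"
    using e(2) by (simp add: nn_integral_cmult mult.commute)
  finally show ?thesis unfolding H .
qed

text \<open>Base times height, where the height is \<open>e \<bullet> n\<close> whatever the
  tangential part of \<open>e\<close>. On the line a hyperplane is one point, so \<open>G\<close> is
  empty or a singleton, and in the second case the prism is a segment of length
  \<open>\<tau>\<close>.\<close>

lemma emeasure_prism:
  fixes G :: "(real ^ 'd) set" and n e :: "real ^ 'd"
  assumes G: "compact G" "G \<subseteq> {v. v \<bullet> n = c}" and n: "norm n = 1" and e: "e \<bullet> n = \<tau>" "\<tau> > 0"
  shows "emeasure lborel (prism G e) = ennreal \<tau> * hausdorff_measure (CARD('d) - 1) G"
proof (cases "CARD('d) \<ge> 2")
  case True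
  then show ?thesis by (rule emeasure_prism_aux[OF assms])
next
  case False
  then have d: "CARD('d) = 1" using zero_less_card_finite[where 'a = 'd] by linarith
  have nn: "n \<bullet> n = 1" using n by (simp add: norm_eq_1)
  have "dim {v. n \<bullet> v = 0} = 0" using d n by (subst dim_hyperplane) auto
  then have z: "v = 0" if "n \<bullet> v = 0" for v using that by auto
  have G1: "h = h'" if "h \<in> G" "h' \<in> G" for h h'
    using z[of "h - h'"] that G(2) by (auto simp: inner_diff_right inner_commute)
  show ?thesis
  proof (cases "G = {}")
    case True
    then show ?thesis by (simp add: prism_def d hausdorff_measure_empty)
  next
    case False
    then obtain h where h: "G = {h}" using G1 by blast
    have en: "e = \<tau> *\<^sub>R n" using z[of "e - \<tau> *\<^sub>R n"] e by (auto simp: inner_diff_right nn inner_commute)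
    have "prism G e = (\<lambda>t. h + t *\<^sub>R n) ` {0..\<tau>}"
    proof (intro set_eqI iffI)
      fix v assume "v \<in> (\<lambda>t. h + t *\<^sub>R n) ` {0..\<tau>}"
      then obtain t where "0 \<le> t" "t \<le> \<tau>" "v = h + t *\<^sub>R n" by auto
      then show "v \<in> prism G e" unfolding prism_def h using e(2)
        by (intro image_eqI[of _ _ "(h, t / \<tau>)"]) (auto simp: en)
    qed (use e(2) in \<open>auto simp: prism_def h en mult_left_le_one_le intro!: image_eqI\<close>)
    also have "emeasure lborel \<dots> = emeasure lborel {0..\<tau>}"
      using d n by (intro emeasure_lborel_isometric_image) (auto simp: dist_norm simp flip: scaleR_diff_left)
    also have "\<dots> = ennreal \<tau>" using e(2) by simp
    finally show ?thesis by (simp add: h d hausdorff_measure_0_singleton)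
  qed
qed

section \<open>Overlap of a translated convex set with a neighbour\<close>

text \<open>The point \<open>h + s *\<^sub>R e\<close> is a convex combination of an interior point
  \<open>l\<close> of \<open>L\<close> and a point \<open>g\<close> of the hyperplane. Comparison of
  heights fixes the weight \<theta> of \<open>l\<close>, and \<open>g\<close> tends to
  \<open>h\<close> with \<open>s\<close>, so it lies in \<open>closure L\<close>. A point of the
  closure moved towards an interior point is interior.\<close>

lemma transversal_ray_enters:
  fixes L :: "'a::euclidean_space set"
  assumes L: "convex L" "open L" "L \<noteq> {}" "L \<subseteq> {v. c < v \<bullet> n}"
    and e: "e \<bullet> n > 0" and h: "h \<bullet> n = c" and r: "r > 0" "ball h r \<inter> {v. v \<bullet> n = c} \<subseteq> closure L"
  shows "\<exists>t0>0. \<forall>s. 0 < s \<and> s < t0 \<longrightarrow> h + s *\<^sub>R e \<in> L"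
proof -
  obtain l where l: "l \<in> L" using L(3) by auto
  define m where "m = l \<bullet> n - c"
  define \<tau> where "\<tau> = e \<bullet> n"
  have m: "m > 0" using l L(4) by (auto simp: m_def)
  have \<tau>: "\<tau> > 0" using e by (simp add: \<tau>_def)
  define q where "q = norm (e - (\<tau> / m) *\<^sub>R (l - h)) + 1"
  have q: "q > 0" by (simp add: q_def add_nonneg_pos)
  \<comment> \<open>The first bound keeps the weight \<theta> of \<open>l\<close> at most 1/2; given
    this, the second keeps \<open>g\<close> within distance \<open>r\<close> of
    \<open>h\<close>.\<close>
  define t0 where "t0 = min (m / (2 * \<tau>)) (r / (2 * q))"
  have "t0 > 0" using m \<tau> q r by (simp add: t0_def)
  moreover have "h + s *\<^sub>R e \<in> L" if s: "0 < s" "s < t0" for s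
  proof -
    define \<theta> where "\<theta> = s * \<tau> / m"
    have \<theta>: "0 < \<theta>" "\<theta> \<le> 1 / 2"
    proof -
      have "s \<le> m / (2 * \<tau>)" using s by (simp add: t0_def)
      then show "\<theta> \<le> 1 / 2" using m \<tau> by (simp add: \<theta>_def field_simps)
    qed (use s m \<tau> in \<open>simp add: \<theta>_def\<close>)
    define g where "g = h + (s / (1 - \<theta>)) *\<^sub>R (e - (\<tau> / m) *\<^sub>R (l - h))"
    have "(e - (\<tau> / m) *\<^sub>R (l - h)) \<bullet> n = 0"
      using m by (simp add: inner_diff_left h \<tau>_def m_def)
    then have gn: "g \<bullet> n = c" by (simp add: g_def inner_add_left h)
    have "norm (g - h) = (s / (1 - \<theta>)) * norm (e - (\<tau> / m) *\<^sub>R (l - h))"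
      using s \<theta> by (simp add: g_def)
    also have "\<dots> \<le> (s / (1 / 2)) * norm (e - (\<tau> / m) *\<^sub>R (l - h))"
      using s \<theta> by (intro mult_right_mono divide_left_mono) auto
    also have "\<dots> \<le> (2 * s) * q" using s by (simp add: q_def algebra_simps)
    also have "\<dots> < r" using s q by (simp add: t0_def field_simps)
    finally have "g \<in> ball h r" by (simp add: dist_norm norm_minus_commute)
    then have "g \<in> closure L" using r(2) gn by auto
    then have "g - \<theta> *\<^sub>R (g - l) \<in> interior L"
      using L l \<theta> by (intro mem_interior_closure_convex_shrink) (auto simp: interior_open)
    moreover have "g - \<theta> *\<^sub>R (g - l) = h + s *\<^sub>R e"
    proof -
      have *: "(1 - \<theta>) * (s / (1 - \<theta>)) = s" using \<theta> by simp
      have "g - \<theta> *\<^sub>R (g - l) = (1 - \<theta>) *\<^sub>R g + \<theta> *\<^sub>R l" by (simp add: algebra_simps)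
      also have "\<dots> = (1 - \<theta>) *\<^sub>R h + ((1 - \<theta>) * (s / (1 - \<theta>))) *\<^sub>R (e - (\<tau> / m) *\<^sub>R (l - h)) + \<theta> *\<^sub>R l"
        by (simp add: g_def scaleR_add_right)
      also have "\<dots> = h + s *\<^sub>R e" unfolding * by (simp add: \<theta>_def algebra_simps)
      finally show ?thesis .
    qed
    ultimately show ?thesis using L(2) by (simp add: interior_open)
  qed
  ultimately show ?thesis by blast
qed

definition overlap :: "'a::real_vector set \<Rightarrow> 'a set \<Rightarrow> 'a \<Rightarrow> 'a set" where
  "overlap K L w = {v \<in> L. v - w \<in> K}"

lemma open_overlap: "open K \<Longrightarrow> open L \<Longrightarrow> open (overlap K L (w::'a::real_normed_vector))"
proof -
  assume "open K" "open L"
  moreover have "overlap K L w = L \<inter> (\<lambda>v. v - w) -` K" by (auto simp: overlap_def)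
  moreover have "open ((\<lambda>v. v - w) -` K)"
    using \<open>open K\<close> by (intro open_vimage continuous_intros)
  ultimately show ?thesis by auto
qed

text \<open>Count the parameter on a line in direction \<open>e\<close> from the hyperplane. The
  overlap then occupies parameters between 0 and \<open>t i\<close> only: for small
  \<open>t i\<close> all of them if the base point is relatively interior to the contact set, and
  none if it is outside. The slice lengths divided by \<open>t i\<close> thus converge almost
  everywhere to the indicator of the prism, and dominated convergence applies.\<close>

lemma overlap_limit:
  fixes K L :: "'a::euclidean_space set"
  assumes K: "convex K" "open K" "bounded K" "K \<noteq> {}" "K \<subseteq> {v. v \<bullet> n < c}"
    and L: "convex L" "open L" "bounded L" "L \<noteq> {}" "L \<subseteq> {v. c < v \<bullet> n}"
    and e: "e \<bullet> n > 0"
    and t: "\<And>i. t i > 0" "t \<longlonglongrightarrow> 0"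
  shows "(\<lambda>i. measure lborel (overlap K L (t i *\<^sub>R e)) / t i)
    \<longlonglongrightarrow> measure lborel (prism (closure K \<inter> closure L) e)"
proof -
  define \<tau> where "\<tau> = e \<bullet> n"
  have \<tau>: "\<tau> > 0" using e by (simp add: \<tau>_def)
  define G where "G = closure K \<inter> closure L"
  have "closure K \<subseteq> {v. v \<bullet> n \<le> c}"
    using K(5) by (intro closure_minimal) (auto intro!: closed_Collect_le continuous_intros)
  moreover have "closure L \<subseteq> {v. c \<le> v \<bullet> n}"
    using L(5) by (intro closure_minimal) (auto intro!: closed_Collect_le continuous_intros)
  ultimately have Gn: "v \<bullet> n = c" if "v \<in> G" for v using that by (force simp: G_def)
  have cG: "compact G" using K(3) by (auto simp: G_def compact_closure intro: compact_Int_closed)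
  have vG: "convex G" using K(1) L(1) by (simp add: G_def convex_Int convex_closure)
  \<comment> \<open>The projection onto the hyperplane along \<open>e\<close>; the set
    \<open>Z\<close> below is the cylinder of all lines that hit the contact set
    \<open>G\<close>.\<close>
  define h where "h v = v - ((v \<bullet> n - c) / \<tau>) *\<^sub>R e" for v
  have hn: "h v \<bullet> n = c" for v using \<tau> by (simp add: h_def inner_diff_left \<tau>_def)
  have hh: "h (v + s *\<^sub>R e) = h v" for v s
    using \<tau> by (simp add: h_def inner_add_left add_divide_distrib diff_divide_distrib \<tau>_def scaleR_diff_left scaleR_add_left)
  have ch: "continuous_on UNIV h"
    using \<tau> unfolding h_def by (intro continuous_intros) auto
  define S where "S = {v. c \<le> v \<bullet> n \<and> v \<bullet> n \<le> c + \<tau>}"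
  define Z where "Z = h -` G"
  have clS: "closed S" unfolding S_def
    by (intro closed_Collect_conj closed_Collect_le continuous_intros)
  have clZ: "closed Z" unfolding Z_def using cG ch
    by (intro closed_vimage compact_imp_closed) auto
  have vZ: "convex Z"
  proof (rule convexI)
    fix x y and u v :: real assume *: "x \<in> Z" "y \<in> Z" "0 \<le> u" "0 \<le> v" "u + v = 1"
    have "u * c + v * c = c" using * by (simp flip: distrib_right)
    then have "u * (x \<bullet> n - c) + v * (y \<bullet> n - c) = (u *\<^sub>R x + v *\<^sub>R y) \<bullet> n - c"
      by (simp add: inner_add_left algebra_simps)
    then have "h (u *\<^sub>R x + v *\<^sub>R y) = u *\<^sub>R h x + v *\<^sub>R h y"
      by (simp add: h_def scaleR_diff_right algebra_simps flip: add_divide_distrib scaleR_add_left)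
    then show "u *\<^sub>R x + v *\<^sub>R y \<in> Z" using * vG by (auto simp: Z_def convex_def)
  qed
  have SZ: "S \<inter> Z = prism G e"
  proof (intro set_eqI iffI)
    fix v assume v: "v \<in> S \<inter> Z"
    have "v = h v + ((v \<bullet> n - c) / \<tau>) *\<^sub>R e" by (simp add: h_def)
    then show "v \<in> prism G e" unfolding prism_def using v \<tau>
      by (intro image_eqI[of _ _ "(h v, (v \<bullet> n - c) / \<tau>)"]) (auto simp: Z_def S_def)
  next
    fix v assume "v \<in> prism G e"
    then obtain g s where v: "g \<in> G" "0 \<le> s" "s \<le> 1" "v = g + s *\<^sub>R e" by (auto simp: prism_def)
    have "h g = g" using Gn[OF v(1)] by (simp add: h_def)
    then have "v \<in> Z" using v by (simp add: Z_def hh)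
    moreover have "v \<bullet> n = c + s * \<tau>" using v Gn by (simp add: inner_add_left \<tau>_def)
    then have "v \<in> S" using v \<tau> by (simp add: S_def mult_left_le_one_le)
    ultimately show "v \<in> S \<inter> Z" by simp
  qed
  define A where "A i = overlap K L (t i *\<^sub>R e)" for i
  have oA: "open (A i)" for i using K L by (simp add: A_def open_overlap)
  have bA: "bounded (A i)" for i using L(3) by (rule bounded_subset) (auto simp: A_def overlap_def)
  define T where "T i v = {s::real. h v + s *\<^sub>R e \<in> A i}" for i v
  have sl: "slice_length (A i) e v = emeasure lborel (T i v)" for i v
    using slice_length_translate[of "A i" e "h v" "(v \<bullet> n - c) / \<tau>"] oA
    by (simp add: h_def T_def slice_length_def)
  \<comment> \<open>A point of the overlap lies in \<open>L\<close>, beyond the hyperplane, while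
    its origin before the translation lies in \<open>K\<close>, on the near side.\<close>
  have T: "T i v \<subseteq> {0<..<t i}" for i v
  proof
    fix s assume "s \<in> T i v"
    then have "h v + s *\<^sub>R e \<in> L" "h v + s *\<^sub>R e - t i *\<^sub>R e \<in> K" by (auto simp: T_def A_def overlap_def)
    then have "c < c + s * \<tau>" "c + s * \<tau> - t i * \<tau> < c"
      using K(5) L(5) by (auto simp: inner_add_left inner_diff_left hn \<tau>_def dest!: subsetD)
    then have "0 < s * \<tau>" "s * \<tau> < t i * \<tau>" by linarith+
    then show "s \<in> {0<..<t i}" using \<tau> by (simp add: zero_less_mult_iff)
  qed
  define u where "u i v = indicator S v * (slice_length (A i) e v / ennreal (t i))" for i v
  have u_le: "u i v \<le> indicator S v" for i v
  proof -
    have "emeasure lborel (T i v) \<le> emeasure lborel {0<..<t i}" using T by (rule emeasure_mono) simp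
    then have "slice_length (A i) e v \<le> ennreal (t i)" using t(1)[of i] by (simp add: sl less_imp_le)
    then have "slice_length (A i) e v / ennreal (t i) \<le> ennreal (t i) / ennreal (t i)"
      by (rule divide_right_mono_ennreal)
    also have "\<dots> = 1" using t(1)[of i] by (simp add: divide_ennreal)
    finally show ?thesis by (auto simp: u_def indicator_def)
  qed
  obtain BL where BL: "\<And>x. x \<in> L \<Longrightarrow> norm x \<le> BL" using L(3) by (auto simp: bounded_iff)
  obtain tb where tb: "\<And>i. t i \<le> tb"
    using convergent_imp_Bseq[of t] t by (auto simp: convergent_def Bseq_def abs_le_iff)
  \<comment> \<open>In dimension at least two the slab \<open>S\<close> is unbounded. A fixed ball
    containing its part on all lines that meet an overlap gives the integrable majorant.\<close>
  define R where "R = BL + tb * norm e + norm e"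
  have zero_outside: "u i v \<le> indicator (cball 0 R) v" for i v
  proof (cases "v \<in> S \<and> T i v \<noteq> {}")
    case True
    then obtain s where s: "s \<in> T i v" by auto
    have "0 < s" "s < t i" using subsetD[OF T s] by simp_all
    have "h v + s *\<^sub>R e \<in> L" using s by (simp add: T_def A_def overlap_def)
    then have "norm (h v + s *\<^sub>R e) \<le> BL" by (rule BL)
    moreover have "norm (s *\<^sub>R e) \<le> tb * norm e"
      using \<open>0 < s\<close> \<open>s < t i\<close> tb[of i] by (simp add: mult_right_mono)
    moreover have "norm (((v \<bullet> n - c) / \<tau>) *\<^sub>R e) \<le> 1 * norm e"
      using True \<tau> unfolding norm_scaleR by (intro mult_right_mono) (auto simp: S_def)
    moreover have "v = (h v + s *\<^sub>R e) - s *\<^sub>R e + ((v \<bullet> n - c) / \<tau>) *\<^sub>R e" by (simp add: h_def)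
    then have "norm v = norm ((h v + s *\<^sub>R e) - s *\<^sub>R e + ((v \<bullet> n - c) / \<tau>) *\<^sub>R e)" by (rule arg_cong)
    then have "norm v \<le> norm (h v + s *\<^sub>R e) + norm (s *\<^sub>R e) + norm (((v \<bullet> n - c) / \<tau>) *\<^sub>R e)"
      using norm_triangle_ineq[of "(h v + s *\<^sub>R e) - s *\<^sub>R e" "((v \<bullet> n - c) / \<tau>) *\<^sub>R e"]
        norm_triangle_ineq4[of "h v + s *\<^sub>R e" "s *\<^sub>R e"] by linarith
    ultimately have "norm v \<le> R" by (simp add: R_def)
    then show ?thesis using u_le[of i v] True by (simp add: indicator_def)
  next
    case False
    then have "u i v = 0" by (auto simp: u_def sl)
    then show ?thesis by simp
  qed
  have lim: "(\<lambda>i. u i v) \<longlonglongrightarrow> indicator (prism G e) v" if v: "v \<notin> frontier Z" for v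
  proof (cases "v \<in> Z")
    case True
    then have "v \<in> interior Z" using v clZ by (simp add: frontier_def)
    then obtain r where r: "r > 0" "ball v r \<subseteq> Z" by (auto simp: mem_interior)
    have "ball (h v) r \<inter> {w. w \<bullet> n = c} \<subseteq> G"
    proof safe
      fix w assume w: "w \<in> ball (h v) r" "c = w \<bullet> n"
      have "w + ((v \<bullet> n - c) / \<tau>) *\<^sub>R e \<in> ball v r" using w(1) by (simp add: h_def dist_norm algebra_simps)
      then have "h w \<in> G" using r(2) hh by (auto simp: Z_def)
      moreover have "h w = w" using w(2) by (simp add: h_def)
      ultimately show "w \<in> G" by simp
    qed
    then have rK: "ball (h v) r \<inter> {w. w \<bullet> n = c} \<subseteq> closure L" "ball (h v) r \<inter> {w. w \<bullet> (- n) = - c} \<subseteq> closure K"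
      by (auto simp: G_def)
    obtain t1 where t1: "t1 > 0" "\<And>s. 0 < s \<and> s < t1 \<Longrightarrow> h v + s *\<^sub>R e \<in> L"
      using transversal_ray_enters[OF L(1,2,4,5) e hn r(1) rK(1)] by blast
    obtain t2 where t2: "t2 > 0" "\<And>s. 0 < s \<and> s < t2 \<Longrightarrow> h v + s *\<^sub>R (- e) \<in> K"
      using transversal_ray_enters[OF K(1,2,4) _ _ _ r(1) rK(2), of "- e"] K(5) e hn by auto
    have "\<forall>\<^sub>F i in sequentially. t i < min t1 t2"
      using t1(1) t2(1) by (intro order_tendstoD[OF t(2)]) simp
    then have "\<forall>\<^sub>F i in sequentially. u i v = indicator (prism G e) v"
    proof eventually_elim
      case (elim i)
      have "{0<..<t i} \<subseteq> T i v"
      proof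
        fix s assume s: "s \<in> {0<..<t i}"
        have "h v + s *\<^sub>R e \<in> L" using s elim by (intro t1) auto
        moreover have "h v + (t i - s) *\<^sub>R (- e) \<in> K" using s elim by (intro t2) auto
        ultimately show "s \<in> T i v" by (simp add: T_def A_def overlap_def algebra_simps)
      qed
      then have "T i v = {0<..<t i}" using T by blast
      then show ?case using True t(1)[of i]
        by (auto simp: u_def sl less_imp_le divide_ennreal indicator_def simp flip: SZ)
    qed
    then show ?thesis by (rule tendsto_eventually)
  next
    case False
    then have "h v \<notin> G" by (simp add: Z_def)
    then have "h v \<in> - closure K \<or> h v \<in> - closure L" by (simp add: G_def)
    then obtain r where r: "r > 0" "ball (h v) r \<subseteq> - closure K \<or> ball (h v) r \<subseteq> - closure L"
      using open_contains_ball[of "- closure K"] open_contains_ball[of "- closure L"] by blast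
    have "(\<lambda>i. t i * norm e) \<longlonglongrightarrow> 0 * norm e" by (intro tendsto_intros t)
    then have "\<forall>\<^sub>F i in sequentially. t i * norm e < r"
      by (rule order_tendstoD) (use r in simp)
    then have "\<forall>\<^sub>F i in sequentially. u i v = indicator (prism G e) v"
    proof eventually_elim
      case (elim i)
      have "T i v = {}"
      proof (rule ccontr)
        assume "T i v \<noteq> {}"
        then obtain s where s: "s \<in> T i v" by auto
        have s01: "0 < s" "s < t i" using subsetD[OF T s] by simp_all
        have "s * norm e \<le> t i * norm e" "(t i - s) * norm e \<le> t i * norm e"
          using s01 by (auto intro!: mult_right_mono)
        then have "h v + s *\<^sub>R e \<in> ball (h v) r" "h v + s *\<^sub>R e - t i *\<^sub>R e \<in> ball (h v) r"
        proof -
          show "h v + s *\<^sub>R e \<in> ball (h v) r" using s01 \<open>s * norm e \<le> t i * norm e\<close> elim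
            by (simp add: dist_norm)
          have "h v + s *\<^sub>R e - t i *\<^sub>R e = h v - (t i - s) *\<^sub>R e" by (simp add: algebra_simps)
          then show "h v + s *\<^sub>R e - t i *\<^sub>R e \<in> ball (h v) r"
            using s01 \<open>(t i - s) * norm e \<le> t i * norm e\<close> elim by (simp add: dist_norm)
        qed
        moreover have "h v + s *\<^sub>R e \<in> L" "h v + s *\<^sub>R e - t i *\<^sub>R e \<in> K"
          using s by (auto simp: T_def A_def overlap_def)
        ultimately show False using r(2) closure_subset[of K] closure_subset[of L] by blast
      qed
      then show ?case using False by (auto simp: u_def sl simp flip: SZ)
    qed
    then show ?thesis by (rule tendsto_eventually)
  qed
  \<comment> \<open>Points over the relative boundary of the contact set lie on the frontier of the
    convex cylinder \<open>Z\<close>, hence form a null set.\<close>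
  have fr: "frontier Z \<in> null_sets lborel"
    using negligible_convex_frontier[OF vZ] by (simp add: negligible_iff_null_sets null_sets_completion_iff)
  have [measurable]: "S \<in> sets borel" "A i \<in> sets borel" "prism G e \<in> sets borel" for i
    using clS oA compact_prism[OF cG] by (auto simp: borel_compact)
  have "(\<lambda>i. \<integral>\<^sup>+v. u i v \<partial>lborel) \<longlonglongrightarrow> (\<integral>\<^sup>+v. indicator (prism G e) v \<partial>lborel)"
  proof (rule nn_integral_dominated_convergence[where w = "indicator (cball 0 R)"])
    show "u i \<in> borel_measurable lborel" for i unfolding u_def[abs_def] by measurable
    show "AE v in lborel. (\<lambda>i. u i v) \<longlonglongrightarrow> indicator (prism G e) v"
      using AE_not_in[OF fr] by eventually_elim (rule lim)
    show "(\<integral>\<^sup>+v. indicator (cball 0 R) v \<partial>lborel) < \<infinity>"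
      using emeasure_lborel_cball_finite by simp
    show "indicator (cball 0 R) \<in> borel_measurable lborel"
      by (intro borel_measurable_indicator) simp
  qed (use zero_outside in auto)
  moreover have "(\<integral>\<^sup>+v. u i v \<partial>lborel) = ennreal (measure lborel (A i) / t i)" for i
  proof -
    have "(\<integral>\<^sup>+v. u i v \<partial>lborel) = (\<integral>\<^sup>+v. indicator S v * slice_length (A i) e v / ennreal (t i) \<partial>lborel)"
      by (simp add: u_def ennreal_times_divide)
    also have "\<dots> = (\<integral>\<^sup>+v. indicator S v * slice_length (A i) e v \<partial>lborel) / ennreal (t i)"
      by (rule nn_integral_divide) measurable
    also have "\<dots> = emeasure lborel (A i) / ennreal (t i)"
      using emeasure_slab_slices[of "A i" e n \<tau> c] \<tau> by (simp add: \<tau>_def S_def)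
    also have "emeasure lborel (A i) = ennreal (measure lborel (A i))"
      using emeasure_bounded_finite[OF bA[of i]] by (intro emeasure_eq_ennreal_measure) simp
    finally show ?thesis using t(1)[of i] by (simp add: divide_ennreal)
  qed
  moreover have "(\<integral>\<^sup>+v. indicator (prism G e) v \<partial>lborel) = ennreal (measure lborel (prism G e))"
    using emeasure_compact_finite[OF compact_prism[OF cG, of e]] by (simp add: emeasure_eq_ennreal_measure)
  ultimately have "(\<lambda>i. ennreal (measure lborel (A i) / t i)) \<longlonglongrightarrow> ennreal (measure lborel (prism G e))"
    by simp
  then show ?thesis
    unfolding A_def G_def using t(1) by (subst (asm) tendsto_ennreal_iff) (auto intro!: always_eventually divide_nonneg_pos)
qed

section \<open>Separation of two cells and the flux across their common face\<close>

lemma frontier_Int_disjoint_open: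
  assumes "open K" "open L" "K \<inter> L = {}"
  shows "frontier K \<inter> frontier L = closure K \<inter> closure L"
proof -
  have "K \<inter> closure L = {}" "closure K \<inter> L = {}"
    using assms open_Int_closure_eq_empty[of K L] open_Int_closure_eq_empty[of L K] by auto
  then show ?thesis using assms by (auto simp: frontier_def interior_open)
qed

lemma strict_separation:
  fixes K L :: "'a::euclidean_space set"
  assumes K: "convex K" "open K" "K \<noteq> {}" and L: "convex L" "open L" "L \<noteq> {}" and KL: "K \<inter> L = {}"
  obtains n c where "norm n = 1" "K \<subseteq> {v. v \<bullet> n < c}" "L \<subseteq> {v. c < v \<bullet> n}"
proof -
  obtain a b where ab: "a \<noteq> 0" "\<forall>x\<in>K. a \<bullet> x \<le> b" "\<forall>x\<in>L. b \<le> a \<bullet> x"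
    using separating_hyperplane_sets[OF K(1) L(1) K(3) L(3) KL] by blast
  define n where "n = a /\<^sub>R norm a"
  define c where "c = b / norm a"
  have nn: "n \<bullet> n = 1" using ab(1) by (simp add: n_def dot_square_norm power2_eq_square)
  have na: "norm a > 0" using ab(1) by simp
  have le: "\<forall>x\<in>K. x \<bullet> n \<le> c" "\<forall>x\<in>L. c \<le> x \<bullet> n"
    using ab na by (auto simp: n_def c_def inner_commute field_simps)
  have "x \<bullet> n < c" if "x \<in> K" for x
  proof -
    obtain r where r: "r > 0" "cball x r \<subseteq> K" using K(2) \<open>x \<in> K\<close> open_contains_cball by blast
    moreover have "x + r *\<^sub>R n \<in> cball x r" using nn r(1) norm_eq_1[of n] by (simp add: dist_norm)
    ultimately have "x + r *\<^sub>R n \<in> K" by blast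
    then have "(x + r *\<^sub>R n) \<bullet> n \<le> c" using le(1) by blast
    then show ?thesis using r(1) by (simp add: inner_add_left nn)
  qed
  moreover have "c < x \<bullet> n" if "x \<in> L" for x
  proof -
    obtain r where r: "r > 0" "cball x r \<subseteq> L" using L(2) \<open>x \<in> L\<close> open_contains_cball by blast
    moreover have "x - r *\<^sub>R n \<in> cball x r" using nn r(1) norm_eq_1[of n] by (simp add: dist_norm)
    ultimately have "x - r *\<^sub>R n \<in> L" by blast
    then have "c \<le> (x - r *\<^sub>R n) \<bullet> n" using le(2) by blast
    then show ?thesis using r(1) by (simp add: inner_diff_left nn)
  qed
  ultimately show thesis using that[of n c] nn by (auto simp: norm_eq_1)
qed

lemma convex_prism:
  assumes "convex G"
  shows "convex (prism G e)"
proof -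
  have "linear (\<lambda>x. fst x + snd x *\<^sub>R e)"
    by (rule linearI) (simp_all add: algebra_simps)
  moreover have "convex (G \<times> {0..1::real})" using assms by (simp add: convex_Times)
  ultimately show ?thesis unfolding prism_def case_prod_unfold by (rule convex_linear_image)
qed

text \<open>A face of positive measure spans its hyperplane: the prism over it has positive volume
  and contains a ball, so differences of points of the face point in all tangential directions.
  Orthogonality to these makes \<open>p\<close> a multiple of \<open>n\<close>, and the position of
  \<open>K\<close> fixes the sign.\<close>

lemma normal_eq_of_face:
  fixes G :: "(real ^ 'd) set"
  assumes G: "compact G" "convex G" "G \<subseteq> {v. v \<bullet> n = c}" "hausdorff_measure (CARD('d) - 1) G > 0"
    and n: "norm n = 1" and K: "K \<noteq> {}" "K \<subseteq> {v. v \<bullet> n < c}"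
    and p: "p \<noteq> 0" "\<And>a b. a \<in> G \<Longrightarrow> b \<in> G \<Longrightarrow> orthogonal p (a - b)"
      "\<And>a b. a \<in> K \<Longrightarrow> b \<in> G \<Longrightarrow> p \<bullet> (a - b) \<le> 0"
  shows "(1 / norm p) *\<^sub>R p = n"
proof -
  have nn: "n \<bullet> n = 1" using n by (simp add: norm_eq_1)
  have "emeasure lborel (prism G n) > 0"
    using emeasure_prism[OF G(1,3) n nn] G(4) by simp
  then have "\<not> negligible (prism G n)"
    using borel_compact[OF compact_prism[OF G(1)], of n]
    by (auto simp: negligible_iff_null_sets null_sets_completion_iff null_sets_def)
  then have "interior (prism G n) \<noteq> {}"
    using negligible_convex_interior[OF convex_prism[OF G(2)]] by blast
  then obtain z r where z: "r > 0" "cball z r \<subseteq> prism G n"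
    by (auto simp: mem_interior_cball)
  then have "z \<in> prism G n" by auto
  then obtain g s where g: "g \<in> G" "z = g + s *\<^sub>R n" by (auto simp: prism_def)
  have perp: "p \<bullet> u = 0" if u: "u \<bullet> n = 0" for u
  proof (cases "u = 0")
    case False
    define \<epsilon> where "\<epsilon> = r / norm u"
    have \<epsilon>: "\<epsilon> > 0" using False z(1) by (simp add: \<epsilon>_def)
    have "z + \<epsilon> *\<^sub>R u \<in> cball z r" using False z(1) by (simp add: dist_norm \<epsilon>_def)
    then have "z + \<epsilon> *\<^sub>R u \<in> prism G n" using z(2) by blast
    then obtain g' s' where g': "g' \<in> G" "z + \<epsilon> *\<^sub>R u = g' + s' *\<^sub>R n" by (auto simp: prism_def)
    have "g \<bullet> n = c" "g' \<bullet> n = c" using g(1) g'(1) G(3) by auto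
    moreover have "(z + \<epsilon> *\<^sub>R u) \<bullet> n = (g' + s' *\<^sub>R n) \<bullet> n" using g'(2) by simp
    ultimately have "s = s'" using g(2) u by (simp add: inner_add_left nn)
    then have "g' - g = \<epsilon> *\<^sub>R u" using g(2) g'(2) by (simp add: algebra_simps)
    then show ?thesis using p(2)[OF g'(1) g(1)] \<epsilon> by (simp add: orthogonal_def)
  qed simp
  define u where "u = p - (p \<bullet> n) *\<^sub>R n"
  have "u \<bullet> n = 0" by (simp add: u_def inner_diff_left nn)
  then have "p \<bullet> u = 0" by (rule perp)
  moreover have "u \<bullet> u = (p - (p \<bullet> n) *\<^sub>R n) \<bullet> u" by (simp only: u_def[symmetric])
  then have "u \<bullet> u = p \<bullet> u - (p \<bullet> n) * (u \<bullet> n)"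
    by (simp add: inner_diff_left inner_commute[of n u])
  ultimately have "u \<bullet> u = 0" using \<open>u \<bullet> n = 0\<close> by simp
  then have pn: "p = (p \<bullet> n) *\<^sub>R n" by (simp add: u_def)
  obtain a where a: "a \<in> K" using K(1) by auto
  have "p \<bullet> (a - g) \<le> 0" using p(3)[OF a g(1)] .
  then have "(p \<bullet> n) * (a \<bullet> n - c) \<le> 0"
    using g(1) G(3) by (subst (asm) pn) (auto simp: inner_diff_right inner_commute)
  moreover have "a \<bullet> n - c < 0" using a K(2) by auto
  ultimately have "p \<bullet> n \<ge> 0" by (simp add: mult_le_0_iff)
  moreover have "p \<bullet> n \<noteq> 0" using p(1) pn by auto
  ultimately have pos: "p \<bullet> n > 0" by simp
  have "norm p = \<bar>p \<bullet> n\<bar> * norm n" by (metis norm_scaleR pn)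
  then have "norm p = p \<bullet> n" using n pos by simp
  then show ?thesis using pn pos by (metis divide_inverse_commute divide_self_if less_irrefl mult.commute mult_1 scaleR_one scaleR_scaleR)
qed

text \<open>The positive part appears because a translation with
  \<open>e \<bullet> n \<le> 0\<close> moves \<open>K\<close> away from \<open>L\<close>. The
  separating normal is that of \<open>p\<close> when the face has positive measure; otherwise the
  factor in front is 0 and the direction is immaterial.\<close>

lemma overlap_flux:
  fixes K L :: "(real ^ 'd) set" and p e :: "real ^ 'd"
  assumes K: "convex K" "open K" "bounded K" "K \<noteq> {}" and L: "convex L" "open L" "bounded L" "L \<noteq> {}"
    and KL: "K \<inter> L = {}"
    and p: "p \<noteq> 0" "hausdorff_measure (CARD('d) - 1) (frontier K \<inter> frontier L) > 0 \<Longrightarrow>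
      (\<forall>a\<in>frontier K \<inter> frontier L. \<forall>b\<in>frontier K \<inter> frontier L. orthogonal p (a - b)) \<and>
      (\<forall>a\<in>K. \<forall>b\<in>frontier K \<inter> frontier L. p \<bullet> (a - b) \<le> 0)"
    and t: "\<And>i. t i > 0" "t \<longlonglongrightarrow> 0"
  shows "hausdorff_measure (CARD('d) - 1) (frontier K \<inter> frontier L) < \<infinity>" (is "?s < \<infinity>")
    and "(\<lambda>i. measure lborel (overlap K L (t i *\<^sub>R e)) / t i)
      \<longlonglongrightarrow> enn2real (hausdorff_measure (CARD('d) - 1) (frontier K \<inter> frontier L)) *
          max 0 (((1 / norm p) *\<^sub>R p) \<bullet> e)"
proof -
  obtain n c where n: "norm n = 1" and Kc: "K \<subseteq> {v. v \<bullet> n < c}" and Lc: "L \<subseteq> {v. c < v \<bullet> n}"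
    using strict_separation[OF K(1,2,4) L(1,2,4) KL] by metis
  have nn: "n \<bullet> n = 1" using n by (simp add: norm_eq_1)
  define G where "G = closure K \<inter> closure L"
  have fG: "frontier K \<inter> frontier L = G"
    using frontier_Int_disjoint_open[OF K(2) L(2) KL] by (simp add: G_def)
  have "closure K \<subseteq> {v. v \<bullet> n \<le> c}"
    using Kc by (intro closure_minimal) (auto intro!: closed_Collect_le continuous_intros)
  moreover have "closure L \<subseteq> {v. c \<le> v \<bullet> n}"
    using Lc by (intro closure_minimal) (auto intro!: closed_Collect_le continuous_intros)
  ultimately have Gn: "G \<subseteq> {v. v \<bullet> n = c}" by (force simp: G_def)
  have cG: "compact G" using K(3) by (auto simp: G_def compact_closure intro: compact_Int_closed)
  have vG: "convex G" using K(1) L(1) by (simp add: G_def convex_Int convex_closure)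
  have "emeasure lborel (prism G n) = hausdorff_measure (CARD('d) - 1) G"
    using emeasure_prism[OF cG Gn n nn] by simp
  then show fin: "?s < \<infinity>"
    using emeasure_compact_finite[OF compact_prism[OF cG], of n] by (simp add: fG)
  have "(\<lambda>i. measure lborel (overlap K L (t i *\<^sub>R e)) / t i) \<longlonglongrightarrow> enn2real ?s * max 0 (e \<bullet> n)"
  proof (cases "e \<bullet> n > 0")
    case True
    have "measure lborel (prism G e) = enn2real ?s * (e \<bullet> n)"
      using emeasure_prism[OF cG Gn n refl True] True
      by (simp add: measure_def fG enn2real_mult mult.commute)
    then show ?thesis
      using overlap_limit[OF K Kc L Lc True t] True by (simp add: G_def)
  next
    case False
    have "overlap K L (t i *\<^sub>R e) = {}" for i
    proof -
      have False if v: "v \<in> L" "v - t i *\<^sub>R e \<in> K" for v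
      proof -
        have "c < v \<bullet> n" "v \<bullet> n - t i * (e \<bullet> n) < c"
          using Kc Lc v by (auto simp: inner_diff_left dest!: subsetD)
        moreover have "t i * (e \<bullet> n) \<le> 0" using t(1)[of i] False by (simp add: mult_le_0_iff)
        ultimately show False by simp
      qed
      then show ?thesis by (auto simp: overlap_def)
    qed
    then show ?thesis using False by simp
  qed
  moreover have "enn2real ?s * max 0 (e \<bullet> n) = enn2real ?s * max 0 (((1 / norm p) *\<^sub>R p) \<bullet> e)"
  proof (cases "?s > 0")
    case True
    have "(1 / norm p) *\<^sub>R p = n"
      using p(2)[OF True] True fG by (intro normal_eq_of_face[OF cG vG Gn _ n K(4) Kc p(1)]) auto
    then show ?thesis by (simp add: inner_commute)
  next
    case False
    then show ?thesis by simp
  qed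
  ultimately show "(\<lambda>i. measure lborel (overlap K L (t i *\<^sub>R e)) / t i)
      \<longlonglongrightarrow> enn2real ?s * max 0 (((1 / norm p) *\<^sub>R p) \<bullet> e)" by (simp only:)
qed

section \<open>Lattice periodicity\<close>

lemma int_lattice_0 [simp]: "0 \<in> int_lattice" by (simp add: int_lattice_def)

lemma int_lattice_add: "z \<in> int_lattice \<Longrightarrow> w \<in> int_lattice \<Longrightarrow> z + w \<in> int_lattice"
  by (simp add: int_lattice_def)

lemma int_lattice_minus: "z \<in> int_lattice \<Longrightarrow> - z \<in> int_lattice"
  by (simp add: int_lattice_def)

lemma lattice_part_in [simp]: "lattice_part x \<in> int_lattice"
  by (simp add: int_lattice_def lattice_part_def)

lemma lattice_part_add: "z \<in> int_lattice \<Longrightarrow> lattice_part (x + z) = lattice_part x + z"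
  unfolding lattice_part_def int_lattice_def vec_eq_iff
  by (auto elim!: Ints_cases)

lemma lattice_part_diff: "z \<in> int_lattice \<Longrightarrow> lattice_part (x - z) = lattice_part x - z"
  using lattice_part_add[OF int_lattice_minus, of z x] by simp

definition unit_cell :: "(real ^ 'd) set" where
  "unit_cell = {v. lattice_part v = 0}"

lemma unit_cell_eq: "unit_cell = {v. \<forall>i. 0 \<le> v $ i \<and> v $ i < 1}"
  by (auto simp: unit_cell_def lattice_part_eq_iff)

lemma sets_unit_cell [measurable]: "(unit_cell :: (real ^ 'd) set) \<in> sets borel"
proof -
  have "{v :: real ^ 'd. 0 \<le> v $ i} \<inter> {v. v $ i < 1} \<in> sets borel" for i
    by (intro sets.Int borel_closed borel_open closed_Collect_le open_Collect_less continuous_intros)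
  then have "(\<Inter>i\<in>UNIV. {v :: real ^ 'd. 0 \<le> v $ i} \<inter> {v. v $ i < 1}) \<in> sets borel"
    by (intro sets.finite_INT) auto
  also have "(\<Inter>i\<in>UNIV. {v :: real ^ 'd. 0 \<le> v $ i} \<inter> {v. v $ i < 1}) = unit_cell"
    by (auto simp: unit_cell_eq)
  finally show ?thesis .
qed

lemma unit_cell_norm: "v \<in> unit_cell \<Longrightarrow> norm (v :: real ^ 'd) \<le> CARD('d)"
  using norm_le_l1_cart[of v] sum_bounded_above[of UNIV "\<lambda>i. \<bar>v $ i\<bar>" 1]
  by (force simp: unit_cell_eq intro: less_imp_le)

lemma measure_unit_cell: "measure lborel (unit_cell :: (real ^ 'd) set) = 1"
proof -
  have b: "box (0 :: real ^ 'd) 1 \<subseteq> unit_cell" "unit_cell \<subseteq> cbox (0 :: real ^ 'd) 1"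
    by (auto simp: unit_cell_eq mem_box_cart less_imp_le)
  have 1: "(0 :: real ^ 'd) \<bullet> b \<le> 1 \<bullet> b" if "b \<in> Basis" for b
    using that by (auto simp: Basis_vec_def inner_axis)
  have 2: "prod ((\<bullet>) (1 :: real ^ 'd)) Basis = 1"
    by (intro prod.neutral) (auto simp: Basis_vec_def inner_axis)
  have "emeasure lborel (box (0 :: real ^ 'd) 1) \<le> emeasure lborel (unit_cell :: (real ^ 'd) set)"
    by (rule emeasure_mono[OF b(1)]) simp
  moreover have "emeasure lborel (unit_cell :: (real ^ 'd) set) \<le> emeasure lborel (cbox (0 :: real ^ 'd) 1)"
    by (rule emeasure_mono[OF b(2)]) simp
  ultimately have "emeasure lborel (unit_cell :: (real ^ 'd) set) = 1"
    using emeasure_lborel_box[OF 1] emeasure_lborel_cbox[OF 1] by (simp add: 2 antisym)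
  then show ?thesis by (simp add: measure_def)
qed

text \<open>For a lattice-invariant \<open>E\<close> this selects one pair from each lattice orbit,
  normalised at its first point.\<close>

definition periodic_part ::
  "((real ^ 'd) \<times> (real ^ 'd)) set \<Rightarrow> ((real ^ 'd) \<times> (real ^ 'd)) set" where
  "periodic_part E = {(x, y) \<in> E. lattice_part x = 0}"

lemma edgesQ_eq: "edgesQ X K = periodic_part (edges X K)"
  by (simp add: edgesQ_def periodic_part_def)

text \<open>Reversing a pair and shifting it so that its new first point lies in the unit cell is an
  involution of the representatives. This is how the roles of \<open>x\<close> and \<open>y\<close>
  are exchanged although \<open>y\<close> may lie outside the unit cell.\<close>

lemma mass_transport:
  assumes sym: "\<And>x y. (x, y) \<in> E \<Longrightarrow> (y, x) \<in> E"
    and shift: "\<And>x y z. (x, y) \<in> E \<Longrightarrow> z \<in> int_lattice \<Longrightarrow> (x + z, y + z) \<in> E"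
    and h: "\<And>x y z. (x, y) \<in> E \<Longrightarrow> z \<in> int_lattice \<Longrightarrow> h (x + z) (y + z) = h x y"
  shows "(\<Sum>(x, y)\<in>periodic_part E. h x y) = (\<Sum>(x, y)\<in>periodic_part E. h y x)"
proof -
  let ?T = "\<lambda>(x, y). (y - lattice_part y, x - lattice_part y)"
  have T: "?T p \<in> periodic_part E" "?T (?T p) = p" "(case ?T p of (x, y) \<Rightarrow> h y x) = (case p of (x, y) \<Rightarrow> h x y)"
    if "p \<in> periodic_part E" for p
  proof -
    obtain x y where "p = (x, y)" by (cases p)
    then have p: "p = (x, y)" "(x, y) \<in> E" "lattice_part x = 0"
      using that by (simp_all add: periodic_part_def)
    have m: "- lattice_part y \<in> int_lattice" by (simp add: int_lattice_minus)
    have 1: "(y - lattice_part y, x - lattice_part y) \<in> E"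
      using shift[OF sym[OF p(2)] m] by simp
    have 2: "lattice_part (y - lattice_part y) = 0" "lattice_part (x - lattice_part y) = - lattice_part y"
      by (simp_all add: lattice_part_diff p(3))
    show "?T p \<in> periodic_part E" using 1 2(1) by (simp add: p(1) periodic_part_def)
    show "?T (?T p) = p" using 2 by (simp add: p(1))
    show "(case ?T p of (x, y) \<Rightarrow> h y x) = (case p of (x, y) \<Rightarrow> h x y)"
      using h[OF p(2) m] by (simp add: p(1))
  qed
  show ?thesis
    by (rule sum.reindex_bij_witness[of _ ?T ?T]) (erule T)+
qed

section \<open>First moments of sets and of their pieces\<close>

definition moment :: "(real ^ 'd) set \<Rightarrow> real ^ 'd \<Rightarrow> real ^ 'd \<Rightarrow> real" where
  "moment A a j = (LINT w:A|lborel. (w - a) \<bullet> j)"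

lemma set_integrable_inner:
  fixes A :: "(real ^ 'd) set"
  assumes A: "A \<in> sets borel" "bounded A"
  shows "set_integrable lborel A (\<lambda>w. (w - a) \<bullet> j)"
proof -
  obtain B where "\<forall>x\<in>A. norm x \<le> B" using A(2) unfolding bounded_iff by blast
  then have "A \<subseteq> cball 0 B" by (simp add: subset_iff)
  have "set_integrable lborel (cball 0 B) (\<lambda>w. (w - a) \<bullet> j)"
    unfolding set_integrable_def by (intro borel_integrable_compact continuous_intros) auto
  then show ?thesis by (rule set_integrable_subset) (use A \<open>A \<subseteq> cball 0 B\<close> in simp_all)
qed

lemma moment_translate:
  fixes A :: "(real ^ 'd) set"
  assumes A: "A \<in> sets borel"
  shows "moment ((\<lambda>w. w + z) ` A) (a + z) j = moment A a j"
proof -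
  have B: "(\<lambda>w. w + z) ` A \<in> sets borel"
  proof -
    have "(\<lambda>w. w + z) ` A = (\<lambda>w. w - z) -` A \<inter> space borel" by (auto simp: image_iff) (metis diff_add_cancel)
    also have "\<dots> \<in> sets borel" using A by (intro measurable_sets[of _ borel borel]) auto
    finally show ?thesis .
  qed
  have "moment ((\<lambda>w. w + z) ` A) (a + z) j =
      (\<integral>w. indicator ((\<lambda>w. w + z) ` A) w *\<^sub>R ((w - (a + z)) \<bullet> j) \<partial>distr lborel borel ((+) z))"
    by (simp add: moment_def set_lebesgue_integral_def lborel_distr_plus)
  also have "\<dots> = (\<integral>w. indicator ((\<lambda>w. w + z) ` A) (z + w) *\<^sub>R (((z + w) - (a + z)) \<bullet> j) \<partial>lborel)"
    using B by (intro integral_distr) auto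
  also have "\<dots> = moment A a j"
    unfolding moment_def set_lebesgue_integral_def
    by (intro Bochner_Integration.integral_cong) (auto simp: indicator_def image_iff add.commute)
  finally show ?thesis .
qed

lemma moment_diff:
  fixes A :: "(real ^ 'd) set"
  assumes A: "A \<in> sets borel" "bounded A"
  shows "moment A a j - moment A b j = ((b - a) \<bullet> j) * measure lborel A"
proof -
  have "moment A a j - moment A b j = (LINT w:A|lborel. (w - a) \<bullet> j - (w - b) \<bullet> j)"
    unfolding moment_def by (rule set_integral_diff(2)[symmetric]) (intro set_integrable_inner A)+
  also have "\<dots> = (LINT w:A|lborel. (b - a) \<bullet> j)"
    by (intro set_lebesgue_integral_cong) (use A in \<open>auto simp: inner_diff_left\<close>)
  also have "\<dots> = ((b - a) \<bullet> j) * measure lborel A"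
    using A(1) by (simp add: set_lebesgue_integral_def mult.commute)
  finally show ?thesis .
qed

lemma moment_decompose:
  fixes W :: "(real ^ 'd) set"
  assumes W: "W \<in> sets borel" "bounded W" and Y: "finite Y" and C: "\<And>y. y \<in> Y \<Longrightarrow> C y \<in> sets borel"
    and disj: "\<And>x y. x \<in> Y \<Longrightarrow> y \<in> Y \<Longrightarrow> x \<noteq> y \<Longrightarrow> C x \<inter> C y = {}"
    and cov: "W - (\<Union>y\<in>Y. C y) \<in> null_sets lborel"
  shows "moment W a j = (\<Sum>y\<in>Y. moment (W \<inter> C y) a j)"
    and "measure lborel W = (\<Sum>y\<in>Y. measure lborel (W \<inter> C y))"
proof -
  have ae: "AE w in lborel. indicator W w = (\<Sum>y\<in>Y. indicator (W \<inter> C y) w :: real)"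
    using AE_not_in[OF cov]
  proof eventually_elim
    fix w assume w: "w \<notin> W - (\<Union>y\<in>Y. C y)"
    show "indicator W w = (\<Sum>y\<in>Y. indicator (W \<inter> C y) w :: real)"
    proof (cases "w \<in> W")
      case True
      then obtain y where y: "y \<in> Y" "w \<in> C y" using w by auto
      have "indicator (W \<inter> C x) w = (if x = y then 1 else 0 :: real)" if "x \<in> Y" for x
        using disj[OF that y(1)] y(2) True by (auto simp: indicator_def)
      then have "(\<Sum>x\<in>Y. indicator (W \<inter> C x) w) = (\<Sum>x\<in>Y. if x = y then 1 else 0 :: real)"
        by (intro sum.cong) auto
      then show ?thesis using Y y True by simp
    qed (simp add: indicator_def)
  qed
  have bW: "W \<inter> C y \<in> sets borel" "bounded (W \<inter> C y)" if "y \<in> Y" for y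
    using W C[OF that] by (auto intro: bounded_subset)
  have "moment W a j = (\<integral>w. (\<Sum>y\<in>Y. indicator (W \<inter> C y) w *\<^sub>R ((w - a) \<bullet> j)) \<partial>lborel)"
    unfolding moment_def set_lebesgue_integral_def
  proof (rule integral_cong_AE)
    show "AE w in lborel. indicator W w *\<^sub>R ((w - a) \<bullet> j) = (\<Sum>y\<in>Y. indicator (W \<inter> C y) w *\<^sub>R ((w - a) \<bullet> j))"
      using ae by eventually_elim (simp add: sum_distrib_right)
  qed (use W C in measurable)
  also have "\<dots> = (\<Sum>y\<in>Y. moment (W \<inter> C y) a j)"
    unfolding moment_def set_lebesgue_integral_def
    using set_integrable_inner[OF bW] by (intro Bochner_Integration.integral_sum) (simp add: set_integrable_def)
  finally show "moment W a j = (\<Sum>y\<in>Y. moment (W \<inter> C y) a j)" .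
  have fin: "emeasure lborel (W \<inter> C y) < \<infinity>" if "y \<in> Y" for y
    using bW(2)[OF that] by (rule emeasure_bounded_finite)
  have "measure lborel W = (\<integral>w. indicator W w \<partial>lborel)" using W by simp
  also have "\<dots> = (\<integral>w. (\<Sum>y\<in>Y. indicator (W \<inter> C y) w) \<partial>lborel)"
    by (rule integral_cong_AE) (use W C ae in auto)
  also have "\<dots> = (\<Sum>y\<in>Y. measure lborel (W \<inter> C y))"
    using fin bW(1) by (subst Bochner_Integration.integral_sum) auto
  finally show "measure lborel W = (\<Sum>y\<in>Y. measure lborel (W \<inter> C y))" .
qed

section \<open>Volumes and fluxes of the cells\<close>

locale fv_mesh =
  fixes X :: "(real ^ 'd) set" and K :: "real ^ 'd \<Rightarrow> (real ^ 'd) set"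
  assumes fv: "fv_partition X K" and oriented: "outward_oriented X K"
begin

lemma point_shift: "x \<in> X \<Longrightarrow> z \<in> int_lattice \<Longrightarrow> x + z \<in> X"
  using fv by (simp add: fv_partition_def)

lemma point_shift_diff: "x \<in> X \<Longrightarrow> z \<in> int_lattice \<Longrightarrow> x - z \<in> X"
  using point_shift[of x "- z"] int_lattice_minus[of z] by simp

lemma cell_shift: "x \<in> X \<Longrightarrow> z \<in> int_lattice \<Longrightarrow> K (x + z) = (\<lambda>w. w + z) ` K x"
  using fv by (simp add: fv_partition_def)

lemma mem_cell_shift: "x \<in> X \<Longrightarrow> z \<in> int_lattice \<Longrightarrow> w \<in> K (x + z) \<longleftrightarrow> w - z \<in> K x"
  by (auto simp: cell_shift image_iff) (metis diff_add_cancel)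

lemma cell: "x \<in> X \<Longrightarrow> K x \<noteq> {}" "x \<in> X \<Longrightarrow> open (K x)" "x \<in> X \<Longrightarrow> bounded (K x)" "x \<in> X \<Longrightarrow> convex (K x)"
  using fv by (simp_all add: fv_partition_def)

lemma sets_cell: "x \<in> X \<Longrightarrow> K x \<in> sets borel"
  using cell(2) by simp

lemma cells_disjoint: "x \<in> X \<Longrightarrow> y \<in> X \<Longrightarrow> x \<noteq> y \<Longrightarrow> K x \<inter> K y = {}"
  using fv by (simp add: fv_partition_def)

lemma vol_pos: "x \<in> X \<Longrightarrow> vol K x > 0"
proof -
  assume x: "x \<in> X"
  have "emeasure lborel (K x) \<noteq> 0"
    using cell(1,2)[OF x] open_not_negligible[of "K x"]
    by (auto simp: negligible_iff_null_sets null_sets_completion_iff null_sets_def)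
  moreover have "emeasure lborel (K x) < \<infinity>" using cell(3)[OF x] by (rule emeasure_bounded_finite)
  ultimately show ?thesis
    unfolding vol_def measure_def enn2real_positive_iff by (simp add: zero_less_iff_neq_zero)
qed

lemma vol_shift: "x \<in> X \<Longrightarrow> z \<in> int_lattice \<Longrightarrow> vol K (x + z) = vol K x"
  using emeasure_lborel_translation_image[OF sets_cell, of x z]
  by (simp add: vol_def measure_def cell_shift)

lemma cellsQ_eq: "cellsQ X = X \<inter> unit_cell"
  by (auto simp: cellsQ_def unit_cell_def)

lemma finite_cellsQ: "finite (cellsQ X)"
proof -
  have "bounded (unit_cell :: (real ^ 'd) set)" using unit_cell_norm unfolding bounded_iff by blast
  then show ?thesis using fv by (simp add: cellsQ_eq fv_partition_def)
qed

lemma representative: "x \<in> X \<Longrightarrow> x - lattice_part x \<in> cellsQ X"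
  by (simp add: cellsQ_def point_shift_diff lattice_part_diff)

text \<open>Up to lattice translations there are finitely many cells, so one radius serves them
  all.\<close>

lemma cell_radius: obtains r where "r > 0" "\<And>x. x \<in> X \<Longrightarrow> K x \<subseteq> cball x r"
proof -
  have "bounded (\<Union>x\<in>cellsQ X. (\<lambda>w. w - x) ` K x)"
    using finite_cellsQ cell(3)
    by (intro bounded_UN ballI bounded_translation_minus) (auto simp: cellsQ_def)
  then obtain r where "r > 0" and r: "\<forall>u\<in>(\<Union>x\<in>cellsQ X. (\<lambda>w. w - x) ` K x). norm u \<le> r"
    unfolding bounded_pos by blast
  have "K x \<subseteq> cball x r" if x: "x \<in> X" for x
  proof
    fix w assume w: "w \<in> K x"
    let ?q = "x - lattice_part x"
    have q: "?q \<in> cellsQ X" "?q \<in> X" using representative[OF x] by (auto simp: cellsQ_def)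
    have "w - lattice_part x \<in> K ?q"
      using mem_cell_shift[OF q(2) lattice_part_in, of w x] w by simp
    then have "norm ((w - lattice_part x) - ?q) \<le> r" using r q(1) by blast
    then show "w \<in> cball x r" by (simp add: dist_norm norm_minus_commute)
  qed
  then show thesis using that \<open>r > 0\<close> by blast
qed

text \<open>A symmetric, lattice-invariant set of pairs that, for large enough \<open>R\<close>,
  contains all pairs whose cells overlap after a bounded translation. The edges emerge in the limit,
  where all other pairs of distinct cells have area 0.\<close>

definition nearby :: "real \<Rightarrow> ((real ^ 'd) \<times> (real ^ 'd)) set" where
  "nearby R = {(x, y). x \<in> X \<and> y \<in> X \<and> dist x y \<le> R}"

lemma finite_near: "finite {y \<in> X. dist x y \<le> R}"
proof -
  have "{y \<in> X. dist x y \<le> R} = X \<inter> cball x R" by auto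
  then show ?thesis using fv by (simp add: fv_partition_def)
qed

lemma nearby_sum:
  "(\<Sum>(x, y)\<in>periodic_part (nearby R). h x y) = (\<Sum>x\<in>cellsQ X. \<Sum>y\<in>{y \<in> X. dist x y \<le> R}. h x y)"
proof -
  have "periodic_part (nearby R) = Sigma (cellsQ X) (\<lambda>x. {y \<in> X. dist x y \<le> R})"
    by (auto simp: periodic_part_def nearby_def cellsQ_def)
  then show ?thesis using finite_near by (simp add: sum.Sigma finite_cellsQ)
qed

lemma nearby_sym: "(x, y) \<in> nearby R \<Longrightarrow> (y, x) \<in> nearby R"
  by (simp add: nearby_def dist_commute)

lemma nearby_shift: "(x, y) \<in> nearby R \<Longrightarrow> z \<in> int_lattice \<Longrightarrow> (x + z, y + z) \<in> nearby R"
  by (simp add: nearby_def point_shift dist_norm)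

lemma face_shift:
  assumes "x \<in> X" "y \<in> X" "z \<in> int_lattice"
  shows "face K (x + z) (y + z) = (\<lambda>w. w + z) ` face K x y"
proof -
  have "frontier (K (x + z)) = (\<lambda>w. w + z) ` frontier (K x)" if "x \<in> X" for x
  proof -
    have f: "(\<lambda>w. w + z) = (+) z" by (auto simp: add.commute)
    show ?thesis unfolding cell_shift[OF that assms(3)] f by (rule frontier_translation)
  qed
  then show ?thesis using assms by (simp add: face_def image_Int[of "\<lambda>w. w + z"])
qed

lemma face_measure_shift:
  assumes "x \<in> X" "y \<in> X" "z \<in> int_lattice"
  shows "face_measure K (x + z) (y + z) = face_measure K x y"
proof -
  have "hausdorff_measure (CARD('d) - 1) ((\<lambda>w. w + z) ` face K x y) = hausdorff_measure (CARD('d) - 1) (face K x y)"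
    by (rule hausdorff_measure_isometric_image) simp
  then show ?thesis by (simp only: face_measure_def face_shift[OF assms])
qed

lemma face_measure_sym: "face_measure K x y = face_measure K y x"
  by (simp add: face_measure_def face_def Int_commute)

lemma area_shift: "x \<in> X \<Longrightarrow> y \<in> X \<Longrightarrow> z \<in> int_lattice \<Longrightarrow> area K (x + z) (y + z) = area K x y"
  by (simp add: area_def face_measure_shift)

lemma area_sym: "area K x y = area K y x"
  unfolding area_def by (subst face_measure_sym) simp

lemma edges_sym: "(x, y) \<in> edges X K \<Longrightarrow> (y, x) \<in> edges X K"
  unfolding edges_def mem_Collect_eq case_prod_conv face_measure_sym[of y x] by blast

lemma edges_shift: "(x, y) \<in> edges X K \<Longrightarrow> z \<in> int_lattice \<Longrightarrow> (x + z, y + z) \<in> edges X K"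
  by (simp add: edges_def point_shift face_measure_shift)

lemma edge_points: "(x, y) \<in> edges X K \<Longrightarrow> x \<in> X" "(x, y) \<in> edges X K \<Longrightarrow> y \<in> X"
  "(x, y) \<in> edges X K \<Longrightarrow> x \<noteq> y"
  by (auto simp: edges_def)

lemma cell_flux:
  assumes x: "x \<in> X" "y \<in> X" "x \<noteq> y" and t: "\<And>i. t i > 0" "t \<longlonglongrightarrow> 0"
  shows "face_measure K x y < \<infinity>"
    and "(\<lambda>i. measure lborel (overlap (K x) (K y) (t i *\<^sub>R e)) / t i)
      \<longlonglongrightarrow> area K x y * max 0 (normal x y \<bullet> e)"
proof -
  have p: "(\<forall>a\<in>frontier (K x) \<inter> frontier (K y). \<forall>b\<in>frontier (K x) \<inter> frontier (K y). orthogonal (y - x) (a - b)) \<and>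
      (\<forall>a\<in>K x. \<forall>b\<in>frontier (K x) \<inter> frontier (K y). (y - x) \<bullet> (a - b) \<le> 0)"
    if "hausdorff_measure (CARD('d) - 1) (frontier (K x) \<inter> frontier (K y)) > 0"
  proof -
    have pos: "face_measure K x y > 0" using that by (simp add: face_measure_def face_def)
    then have "(x, y) \<in> edges X K" using x by (simp add: edges_def)
    then have "\<forall>a\<in>K x. \<forall>b\<in>face K x y. (y - x) \<bullet> (a - b) \<le> 0"
      using oriented unfolding outward_oriented_def by blast
    moreover have "\<forall>a\<in>face K x y. \<forall>b\<in>face K x y. orthogonal (y - x) (a - b)"
      using fv x pos by (simp add: fv_partition_def)
    ultimately show ?thesis by (simp add: face_def)
  qed
  note * = overlap_flux[OF cell(4,2,3,1)[OF x(1)] cell(4,2,3,1)[OF x(2)] cells_disjoint[OF x] _ p t]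
  have ne: "y - x \<noteq> 0" using x(3) by simp
  show "face_measure K x y < \<infinity>" using *(1)[OF ne] by (simp add: face_measure_def face_def)
  show "(\<lambda>i. measure lborel (overlap (K x) (K y) (t i *\<^sub>R e)) / t i)
      \<longlonglongrightarrow> area K x y * max 0 (normal x y \<bullet> e)"
    using *(2)[OF ne, of e] unfolding area_def face_measure_def face_def normal_def
    by (simp add: dist_norm norm_minus_commute)
qed

lemma area_pos: "(x, y) \<in> edges X K \<Longrightarrow> area K x y > 0"
proof -
  assume e: "(x, y) \<in> edges X K"
  have "face_measure K x y < \<infinity>"
    using cell_flux(1)[of x y "\<lambda>i. inverse (real (Suc i))"] edge_points[OF e] LIMSEQ_inverse_real_of_nat by simp
  then show ?thesis using e by (simp add: area_def edges_def enn2real_positive_iff)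
qed

lemma area_nonedge: "x \<in> X \<Longrightarrow> y \<in> X \<Longrightarrow> x \<noteq> y \<Longrightarrow> (x, y) \<notin> edges X K \<Longrightarrow> area K x y = 0"
  by (simp add: area_def edges_def)

lemma uncovered_null: "UNIV - (\<Union>x\<in>X. K x) \<in> null_sets lborel"
proof -
  have X: "countable X" "(\<Union>x\<in>X. closure (K x)) = UNIV" using fv by (auto simp: fv_partition_def)
  have fr: "frontier (K x) \<in> null_sets lborel" if "x \<in> X" for x
    using negligible_convex_frontier[OF cell(4)[OF that]]
    by (simp add: negligible_iff_null_sets null_sets_completion_iff)
  have "(\<Union>x\<in>X. frontier (K x)) \<in> null_sets lborel"
    using X(1) fr by (rule null_sets_UN')
  moreover have "UNIV - (\<Union>x\<in>X. K x) \<subseteq> (\<Union>x\<in>X. frontier (K x))"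
  proof
    fix w assume w: "w \<in> UNIV - (\<Union>x\<in>X. K x)"
    have "w \<in> (\<Union>x\<in>X. closure (K x))" using X(2) by simp
    then obtain x where "x \<in> X" "w \<in> closure (K x)" by blast
    then show "w \<in> (\<Union>x\<in>X. frontier (K x))" using w cell(2) by (auto simp: frontier_def interior_open)
  qed
  moreover have "UNIV - (\<Union>x\<in>X. K x) \<in> sets lborel"
    using cell(2) by (auto simp: open_UN)
  ultimately show ?thesis using null_sets_subset by blast
qed

lemma cell_decompose:
  assumes W: "W \<in> sets borel" "bounded W" and Y: "finite Y" "Y \<subseteq> X"
    and cov: "\<And>y. y \<in> X \<Longrightarrow> y \<notin> Y \<Longrightarrow> W \<inter> K y = {}"
  shows "moment W a j = (\<Sum>y\<in>Y. moment (W \<inter> K y) a j)"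
    and "measure lborel W = (\<Sum>y\<in>Y. measure lborel (W \<inter> K y))"
proof -
  have sub: "W - (\<Union>y\<in>Y. K y) \<subseteq> UNIV - (\<Union>x\<in>X. K x)" using cov Y(2) by blast
  have "open (\<Union>y\<in>Y. K y)" using cell(2) Y(2) by (intro open_UN) auto
  then have "W - (\<Union>y\<in>Y. K y) \<in> sets lborel" using W(1) by auto
  then have null: "W - (\<Union>y\<in>Y. K y) \<in> null_sets lborel"
    using null_sets_subset[OF uncovered_null _ sub] by blast
  have s: "K y \<in> sets borel" if "y \<in> Y" for y using sets_cell Y(2) that by blast
  have d: "K x \<inter> K y = {}" if "x \<in> Y" "y \<in> Y" "x \<noteq> y" for x y using cells_disjoint Y(2) that by blast
  show "moment W a j = (\<Sum>y\<in>Y. moment (W \<inter> K y) a j)"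
    "measure lborel W = (\<Sum>y\<in>Y. measure lborel (W \<inter> K y))"
    by (rule moment_decompose[OF W Y(1) s d null]; assumption)+
qed

text \<open>Cutting the unit cell by all cells, and cutting the representative cells by all lattice
  translates of the unit cell, yields the same pieces up to translation.\<close>

lemma sum_vol: "(\<Sum>x\<in>cellsQ X. vol K x) = 1"
proof -
  obtain r where r: "r > 0" "\<And>x. x \<in> X \<Longrightarrow> K x \<subseteq> cball x r" using cell_radius by blast
  \<comment> \<open>\<open>CARD('d)\<close> bounds the norm on the unit cell, so \<open>Y\<close>
    contains the centre of every cell that meets it.\<close>
  define Y where "Y = {y \<in> X. dist 0 y \<le> r + CARD('d)}"
  have Y: "finite Y" "Y \<subseteq> X" unfolding Y_def using finite_near[of 0 "r + CARD('d)"] by blast+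
  have mem_Y: "y \<in> Y" if "y \<in> X" "w \<in> unit_cell" "w \<in> K y" for y w
  proof -
    have "dist y w \<le> r" using r(2)[OF that(1)] that(3) by auto
    moreover have "norm w \<le> CARD('d)" using that(2) by (rule unit_cell_norm)
    moreover have "norm y \<le> norm w + norm (y - w)" using norm_triangle_ineq[of w "y - w"] by simp
    ultimately show ?thesis using that(1) by (simp add: Y_def dist_norm)
  qed
  have bU: "bounded (unit_cell :: (real ^ 'd) set)" using unit_cell_norm unfolding bounded_iff by blast
  have "1 = measure lborel (unit_cell :: (real ^ 'd) set)" by (simp add: measure_unit_cell)
  also have "\<dots> = (\<Sum>y\<in>Y. measure lborel (unit_cell \<inter> K y))"
    using mem_Y by (intro cell_decompose(2)[OF sets_unit_cell bU Y]) blast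
  also have "\<dots> = (\<Sum>x\<in>cellsQ X. \<Sum>y\<in>{y \<in> Y. y - lattice_part y = x}. measure lborel (unit_cell \<inter> K y))"
    using Y representative finite_cellsQ by (intro sum.group[symmetric]) auto
  also have "\<dots> = (\<Sum>x\<in>cellsQ X. vol K x)"
  proof (rule sum.cong)
    fix x assume x: "x \<in> cellsQ X"
    then have xX: "x \<in> X" and xl: "lattice_part x = 0" by (auto simp: cellsQ_def)
    let ?Yx = "{y \<in> Y. y - lattice_part y = x}"
    \<comment> \<open>The translation by \<open>- lattice_part y\<close> takes \<open>K y\<close> to
      \<open>K x\<close> and the unit cell to \<open>?C y\<close>.\<close>
    let ?C = "\<lambda>y. (\<lambda>w. w + (- lattice_part y)) ` unit_cell"
    have memC: "w \<in> ?C y \<longleftrightarrow> lattice_part w = - lattice_part y" for w y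
    proof -
      have "w \<in> ?C y \<longleftrightarrow> w + lattice_part y \<in> unit_cell"
        by (auto simp: image_iff) (metis add_diff_cancel)
      also have "\<dots> \<longleftrightarrow> lattice_part w = - lattice_part y"
        by (simp add: unit_cell_def lattice_part_add eq_neg_iff_add_eq_0)
      finally show ?thesis .
    qed
    have part: "measure lborel (K x) = (\<Sum>y\<in>?Yx. measure lborel (K x \<inter> ?C y))"
    proof (rule moment_decompose(2))
      show "?C y \<in> sets borel" for y
      proof -
        have "?C y = (\<lambda>w. w + lattice_part y) -` unit_cell \<inter> space borel"
          by (auto simp: image_iff algebra_simps)
        also have "\<dots> \<in> sets borel" by (intro measurable_sets[of _ borel borel] sets_unit_cell) auto
        finally show ?thesis .
      qed
      show "?C y \<inter> ?C y' = {}" if "y \<in> ?Yx" "y' \<in> ?Yx" "y \<noteq> y'" for y y'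
      proof -
        have "y - lattice_part y = y' - lattice_part y'" using that(1,2) by simp
        then have "lattice_part y \<noteq> lattice_part y'" using that(3) by (metis diff_add_cancel)
        then show ?thesis using memC by (metis disjoint_iff neg_equal_iff_equal)
      qed
      have "K x \<subseteq> (\<Union>y\<in>?Yx. ?C y)"
      proof
        fix w assume w: "w \<in> K x"
        define y where "y = x - lattice_part w"
        have y: "y \<in> X" "lattice_part y = - lattice_part w"
          by (simp_all add: y_def lattice_part_diff xl point_shift_diff[OF xX])
        have "w - lattice_part w \<in> K y"
          using mem_cell_shift[OF xX int_lattice_minus[OF lattice_part_in], of "w - lattice_part w" w] w
          by (simp add: y_def)
        moreover have "w - lattice_part w \<in> unit_cell" by (simp add: unit_cell_def lattice_part_diff)
        ultimately have "y \<in> ?Yx" using mem_Y[OF y(1)] y(2) by (auto simp: y_def)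
        moreover have "w \<in> ?C y" unfolding memC using y(2) by simp
        ultimately show "w \<in> (\<Union>y\<in>?Yx. ?C y)" by blast
      qed
      then show "K x - (\<Union>y\<in>?Yx. ?C y) \<in> null_sets lborel" by (simp add: Diff_eq_empty_iff[THEN iffD2])
    qed (use Y(1) cell(3) sets_cell xX in auto)
    have "measure lborel (unit_cell \<inter> K y) = measure lborel (K x \<inter> ?C y)" if y: "y \<in> ?Yx" for y
    proof -
      have yX: "y \<in> X" and xy: "x = y + (- lattice_part y)" using y Y(2) by auto
      have m: "- lattice_part y \<in> int_lattice" by (simp add: int_lattice_minus)
      have "K x = (\<lambda>w. w + (- lattice_part y)) ` K y" by (subst xy) (rule cell_shift[OF yX m])
      moreover have "(\<lambda>w. w + (- lattice_part y)) ` (unit_cell \<inter> K y) =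
          (\<lambda>w. w + (- lattice_part y)) ` unit_cell \<inter> (\<lambda>w. w + (- lattice_part y)) ` K y"
        by (rule image_Int) (simp add: inj_on_def)
      ultimately have "K x \<inter> ?C y = (\<lambda>w. w + (- lattice_part y)) ` (unit_cell \<inter> K y)"
        by (simp only: Int_commute)
      then show ?thesis
        using emeasure_lborel_translation_image[of "unit_cell \<inter> K y" "- lattice_part y"] sets_cell[OF yX] sets_unit_cell
        by (simp add: measure_def)
    qed
    then show "(\<Sum>y\<in>?Yx. measure lborel (unit_cell \<inter> K y)) = vol K x"
      using part by (simp add: vol_def)
  qed simp
  finally show ?thesis by simp
qed

section \<open>Pieces of translated cells\<close>

lemma overlap_eq_translate: "overlap A B u = (\<lambda>w. w + u) ` A \<inter> B"
  by (auto simp: overlap_def image_iff) (metis diff_add_cancel)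

lemma overlap_shift:
  assumes "x \<in> X" "y \<in> X" "z \<in> int_lattice"
  shows "overlap (K (x + z)) (K (y + z)) u = (\<lambda>w. w + z) ` overlap (K x) (K y) u"
proof (intro set_eqI iffI)
  fix v assume "v \<in> overlap (K (x + z)) (K (y + z)) u"
  then have "v - z \<in> overlap (K x) (K y) u"
    using assms by (simp add: overlap_def mem_cell_shift algebra_simps)
  then show "v \<in> (\<lambda>w. w + z) ` overlap (K x) (K y) u" by (rule rev_image_eqI) simp
next
  fix v assume "v \<in> (\<lambda>w. w + z) ` overlap (K x) (K y) u"
  then obtain w where "w \<in> overlap (K x) (K y) u" "v = w + z" by (rule imageE)
  then show "v \<in> overlap (K (x + z)) (K (y + z)) u"
    using assms by (simp add: overlap_def mem_cell_shift algebra_simps)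
qed

lemma open_cell_overlap: "x \<in> X \<Longrightarrow> y \<in> X \<Longrightarrow> open (overlap (K x) (K y) u)"
  by (simp add: open_overlap cell(2))

lemma sets_overlap: "x \<in> X \<Longrightarrow> y \<in> X \<Longrightarrow> overlap (K x) (K y) u \<in> sets borel"
  using open_cell_overlap by simp

lemma bounded_overlap: "y \<in> X \<Longrightarrow> bounded (overlap (K x) (K y) u)"
  by (rule bounded_subset[OF cell(3)]) (auto simp: overlap_def)

lemma measure_overlap_neg:
  assumes x: "x \<in> X"
  shows "measure lborel (overlap (K x) (K x) (- u)) = measure lborel (overlap (K x) (K x) u)"
proof -
  have "overlap (K x) (K x) u = (\<lambda>w. w + u) ` overlap (K x) (K x) (- u)"
    by (auto simp: overlap_def image_iff) (metis diff_add_cancel)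
  then show ?thesis
    using emeasure_lborel_translation_image[OF sets_overlap[OF x x], of u "- u"] by (simp add: measure_def)
qed

lemma far_overlap_empty:
  assumes r: "\<And>x. x \<in> X \<Longrightarrow> K x \<subseteq> cball x r" and u: "norm u \<le> s"
    and x: "x \<in> X" "y \<in> X" "dist x y > 2 * r + s"
  shows "overlap (K x) (K y) u = {}"
proof (rule ccontr)
  assume "overlap (K x) (K y) u \<noteq> {}"
  then obtain v where v: "v \<in> K y" "v - u \<in> K x" by (auto simp: overlap_def)
  have "dist y v \<le> r" "dist x (v - u) \<le> r" using subsetD[OF r[OF x(2)] v(1)] subsetD[OF r[OF x(1)] v(2)] by simp_all
  moreover have "dist x y \<le> dist x (v - u) + dist (v - u) v + dist v y"
    using dist_triangle[of x y v] dist_triangle[of x v "v - u"] by linarith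
  moreover have "dist (v - u) v = norm u" by (simp add: dist_norm)
  ultimately show False using u x(3) by (simp add: dist_commute)
qed

text \<open>The translated cell is cut by the cells in which it lands. When the reference point
  moves along, from \<open>x\<close> to \<open>x + u\<close>, the moment of the cell is
  unchanged.\<close>

lemma overlap_out:
  assumes r: "\<And>x. x \<in> X \<Longrightarrow> K x \<subseteq> cball x r" and u: "norm u \<le> s" and x: "x \<in> X"
  shows "moment (K x) x j = (\<Sum>y\<in>{y \<in> X. dist x y \<le> 2 * r + s}. moment (overlap (K x) (K y) u) (x + u) j)"
    and "vol K x = (\<Sum>y\<in>{y \<in> X. dist x y \<le> 2 * r + s}. measure lborel (overlap (K x) (K y) u))"
proof -
  let ?W = "(\<lambda>w. w + u) ` K x" and ?Y = "{y \<in> X. dist x y \<le> 2 * r + s}"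
  have o: "?W \<inter> K y = overlap (K x) (K y) u" for y by (simp add: overlap_eq_translate)
  have eq: "?W = (\<lambda>w. u + w) ` K x" by (auto simp: add.commute)
  have "open ?W" "bounded ?W"
    unfolding eq by (rule open_translation[OF cell(2)[OF x]], rule bounded_translation[OF cell(3)[OF x]])
  then have W: "?W \<in> sets borel" "bounded ?W" by simp_all
  have Y: "finite ?Y" "?Y \<subseteq> X" using finite_near[of x] by blast+
  have c: "?W \<inter> K y = {}" if "y \<in> X" "y \<notin> ?Y" for y
    unfolding o using that by (intro far_overlap_empty[OF r u x]) simp_all
  show "moment (K x) x j = (\<Sum>y\<in>?Y. moment (overlap (K x) (K y) u) (x + u) j)"
    using cell_decompose(1)[OF W Y c, of "x + u" j] moment_translate[OF sets_cell[OF x], of u x j] by (simp add: o)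
  show "vol K x = (\<Sum>y\<in>?Y. measure lborel (overlap (K x) (K y) u))"
    using cell_decompose(2)[OF W Y c] emeasure_lborel_translation_image[OF sets_cell[OF x], of u]
    by (simp add: o vol_def measure_def)
qed

text \<open>The pieces that arrive in \<open>K y\<close> are, moved back, the pieces into which
  \<open>K y\<close> is cut after translation by \<open>- u\<close>, so \<open>overlap_out\<close>
  applies to the opposite translation.\<close>

lemma overlap_in:
  assumes r: "\<And>x. x \<in> X \<Longrightarrow> K x \<subseteq> cball x r" and u: "norm u \<le> s" and y: "y \<in> X"
  shows "moment (K y) y j = (\<Sum>x\<in>{x \<in> X. dist y x \<le> 2 * r + s}. moment (overlap (K x) (K y) u) y j)"
proof -
  have u': "norm (- u) \<le> s" using u by simp
  have "moment (K y) y j = (\<Sum>x\<in>{x \<in> X. dist y x \<le> 2 * r + s}. moment (overlap (K y) (K x) (- u)) (y - u) j)"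
    using overlap_out(1)[OF r u' y] by simp
  also have "\<dots> = (\<Sum>x\<in>{x \<in> X. dist y x \<le> 2 * r + s}. moment (overlap (K x) (K y) u) y j)"
  proof (rule sum.cong)
    fix x assume "x \<in> {x \<in> X. dist y x \<le> 2 * r + s}"
    then have x: "x \<in> X" by simp
    have "overlap (K x) (K y) u = (\<lambda>w. w + u) ` overlap (K y) (K x) (- u)"
      by (auto simp: overlap_def image_iff) (metis diff_add_cancel)
    then show "moment (overlap (K y) (K x) (- u)) (y - u) j = moment (overlap (K x) (K y) u) y j"
      using moment_translate[OF sets_overlap[OF y x], of u "- u" "y - u" j] by simp
  qed simp
  finally show ?thesis .
qed

text \<open>
  Summing the integrals of \<open>(w - x) \<bullet> j\<close> over \<open>w \<in> K x\<close> for the cells of a period, once by the pieces of the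
  translated cells and once by the pieces that arrive in each cell, gives the same value.
\<close>

lemma displacement_identity:
  assumes r: "\<And>x. x \<in> X \<Longrightarrow> K x \<subseteq> cball x r" and u: "norm u \<le> s"
  shows "(\<Sum>(x, y)\<in>periodic_part (nearby (2 * r + s)). measure lborel (overlap (K x) (K y) u) * ((y - x) \<bullet> j)) = u \<bullet> j"
proof -
  let ?E = "nearby (2 * r + s)"
  let ?N = "\<lambda>x. {y \<in> X. dist x y \<le> 2 * r + s}"
  have Q: "x \<in> X" if "x \<in> cellsQ X" for x using that by (simp add: cellsQ_def)
  have "(\<Sum>x\<in>cellsQ X. moment (K x) x j) = (\<Sum>x\<in>cellsQ X. \<Sum>y\<in>?N x. moment (overlap (K x) (K y) u) (x + u) j)"
    using overlap_out(1)[OF r u] Q by (intro sum.cong) auto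
  also have "\<dots> = (\<Sum>(x, y)\<in>periodic_part ?E. moment (overlap (K x) (K y) u) (x + u) j)"
    by (rule nearby_sum[symmetric])
  finally have out: "(\<Sum>x\<in>cellsQ X. moment (K x) x j) = \<dots>" .
  have "(\<Sum>x\<in>cellsQ X. moment (K x) x j) = (\<Sum>y\<in>cellsQ X. \<Sum>x\<in>?N y. moment (overlap (K x) (K y) u) y j)"
    using overlap_in[OF r u] Q by (intro sum.cong) auto
  also have "\<dots> = (\<Sum>(y, x)\<in>periodic_part ?E. moment (overlap (K x) (K y) u) y j)"
    by (rule nearby_sum[symmetric])
  also have "\<dots> = (\<Sum>(x, y)\<in>periodic_part ?E. moment (overlap (K x) (K y) u) y j)"
  proof (rule mass_transport)
    fix x y z :: "real ^ 'd" assume xy: "(x, y) \<in> ?E" "z \<in> int_lattice"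
    then have p: "x \<in> X" "y \<in> X" by (auto simp: nearby_def)
    show "moment (overlap (K (y + z)) (K (x + z)) u) (x + z) j = moment (overlap (K y) (K x) u) x j"
      using moment_translate[OF sets_overlap[OF p(2,1)], of z u x j] by (simp add: overlap_shift p xy(2))
  qed (auto intro: nearby_sym nearby_shift)
  finally have "0 = (\<Sum>(x, y)\<in>periodic_part ?E. moment (overlap (K x) (K y) u) (x + u) j)
      - (\<Sum>(x, y)\<in>periodic_part ?E. moment (overlap (K x) (K y) u) y j)"
    using out by simp
  also have "\<dots> = (\<Sum>(x, y)\<in>periodic_part ?E. ((y - x) \<bullet> j - u \<bullet> j) * measure lborel (overlap (K x) (K y) u))"
    unfolding sum_subtractf[symmetric]
  proof (rule sum.cong)
    fix p assume "p \<in> periodic_part ?E"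
    then obtain x y where p: "p = (x, y)" "x \<in> X" "y \<in> X" by (auto simp: periodic_part_def nearby_def)
    show "(case p of (x, y) \<Rightarrow> moment (overlap (K x) (K y) u) (x + u) j) -
        (case p of (x, y) \<Rightarrow> moment (overlap (K x) (K y) u) y j) =
        (case p of (x, y) \<Rightarrow> ((y - x) \<bullet> j - u \<bullet> j) * measure lborel (overlap (K x) (K y) u))"
      using moment_diff[of "overlap (K x) (K y) u" "x + u" j y, OF sets_overlap[OF p(2,3)] bounded_overlap[OF p(3)]]
      by (simp add: p(1) inner_diff_left inner_add_left algebra_simps)
  qed simp
  also have "\<dots> = (\<Sum>(x, y)\<in>periodic_part ?E. measure lborel (overlap (K x) (K y) u) * ((y - x) \<bullet> j))
      - (u \<bullet> j) * (\<Sum>(x, y)\<in>periodic_part ?E. measure lborel (overlap (K x) (K y) u))"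
    unfolding sum_distrib_left sum_subtractf[symmetric] by (intro sum.cong) (auto simp: algebra_simps)
  also have "(\<Sum>(x, y)\<in>periodic_part ?E. measure lborel (overlap (K x) (K y) u)) = (\<Sum>x\<in>cellsQ X. vol K x)"
    unfolding nearby_sum using overlap_out(2)[OF r u] Q by (intro sum.cong) auto
  finally show ?thesis by (simp add: sum_vol)
qed

section \<open>First order behaviour of the overlaps for small translations\<close>

abbreviation time :: "nat \<Rightarrow> real" where
  "time i \<equiv> inverse (real (Suc i))"

text \<open>Since the times do not exceed 1, the single range \<open>2 * r + norm e\<close> in
  \<open>nearby\<close> serves all translations of the sequence.\<close>

lemma norm_time_le: "norm (time i *\<^sub>R e) \<le> norm e"
  using mult_right_mono[of "inverse (real (Suc i))" 1 "norm e"] by (simp add: inverse_le_1_iff)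

lemma edge_close:
  assumes r: "\<And>x. x \<in> X \<Longrightarrow> K x \<subseteq> cball x r" and s: "s \<ge> 0" and e: "(x, y) \<in> edges X K"
  shows "dist x y \<le> 2 * r + s"
proof (rule ccontr)
  assume far: "\<not> dist x y \<le> 2 * r + s"
  note p = edge_points[OF e]
  have "closure (K x) \<subseteq> cball x r" "closure (K y) \<subseteq> cball y r"
    by (rule closure_minimal[OF r[OF p(1)] closed_cball], rule closure_minimal[OF r[OF p(2)] closed_cball])
  moreover have "False" if "v \<in> cball x r" "v \<in> cball y r" for v
    using that far s dist_triangle2[of x y v] by simp
  ultimately have f: "face K x y = {}" unfolding face_def frontier_def by blast
  have "area K x y = 0" by (simp add: area_def face_measure_def f hausdorff_measure_empty)
  then show False using area_pos[OF e] by simp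
qed

lemma finite_nbrs: "finite (nbrs X K x)"
proof -
  obtain r where r: "r > 0" "\<And>x. x \<in> X \<Longrightarrow> K x \<subseteq> cball x r" using cell_radius by blast
  have "nbrs X K x \<subseteq> {y \<in> X. dist x y \<le> 2 * r + 0}"
    using edge_close[OF r(2), of 0 x] edge_points by (auto simp: nbrs_def)
  then show ?thesis by (rule finite_subset[OF _ finite_near])
qed

lemma edgesQ_sum:
  "(\<Sum>(x, y)\<in>edgesQ X K. h x y) = (\<Sum>x\<in>cellsQ X. \<Sum>y\<in>nbrs X K x. h x y)"
proof -
  have "edgesQ X K = Sigma (cellsQ X) (nbrs X K)"
    by (auto simp: edgesQ_def cellsQ_def nbrs_def edges_def)
  then show ?thesis using finite_nbrs by (simp add: sum.Sigma finite_cellsQ)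
qed

lemma finite_edgesQ: "finite (edgesQ X K)"
proof -
  have "edgesQ X K = Sigma (cellsQ X) (nbrs X K)"
    by (auto simp: edgesQ_def cellsQ_def nbrs_def edges_def)
  then show ?thesis using finite_nbrs finite_cellsQ by simp
qed

text \<open>The volume leaving \<open>K x\<close> is what the translated cell does not share with
  \<open>K x\<close>. It is distributed over the other cells within range, and those that are not
  neighbours drop out in the limit.\<close>

lemma outflux_limit:
  assumes x: "x \<in> X"
  shows "(\<lambda>i. (vol K x - measure lborel (overlap (K x) (K x) (time i *\<^sub>R e))) / time i)
    \<longlonglongrightarrow> (\<Sum>y\<in>nbrs X K x. area K x y * max 0 (normal x y \<bullet> e))"
proof -
  obtain r where r: "r > 0" "\<And>x. x \<in> X \<Longrightarrow> K x \<subseteq> cball x r" using cell_radius by blast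
  let ?N = "{y \<in> X. dist x y \<le> 2 * r + norm e}"
  have xN: "x \<in> ?N" using x r(1) by (simp add: add_nonneg_nonneg)
  have "(\<lambda>i. \<Sum>y\<in>?N - {x}. measure lborel (overlap (K x) (K y) (time i *\<^sub>R e)) / time i)
      \<longlonglongrightarrow> (\<Sum>y\<in>?N - {x}. area K x y * max 0 (normal x y \<bullet> e))"
    using x LIMSEQ_inverse_real_of_nat by (intro tendsto_sum cell_flux(2)) auto
  moreover have "(\<Sum>y\<in>?N - {x}. measure lborel (overlap (K x) (K y) (time i *\<^sub>R e)) / time i) =
      (vol K x - measure lborel (overlap (K x) (K x) (time i *\<^sub>R e))) / time i" for i
  proof -
    let ?f = "\<lambda>y. measure lborel (overlap (K x) (K y) (time i *\<^sub>R e))"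
    have "vol K x = sum ?f ?N" by (rule overlap_out(2)[OF r(2) norm_time_le x])
    also have "\<dots> = ?f x + sum ?f (?N - {x})" by (rule sum.remove[OF finite_near xN])
    finally have "sum ?f (?N - {x}) = vol K x - ?f x" by linarith
    then show ?thesis by (simp only: sum_divide_distrib[symmetric])
  qed
  moreover have "(\<Sum>y\<in>?N - {x}. area K x y * max 0 (normal x y \<bullet> e)) =
      (\<Sum>y\<in>nbrs X K x. area K x y * max 0 (normal x y \<bullet> e))"
  proof (rule sum.mono_neutral_right)
    show "nbrs X K x \<subseteq> ?N - {x}"
      using edge_close[OF r(2), of "norm e" x] by (auto simp: nbrs_def dest: edge_points)
    show "\<forall>y\<in>?N - {x} - nbrs X K x. area K x y * max 0 (normal x y \<bullet> e) = 0"
      using x area_nonedge by (auto simp: nbrs_def)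
  qed (use finite_near in auto)
  ultimately show ?thesis by simp
qed

lemma max_0_diff: "max 0 a - max 0 (- a) = (a :: real)"
  by (simp add: max_def)

text \<open>The overlaps of \<open>K x\<close> with itself under opposite translations are
  congruent, so the cell loses equal volumes in the directions \<open>e\<close> and
  \<open>- e\<close>. The positive and negative parts of the face fluxes therefore have equal
  sums.\<close>

theorem cell_divergence:
  assumes x: "x \<in> X"
  shows "(\<Sum>y\<in>nbrs X K x. area K x y * (normal x y \<bullet> e)) = 0"
proof -
  have "(\<lambda>i. (vol K x - measure lborel (overlap (K x) (K x) (time i *\<^sub>R e))) / time i)
    \<longlonglongrightarrow> (\<Sum>y\<in>nbrs X K x. area K x y * max 0 (normal x y \<bullet> (- e)))"
    using outflux_limit[OF x, of "- e"] by (simp add: measure_overlap_neg[OF x])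
  then have "(\<Sum>y\<in>nbrs X K x. area K x y * max 0 (normal x y \<bullet> e)) =
      (\<Sum>y\<in>nbrs X K x. area K x y * max 0 (normal x y \<bullet> (- e)))"
    using outflux_limit[OF x] LIMSEQ_unique by blast
  then have "(\<Sum>y\<in>nbrs X K x. area K x y * (max 0 (normal x y \<bullet> e) - max 0 (- (normal x y \<bullet> e)))) = 0"
    by (simp add: right_diff_distrib sum_subtractf)
  then show ?thesis by (simp only: max_0_diff)
qed

text \<open>Divided by the time, the left-hand side of \<open>displacement_identity\<close> equals
  \<open>e \<bullet> j\<close> for every member of the sequence; the limit is taken in each of
  finitely many terms. Diagonal pairs have displacement 0.\<close>

lemma forward_flux:
  "(\<Sum>(x, y)\<in>edgesQ X K. area K x y * max 0 (normal x y \<bullet> e) * ((y - x) \<bullet> j)) = e \<bullet> j"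
proof -
  obtain r where r: "r > 0" "\<And>x. x \<in> X \<Longrightarrow> K x \<subseteq> cball x r" using cell_radius by blast
  let ?E = "nearby (2 * r + norm e)"
  have fin: "finite (periodic_part ?E)"
  proof -
    have "periodic_part ?E = Sigma (cellsQ X) (\<lambda>x. {y \<in> X. dist x y \<le> 2 * r + norm e})"
      by (auto simp: periodic_part_def nearby_def cellsQ_def)
    then show ?thesis using finite_near finite_cellsQ by simp
  qed
  have "(\<lambda>i. \<Sum>p\<in>periodic_part ?E. measure lborel (overlap (K (fst p)) (K (snd p)) (time i *\<^sub>R e)) / time i * ((snd p - fst p) \<bullet> j))
      \<longlonglongrightarrow> (\<Sum>p\<in>periodic_part ?E. area K (fst p) (snd p) * max 0 (normal (fst p) (snd p) \<bullet> e) * ((snd p - fst p) \<bullet> j))"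
  proof (rule tendsto_sum)
    fix p assume "p \<in> periodic_part ?E"
    then have p: "fst p \<in> X" "snd p \<in> X" by (auto simp: periodic_part_def nearby_def)
    show "(\<lambda>i. measure lborel (overlap (K (fst p)) (K (snd p)) (time i *\<^sub>R e)) / time i * ((snd p - fst p) \<bullet> j))
      \<longlonglongrightarrow> area K (fst p) (snd p) * max 0 (normal (fst p) (snd p) \<bullet> e) * ((snd p - fst p) \<bullet> j)"
    proof (cases "fst p = snd p")
      case False
      show ?thesis using LIMSEQ_inverse_real_of_nat
        by (intro tendsto_mult_right cell_flux(2) p False) auto
    qed simp
  qed
  moreover have "(\<Sum>p\<in>periodic_part ?E. measure lborel (overlap (K (fst p)) (K (snd p)) (time i *\<^sub>R e)) / time i * ((snd p - fst p) \<bullet> j))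
      = e \<bullet> j" for i
  proof -
    have "(\<Sum>p\<in>periodic_part ?E. measure lborel (overlap (K (fst p)) (K (snd p)) (time i *\<^sub>R e)) / time i * ((snd p - fst p) \<bullet> j))
      = (\<Sum>(x, y)\<in>periodic_part ?E. measure lborel (overlap (K x) (K y) (time i *\<^sub>R e)) * ((y - x) \<bullet> j)) / time i"
      unfolding sum_divide_distrib by (intro sum.cong) (auto simp: field_simps)
    also have "\<dots> = (time i *\<^sub>R e) \<bullet> j / time i"
      using displacement_identity[OF r(2) norm_time_le, of i e j] by simp
    finally show ?thesis by simp
  qed
  ultimately have "e \<bullet> j = (\<Sum>p\<in>periodic_part ?E. area K (fst p) (snd p) * max 0 (normal (fst p) (snd p) \<bullet> e) * ((snd p - fst p) \<bullet> j))"
    by (simp add: LIMSEQ_const_iff)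
  also have "\<dots> = (\<Sum>p\<in>edgesQ X K. area K (fst p) (snd p) * max 0 (normal (fst p) (snd p) \<bullet> e) * ((snd p - fst p) \<bullet> j))"
  proof (rule sum.mono_neutral_right[OF fin])
    show "edgesQ X K \<subseteq> periodic_part ?E"
      using edge_close[OF r(2), of "norm e"] edge_points
      by (auto simp: edgesQ_def periodic_part_def nearby_def)
    show "\<forall>p\<in>periodic_part ?E - edgesQ X K. area K (fst p) (snd p) * max 0 (normal (fst p) (snd p) \<bullet> e) * ((snd p - fst p) \<bullet> j) = 0"
    proof
      fix p assume "p \<in> periodic_part ?E - edgesQ X K"
      then have p: "fst p \<in> X" "snd p \<in> X" "(fst p, snd p) \<notin> edges X K"
        by (auto simp: edgesQ_def periodic_part_def nearby_def)
      show "area K (fst p) (snd p) * max 0 (normal (fst p) (snd p) \<bullet> e) * ((snd p - fst p) \<bullet> j) = 0"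
        using area_nonedge[OF p(1,2) _ p(3)] by (cases "fst p = snd p") simp_all
    qed
  qed
  finally show ?thesis by (simp add: case_prod_unfold)
qed

text \<open>The factor 2 comes from subtracting the identities for \<open>e\<close> and
  \<open>- e\<close>: one collects the positive parts of the normal components, the other the
  negative parts, and each accounts for \<open>e \<bullet> j\<close>.\<close>

theorem flux_identity:
  "(\<Sum>(x, y)\<in>edgesQ X K. area K x y * (normal x y \<bullet> e) * ((y - x) \<bullet> j)) = 2 * (e \<bullet> j)"
proof -
  have "(\<Sum>(x, y)\<in>edgesQ X K. area K x y * max 0 (normal x y \<bullet> e) * ((y - x) \<bullet> j))
      - (\<Sum>(x, y)\<in>edgesQ X K. area K x y * max 0 (normal x y \<bullet> (- e)) * ((y - x) \<bullet> j))
    = (\<Sum>(x, y)\<in>edgesQ X K. area K x y * (max 0 (normal x y \<bullet> e) - max 0 (- (normal x y \<bullet> e))) * ((y - x) \<bullet> j))"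
    unfolding sum_subtractf[symmetric] by (intro sum.cong) (auto simp: algebra_simps)
  then show ?thesis unfolding forward_flux max_0_diff by simp
qed

end

section \<open>Energy of the uniform flux and lower bound\<close>

text \<open>The lower bounds on single edges may be negative; \<open>ennreal\<close> truncates them
  to 0, which can only increase the sum on the right.\<close>

lemma ennreal_sum_le: "ennreal (\<Sum>i\<in>A. f i) \<le> (\<Sum>i\<in>A. ennreal (f i))"
proof -
  have "ennreal (\<Sum>i\<in>A. f i) \<le> ennreal (\<Sum>i\<in>A. max 0 (f i))"
    by (intro ennreal_leI sum_mono) simp
  also have "\<dots> = (\<Sum>i\<in>A. ennreal (max 0 (f i)))" by (subst sum_ennreal) auto
  also have "\<dots> = (\<Sum>i\<in>A. ennreal (f i))" by (intro sum.cong) (auto simp: max_def ennreal_neg)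
  finally show ?thesis .
qed

text \<open>Expansion of the nonnegative quotient \<open>(v - a * \<mu>)\<^sup>2 / \<mu>\<close>.
  The left side is linear in \<open>v\<close> and \<open>\<mu>\<close>, so it can be summed over
  edges. At \<open>\<mu> = 0\<close> the right side is infinite unless \<open>v = 0\<close>, where
  both sides are 0.\<close>

lemma action_quot_ge:
  assumes "\<mu> \<ge> 0" "k > 0"
  shows "ennreal (k * (2 * a * v - a\<^sup>2 * \<mu>)) \<le> ennreal k * action_quot (v\<^sup>2) \<mu>"
proof (cases "\<mu> = 0")
  case True
  then show ?thesis using assms(2) by (cases "v = 0") (auto simp: action_quot_def ennreal_mult_top)
next
  case False
  then have \<mu>: "\<mu> > 0" using assms(1) by simp
  have "0 \<le> (v - a * \<mu>)\<^sup>2 / \<mu>" using \<mu> by simp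
  also have "\<dots> = v\<^sup>2 / \<mu> - (2 * a * v - a\<^sup>2 * \<mu>)" using \<mu> by (simp add: field_simps power2_eq_square)
  finally have "k * (2 * a * v - a\<^sup>2 * \<mu>) \<le> k * (v\<^sup>2 / \<mu>)" using assms(2) by (intro mult_left_mono) auto
  then show ?thesis using \<mu> assms(2) by (simp add: action_quot_def ennreal_leI flip: ennreal_mult')
qed

text \<open>The interior zero \<open>a\<close> is a proper convex combination of \<open>b\<close>
  and another point \<open>c\<close> of the quadrant. Both values are nonnegative, and concavity
  bounds their weighted mean by \<open>g a = 0\<close>.\<close>

lemma concave_zero_imp_zero:
  assumes g: "concave_on quadrant g" "\<And>b. b \<in> quadrant \<Longrightarrow> g b \<ge> 0"
    and a: "g a = 0" "fst a > 0" "snd a > 0" and b: "b \<in> quadrant"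
  shows "g b = 0"
proof -
  define q where "q = fst b + snd b + fst a + snd a"
  have b0: "fst b \<ge> 0" "snd b \<ge> 0" using b by (auto simp: quadrant_def)
  have q: "q > 0" "fst b \<le> q" "snd b \<le> q" using a b0 by (simp_all add: q_def)
  \<comment> \<open>Small enough that \<open>t *\<^sub>R b\<close> lies below \<open>a\<close> in
    both components, so that \<open>c\<close> stays in the quadrant; the bound 1/2 keeps
    \<open>1 - t\<close> positive.\<close>
  define t where "t = min (1/2) (min (fst a / q) (snd a / q))"
  have t: "0 < t" using a q by (simp add: t_def)
  have t2: "t \<le> 1 / 2" "t \<le> fst a / q" "t \<le> snd a / q"
    unfolding t_def by (simp_all only: min.cobounded1 min.coboundedI2 min.cobounded2)
  have tq: "t * q \<le> fst a" "t * q \<le> snd a"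
    using t2(2,3) q(1) by (simp_all only: pos_le_divide_eq)
  have tb: "t * fst b \<le> fst a" "t * snd b \<le> snd a"
    using tq mult_left_mono[OF q(2), of t] mult_left_mono[OF q(3), of t] t by linarith+
  define c where "c = (1 / (1 - t)) *\<^sub>R (a - t *\<^sub>R b)"
  have "fst c \<ge> 0" "snd c \<ge> 0" using t2(1) tb by (simp_all add: c_def)
  then have c: "c \<in> quadrant" by (simp add: quadrant_def mem_Times_iff)
  have "a = t *\<^sub>R b + (1 - t) *\<^sub>R c" using t t2(1) by (simp add: c_def)
  then have "t * g b + (1 - t) * g c \<le> g a"
    using concave_onD[OF g(1), of "1 - t" b c] t t2(1) b c by simp
  moreover have "(1 - t) * g c \<ge> 0" using g(2)[OF c] t2(1) by (intro mult_nonneg_nonneg) simp_all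
  ultimately have "t * g b \<le> 0" using a(1) by linarith
  then show ?thesis using g(2)[OF b] t by (simp add: mult_le_0_iff)
qed

locale fv_energy = fv_mesh X K for X :: "(real ^ 'd) set" and K +
  fixes mob :: "real \<Rightarrow> real" and mobE :: "real ^ 'd \<Rightarrow> real ^ 'd \<Rightarrow> real \<times> real \<Rightarrow> real"
  assumes mobility: "mobility mob" and admissible: "admissible_mobilities X K mob mobE"
begin

lemma mobE_props:
  assumes "(x, y) \<in> edges X K"
  shows "\<And>r. r \<in> quadrant \<Longrightarrow> mobE x y r \<ge> 0" "concave_on quadrant (mobE x y)"
    "\<And>\<rho>. \<rho> \<ge> 0 \<Longrightarrow> mobE x y (\<rho>, \<rho>) = mob \<rho>"
    "\<And>a b. a \<ge> 0 \<Longrightarrow> b \<ge> 0 \<Longrightarrow> mobE x y (a, b) = mobE y x (b, a)"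
    "\<And>z r. z \<in> int_lattice \<Longrightarrow> r \<in> quadrant \<Longrightarrow> mobE (x + z) (y + z) r = mobE x y r"
  using bspec[OF admissible[unfolded admissible_mobilities_def] assms] by auto

lemma mob_nonneg: "\<rho> \<ge> 0 \<Longrightarrow> mob \<rho> \<ge> 0"
  using mobility by (simp add: mobility_def)

lemma edgesQ_edges: "(x, y) \<in> edgesQ X K \<Longrightarrow> (x, y) \<in> edges X K"
  by (simp add: edgesQ_def)

section \<open>The uniform flux and the constraints on competitors\<close>

lemma edge_weight_pos: "(x, y) \<in> edges X K \<Longrightarrow> dist x y / area K x y > 0"
  using area_pos edge_points(3) by simp

text \<open>On an edge this is \<open>dist x y / area K x y\<close> times the square of the uniform
  flux. It is also the uniform flux times \<open>(y - x) \<bullet> j\<close>, which is how its total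
  is obtained.\<close>

definition weight :: "real ^ 'd \<Rightarrow> real ^ 'd \<Rightarrow> real ^ 'd \<Rightarrow> real" where
  "weight j x y = dist x y * area K x y * (normal x y \<bullet> j)\<^sup>2"

definition uniform_flux :: "real ^ 'd \<Rightarrow> real ^ 'd \<Rightarrow> real ^ 'd \<Rightarrow> real" where
  "uniform_flux j x y = area K x y * (normal x y \<bullet> j)"

lemma normal_sym: "normal y x = - normal x y"
  by (simp add: normal_def dist_commute flip: scaleR_minus_right)

lemma normal_shift: "normal (x + z) (y + z) = normal x y"
  by (simp add: normal_def)

lemma diff_inner_normal: "x \<noteq> y \<Longrightarrow> (y - x) \<bullet> j = dist x y * (normal x y \<bullet> j)"
  by (simp add: normal_def)

lemma weight_nonneg: "weight j x y \<ge> 0"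
  by (simp add: weight_def area_def)

lemma weight_sym: "weight j x y = weight j y x"
  unfolding weight_def area_sym[of x y] normal_sym[of x y] by (simp add: dist_commute)

lemma weight_shift: "x \<in> X \<Longrightarrow> y \<in> X \<Longrightarrow> z \<in> int_lattice \<Longrightarrow> weight j (x + z) (y + z) = weight j x y"
  by (simp add: weight_def area_shift normal_shift dist_norm)

lemma sum_weight: "(\<Sum>(x, y)\<in>edgesQ X K. weight j x y) = 2 * (norm j)\<^sup>2"
proof -
  have "(\<Sum>(x, y)\<in>edgesQ X K. weight j x y) = (\<Sum>(x, y)\<in>edgesQ X K. area K x y * (normal x y \<bullet> j) * ((y - x) \<bullet> j))"
  proof (intro sum.cong refl, clarify)
    fix x y assume "(x, y) \<in> edgesQ X K"
    then have "x \<noteq> y" using edgesQ_edges edge_points(3) by blast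
    then show "weight j x y = area K x y * (normal x y \<bullet> j) * ((y - x) \<bullet> j)"
      by (simp add: weight_def diff_inner_normal power2_eq_square)
  qed
  also have "\<dots> = 2 * (j \<bullet> j)" by (rule flux_identity)
  finally show ?thesis by (simp add: power2_norm_eq_inner)
qed

lemma edge_transport:
  assumes "\<And>x y z. (x, y) \<in> edges X K \<Longrightarrow> z \<in> int_lattice \<Longrightarrow> h (x + z) (y + z) = h x y"
  shows "(\<Sum>(x, y)\<in>edgesQ X K. h x y) = (\<Sum>(x, y)\<in>edgesQ X K. h y x)"
  unfolding edgesQ_eq by (rule mass_transport) (use edges_sym edges_shift assms in blast)+

text \<open>The two displacements differ by the increment along the edge of the periodic function
  \<open>x - lattice_part x\<close>. A periodic antisymmetric divergence-free flux is orthogonal to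
  all such increments, by summation by parts over a period.\<close>

lemma flux_lattice_displacement:
  assumes anti: "\<And>x y. (x, y) \<in> edges X K \<Longrightarrow> J y x = - J x y"
    and per: "\<And>x y z. (x, y) \<in> edges X K \<Longrightarrow> z \<in> int_lattice \<Longrightarrow> J (x + z) (y + z) = J x y"
    and div: "\<And>x. x \<in> X \<Longrightarrow> (\<Sum>y\<in>nbrs X K x. J x y) = 0"
  shows "(\<Sum>(x, y)\<in>edgesQ X K. J x y *\<^sub>R (lattice_part y - lattice_part x)) = (\<Sum>(x, y)\<in>edgesQ X K. J x y *\<^sub>R (y - x))"
proof -
  let ?f = "\<lambda>x. x - lattice_part x"
  have 0: "(\<Sum>(x, y)\<in>edgesQ X K. J x y *\<^sub>R ?f x) = 0"
  proof -
    have "(\<Sum>(x, y)\<in>edgesQ X K. J x y *\<^sub>R ?f x) = (\<Sum>x\<in>cellsQ X. (\<Sum>y\<in>nbrs X K x. J x y) *\<^sub>R ?f x)"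
      unfolding edgesQ_sum scaleR_sum_left ..
    also have "\<dots> = 0" using div by (intro sum.neutral) (auto simp: cellsQ_def)
    finally show ?thesis .
  qed
  have "(\<Sum>(x, y)\<in>edgesQ X K. J x y *\<^sub>R ?f y) = (\<Sum>(x, y)\<in>edgesQ X K. J y x *\<^sub>R ?f x)"
    by (rule edge_transport) (simp add: per lattice_part_add)
  also have "\<dots> = - (\<Sum>(x, y)\<in>edgesQ X K. J x y *\<^sub>R ?f x)"
    unfolding sum_negf[symmetric]
  proof (intro sum.cong refl, clarify)
    fix x y assume "(x, y) \<in> edgesQ X K"
    then show "J y x *\<^sub>R (x - lattice_part x) = - (J x y *\<^sub>R (x - lattice_part x))"
      by (simp only: anti[OF edgesQ_edges] scaleR_minus_left)
  qed
  finally have 1: "(\<Sum>(x, y)\<in>edgesQ X K. J x y *\<^sub>R ?f y) = 0" using 0 by simp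
  have "(\<Sum>(x, y)\<in>edgesQ X K. J x y *\<^sub>R (y - x)) - (\<Sum>(x, y)\<in>edgesQ X K. J x y *\<^sub>R (lattice_part y - lattice_part x))
      = (\<Sum>(x, y)\<in>edgesQ X K. J x y *\<^sub>R ?f y) - (\<Sum>(x, y)\<in>edgesQ X K. J x y *\<^sub>R ?f x)"
    unfolding sum_subtractf[symmetric] by (intro sum.cong refl) (auto simp: algebra_simps)
  then show ?thesis using 0 1 by simp
qed

lemma competitorD:
  assumes "competitor X K \<rho> j m J"
  shows "\<And>x. x \<in> X \<Longrightarrow> m x \<ge> 0" "\<And>x z. x \<in> X \<Longrightarrow> z \<in> int_lattice \<Longrightarrow> m (x + z) = m x"
    "(\<Sum>x\<in>cellsQ X. m x) = \<rho>"
    "\<And>x y. (x, y) \<in> edges X K \<Longrightarrow> J y x = - J x y"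
    "\<And>x y z. (x, y) \<in> edges X K \<Longrightarrow> z \<in> int_lattice \<Longrightarrow> J (x + z) (y + z) = J x y"
    "\<And>x. x \<in> X \<Longrightarrow> (\<Sum>y\<in>nbrs X K x. J x y) = 0"
    "(1 / 2) *\<^sub>R (\<Sum>(x, y)\<in>edgesQ X K. J x y *\<^sub>R (lattice_part y - lattice_part x)) = j"
proof -
  have 1: "\<forall>x\<in>X. m x \<ge> 0 \<and> (\<forall>z\<in>int_lattice. m (x + z) = m x)"
    and 2: "\<forall>(x, y)\<in>edges X K. J y x = - J x y \<and> (\<forall>z\<in>int_lattice. J (x + z) (y + z) = J x y)"
    and 3: "(\<Sum>x\<in>cellsQ X. m x) = \<rho>" and 4: "\<forall>x\<in>X. (\<Sum>y\<in>nbrs X K x. J x y) = 0"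
    and 5: "(1 / 2) *\<^sub>R (\<Sum>(x, y)\<in>edgesQ X K. J x y *\<^sub>R (lattice_part y - lattice_part x)) = j"
    using assms unfolding competitor_def by - (elim conjE, assumption)+
  show "\<And>x. x \<in> X \<Longrightarrow> m x \<ge> 0" "\<And>x z. x \<in> X \<Longrightarrow> z \<in> int_lattice \<Longrightarrow> m (x + z) = m x"
    using 1 by blast+
  show "\<And>x y. (x, y) \<in> edges X K \<Longrightarrow> J y x = - J x y"
    "\<And>x y z. (x, y) \<in> edges X K \<Longrightarrow> z \<in> int_lattice \<Longrightarrow> J (x + z) (y + z) = J x y"
    using 2 by blast+
  show "\<And>x. x \<in> X \<Longrightarrow> (\<Sum>y\<in>nbrs X K x. J x y) = 0" using 4 by blast
  show "(\<Sum>x\<in>cellsQ X. m x) = \<rho>" by (rule 3)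
  show "(1 / 2) *\<^sub>R (\<Sum>(x, y)\<in>edgesQ X K. J x y *\<^sub>R (lattice_part y - lattice_part x)) = j" by (rule 5)
qed

text \<open>Makes the part of the lower bound that is linear in \<open>J\<close> independent of the
  competitor.\<close>

lemma competitor_flux:
  assumes "competitor X K \<rho> j m J"
  shows "(\<Sum>(x, y)\<in>edgesQ X K. J x y * ((y - x) \<bullet> k)) = 2 * (j \<bullet> k)"
proof -
  note c = competitorD[OF assms]
  have "(1 / 2) *\<^sub>R (\<Sum>(x, y)\<in>edgesQ X K. J x y *\<^sub>R (y - x)) = j"
    using c(7) flux_lattice_displacement[OF c(4,5,6)] by simp
  then have "((1 / 2) *\<^sub>R (\<Sum>(x, y)\<in>edgesQ X K. J x y *\<^sub>R (y - x))) \<bullet> k = j \<bullet> k" by (rule arg_cong)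
  then show ?thesis by (simp add: inner_sum_left case_prod_unfold)
qed

text \<open>The density \<open>r\<close> is left free because the constraints on the flux do not
  involve the mass: constant \<open>r\<close> gives the upper bound, perturbations of it the first
  variation.\<close>

lemma competitor_uniform:
  assumes r: "\<And>x. x \<in> X \<Longrightarrow> r x \<ge> 0" "\<And>x z. x \<in> X \<Longrightarrow> z \<in> int_lattice \<Longrightarrow> r (x + z) = r x"
    "(\<Sum>x\<in>cellsQ X. vol K x * r x) = \<rho>"
  shows "competitor X K \<rho> j (\<lambda>x. vol K x * r x) (uniform_flux j)"
proof -
  have anti: "uniform_flux j y x = - uniform_flux j x y" for x y
    unfolding uniform_flux_def area_sym[of y x] normal_sym[of y x] by simp
  have per: "uniform_flux j (x + z) (y + z) = uniform_flux j x y"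
    if "(x, y) \<in> edges X K" "z \<in> int_lattice" for x y z
    using edge_points[OF that(1)] that(2) by (simp add: uniform_flux_def area_shift normal_shift)
  have div: "(\<Sum>y\<in>nbrs X K x. uniform_flux j x y) = 0" if "x \<in> X" for x
    unfolding uniform_flux_def by (rule cell_divergence[OF that])
  have "(\<Sum>(x, y)\<in>edgesQ X K. uniform_flux j x y *\<^sub>R (y - x)) = 2 *\<^sub>R j"
  proof (rule vector_eq_ldot[THEN iffD1], rule allI)
    fix k
    show "k \<bullet> (\<Sum>(x, y)\<in>edgesQ X K. uniform_flux j x y *\<^sub>R (y - x)) = k \<bullet> (2 *\<^sub>R j)"
      using flux_identity[of j k]
      by (simp add: inner_sum_right case_prod_unfold uniform_flux_def inner_commute)
  qed
  then have "(1 / 2) *\<^sub>R (\<Sum>(x, y)\<in>edgesQ X K. uniform_flux j x y *\<^sub>R (lattice_part y - lattice_part x)) = j"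
    using flux_lattice_displacement[of "uniform_flux j", OF anti per div] by simp
  note flux = this
  show ?thesis
    unfolding competitor_def
  proof (intro conjI)
    show "\<forall>x\<in>X. vol K x * r x \<ge> 0 \<and> (\<forall>z\<in>int_lattice. vol K (x + z) * r (x + z) = vol K x * r x)"
      using r(1,2) vol_pos by (simp add: vol_shift less_imp_le)
    show "\<forall>(x, y)\<in>edges X K. uniform_flux j y x = - uniform_flux j x y \<and>
        (\<forall>z\<in>int_lattice. uniform_flux j (x + z) (y + z) = uniform_flux j x y)"
      using anti per by blast
    show "\<forall>x\<in>X. (\<Sum>y\<in>nbrs X K x. uniform_flux j x y) = 0" using div by blast
  qed (fact r(3), fact flux)
qed

lemma uniform_energy:
  assumes pos: "\<And>x y. (x, y) \<in> edgesQ X K \<Longrightarrow> mobE x y (r x, r y) > 0"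
  shows "discrete_energy X K mobE (\<lambda>x. vol K x * r x) (uniform_flux j) =
    ennreal ((\<Sum>(x, y)\<in>edgesQ X K. weight j x y / mobE x y (r x, r y)) / 2)"
proof -
  have "(\<Sum>(x, y)\<in>edgesQ X K. ennreal (dist x y / area K x y) *
      action_quot ((uniform_flux j x y)\<^sup>2) (mobE x y (vol K x * r x / vol K x, vol K y * r y / vol K y)))
    = (\<Sum>(x, y)\<in>edgesQ X K. ennreal (weight j x y / mobE x y (r x, r y)))"
  proof (intro sum.cong refl, clarify)
    fix x y assume e: "(x, y) \<in> edgesQ X K"
    note e' = edgesQ_edges[OF e]
    have v: "vol K x > 0" "vol K y > 0" using vol_pos edge_points[OF e'] by auto
    have a: "area K x y > 0" using area_pos[OF e'] .
    have "dist x y / area K x y * ((uniform_flux j x y)\<^sup>2 / mobE x y (r x, r y)) = weight j x y / mobE x y (r x, r y)"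
      using a by (simp add: uniform_flux_def weight_def power2_eq_square)
    then show "ennreal (dist x y / area K x y) *
        action_quot ((uniform_flux j x y)\<^sup>2) (mobE x y (vol K x * r x / vol K x, vol K y * r y / vol K y)) =
      ennreal (weight j x y / mobE x y (r x, r y))"
      using v a pos[OF e] by (simp add: action_quot_def flip: ennreal_mult')
  qed
  also have "\<dots> = ennreal (\<Sum>(x, y)\<in>edgesQ X K. weight j x y / mobE x y (r x, r y))"
    unfolding case_prod_unfold using pos weight_nonneg
    by (intro sum_ennreal divide_nonneg_pos) auto
  also have "\<dots> / 2 = ennreal ((\<Sum>(x, y)\<in>edgesQ X K. weight j x y / mobE x y (r x, r y)) / 2)"
  proof -
    have "0 \<le> (\<Sum>(x, y)\<in>edgesQ X K. weight j x y / mobE x y (r x, r y))"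
      using pos weight_nonneg by (intro sum_nonneg) (auto intro!: divide_nonneg_pos)
    then show ?thesis using divide_ennreal[of _ 2] by simp
  qed
  finally show ?thesis unfolding discrete_energy_def .
qed

lemma f_hom_uniform_le:
  assumes r: "\<And>x. x \<in> X \<Longrightarrow> r x \<ge> 0" "\<And>x z. x \<in> X \<Longrightarrow> z \<in> int_lattice \<Longrightarrow> r (x + z) = r x"
    "(\<Sum>x\<in>cellsQ X. vol K x * r x) = \<rho>"
    and pos: "\<And>x y. (x, y) \<in> edgesQ X K \<Longrightarrow> mobE x y (r x, r y) > 0"
  shows "f_hom X K mobE \<rho> j \<le> ennreal ((\<Sum>(x, y)\<in>edgesQ X K. weight j x y / mobE x y (r x, r y)) / 2)"
proof -
  have "f_hom X K mobE \<rho> j \<le> discrete_energy X K mobE (\<lambda>x. vol K x * r x) (uniform_flux j)"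
    unfolding f_hom_def
    using competitor_uniform[OF r, of j] by (intro INF_lower2[of "(\<lambda>x. vol K x * r x, uniform_flux j)"]) auto
  then show ?thesis by (simp only: uniform_energy[OF pos])
qed

theorem f_hom_le:
  assumes \<rho>: "\<rho> \<ge> 0"
  shows "f_hom X K mobE \<rho> j \<le> action_density mob \<rho> j"
proof -
  have s: "(\<Sum>x\<in>cellsQ X. vol K x * \<rho>) = \<rho>" by (simp add: sum_vol flip: sum_distrib_right)
  have m: "mobE x y (\<rho>, \<rho>) = mob \<rho>" if "(x, y) \<in> edgesQ X K" for x y
    using mobE_props(3)[OF edgesQ_edges[OF that] \<rho>] .
  consider "mob \<rho> > 0" | "mob \<rho> = 0" "j \<noteq> 0" | "mob \<rho> = 0" "j = 0"
    using mob_nonneg[OF \<rho>] by fastforce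
  then show ?thesis
  proof cases
    case 1
    have "f_hom X K mobE \<rho> j \<le> ennreal ((\<Sum>(x, y)\<in>edgesQ X K. weight j x y / mobE x y (\<rho>, \<rho>)) / 2)"
      using \<rho> 1 s m by (intro f_hom_uniform_le[of "\<lambda>_. \<rho>"]) auto
    also have "(\<Sum>(x, y)\<in>edgesQ X K. weight j x y / mobE x y (\<rho>, \<rho>)) = (\<Sum>(x, y)\<in>edgesQ X K. weight j x y) / mob \<rho>"
      unfolding sum_divide_distrib by (intro sum.cong refl) (auto simp: m)
    finally show ?thesis using 1 by (simp add: action_density_def action_quot_def sum_weight)
  next
    case 2
    then show ?thesis by (simp add: action_density_def action_quot_def)
  next
    case 3
    have "discrete_energy X K mobE (\<lambda>x. vol K x * \<rho>) (uniform_flux j) = 0"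
      using 3 by (auto simp: discrete_energy_def uniform_flux_def action_quot_def intro!: sum.neutral)
    moreover have "f_hom X K mobE \<rho> j \<le> discrete_energy X K mobE (\<lambda>x. vol K x * \<rho>) (uniform_flux j)"
      unfolding f_hom_def using competitor_uniform[of "\<lambda>_. \<rho>" \<rho> j] \<rho> s
      by (intro INF_lower2[of "(\<lambda>x. vol K x * \<rho>, uniform_flux j)"]) auto
    ultimately show ?thesis by simp
  qed
qed

text \<open>\<open>action_quot_ge\<close> is used on each edge with
  \<open>a = uniform_flux j x y / mob \<rho>\<close>. The linear terms add up to
  \<open>4 * (norm j)\<^sup>2 / mob \<rho>\<close>; by \<open>H\<close> and
  \<open>sum_weight\<close> the terms with the mobilities subtract at most half of that. The factor
  1/2 of the energy does the rest.\<close>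

lemma energy_ge:
  assumes c: "competitor X K \<rho> j m J" and \<rho>: "\<rho> \<ge> 0" "mob \<rho> > 0"
    and H: "(\<Sum>(x, y)\<in>edgesQ X K. weight j x y * (mobE x y (m x / vol K x, m y / vol K y) - mob \<rho>)) \<le> 0"
  shows "ennreal ((norm j)\<^sup>2 / mob \<rho>) \<le> discrete_energy X K mobE m J"
proof -
  let ?\<mu> = "\<lambda>x y. mobE x y (m x / vol K x, m y / vol K y)"
  define g where "g x y = 2 * (J x y * ((y - x) \<bullet> j)) / mob \<rho> - weight j x y * ?\<mu> x y / (mob \<rho>)\<^sup>2" for x y
  have tm: "ennreal (g x y) \<le> ennreal (dist x y / area K x y) * action_quot ((J x y)\<^sup>2) (?\<mu> x y)"
    if e: "(x, y) \<in> edgesQ X K" for x y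
  proof -
    note e' = edgesQ_edges[OF e]
    note p = edge_points[OF e']
    have a: "area K x y > 0" using area_pos[OF e'] .
    have "(m x / vol K x, m y / vol K y) \<in> quadrant"
      using competitorD(1)[OF c] vol_pos p by (simp add: quadrant_def less_imp_le)
    then have "?\<mu> x y \<ge> 0" by (rule mobE_props(1)[OF e'])
    note le = action_quot_ge[OF this edge_weight_pos[OF e'], of "uniform_flux j x y / mob \<rho>" "J x y"]
    have "dist x y / area K x y * (2 * (uniform_flux j x y / mob \<rho>) * J x y - (uniform_flux j x y / mob \<rho>)\<^sup>2 * ?\<mu> x y) = g x y"
      using a \<rho>(2) by (simp add: g_def uniform_flux_def weight_def diff_inner_normal[OF p(3)] power2_eq_square field_simps)
    then show ?thesis using le by (simp only:)
  qed
  have "(\<Sum>(x, y)\<in>edgesQ X K. g x y) = 2 * (2 * (j \<bullet> j)) / mob \<rho>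
      - (\<Sum>(x, y)\<in>edgesQ X K. weight j x y * ?\<mu> x y) / (mob \<rho>)\<^sup>2"
    unfolding g_def competitor_flux[OF c, symmetric] sum_divide_distrib sum_distrib_left sum_subtractf[symmetric]
    by (intro sum.cong) auto
  moreover have "(\<Sum>(x, y)\<in>edgesQ X K. weight j x y * ?\<mu> x y) \<le> mob \<rho> * (2 * (norm j)\<^sup>2)"
  proof -
    have "(\<Sum>(x, y)\<in>edgesQ X K. weight j x y * (?\<mu> x y - mob \<rho>)) =
        (\<Sum>(x, y)\<in>edgesQ X K. weight j x y * ?\<mu> x y) - mob \<rho> * (\<Sum>(x, y)\<in>edgesQ X K. weight j x y)"
      unfolding sum_distrib_left sum_subtractf[symmetric] by (intro sum.cong) (auto simp: algebra_simps)
    then show ?thesis using H by (simp add: sum_weight)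
  qed
  then have "(\<Sum>(x, y)\<in>edgesQ X K. weight j x y * ?\<mu> x y) / (mob \<rho>)\<^sup>2 \<le> mob \<rho> * (2 * (norm j)\<^sup>2) / (mob \<rho>)\<^sup>2"
    by (rule divide_right_mono) simp
  then have "(\<Sum>(x, y)\<in>edgesQ X K. weight j x y * ?\<mu> x y) / (mob \<rho>)\<^sup>2 \<le> 2 * (norm j)\<^sup>2 / mob \<rho>"
    using \<rho>(2) by (simp add: power2_eq_square)
  ultimately have "2 * ((norm j)\<^sup>2 / mob \<rho>) \<le> (\<Sum>(x, y)\<in>edgesQ X K. g x y)"
    by (simp add: power2_norm_eq_inner)
  then have "ennreal (2 * ((norm j)\<^sup>2 / mob \<rho>)) \<le> ennreal (\<Sum>(x, y)\<in>edgesQ X K. g x y)" by (rule ennreal_leI)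
  also have "\<dots> \<le> (\<Sum>p\<in>edgesQ X K. ennreal (case p of (x, y) \<Rightarrow> g x y))" by (rule ennreal_sum_le)
  also have "\<dots> \<le> (\<Sum>(x, y)\<in>edgesQ X K. ennreal (dist x y / area K x y) * action_quot ((J x y)\<^sup>2) (?\<mu> x y))"
    using tm by (intro sum_mono) auto
  finally have "ennreal (2 * ((norm j)\<^sup>2 / mob \<rho>)) / 2 \<le> discrete_energy X K mobE m J"
    unfolding discrete_energy_def by (rule divide_right_mono_ennreal)
  moreover have "ennreal (2 * ((norm j)\<^sup>2 / mob \<rho>)) / 2 = ennreal ((norm j)\<^sup>2 / mob \<rho>)"
    using \<rho>(2) divide_ennreal[of "2 * ((norm j)\<^sup>2 / mob \<rho>)" 2] by simp
  ultimately show ?thesis by simp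
qed

text \<open>Tested with \<open>j\<close>, the total flux is \<open>2 * (j \<bullet> j)\<close>, so
  some edge of the period carries a nonzero flux, and its quotient has denominator 0.\<close>

lemma energy_infinite:
  assumes c: "competitor X K \<rho> j m J" and j: "j \<noteq> 0"
    and z: "\<And>x y. (x, y) \<in> edgesQ X K \<Longrightarrow> mobE x y (m x / vol K x, m y / vol K y) = 0"
  shows "discrete_energy X K mobE m J = \<infinity>"
proof -
  have "\<exists>p\<in>edgesQ X K. J (fst p) (snd p) \<noteq> 0"
  proof (rule ccontr)
    assume "\<not> ?thesis"
    then have "(\<Sum>(x, y)\<in>edgesQ X K. J x y * ((y - x) \<bullet> j)) = 0" by (intro sum.neutral) auto
    then show False using competitor_flux[OF c, of j] j by simp
  qed
  then obtain x y where e: "(x, y) \<in> edgesQ X K" "J x y \<noteq> 0" by auto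
  have "ennreal (dist x y / area K x y) * action_quot ((J x y)\<^sup>2) (mobE x y (m x / vol K x, m y / vol K y)) = \<infinity>"
    using z[OF e(1)] e(2) edge_weight_pos[OF edgesQ_edges[OF e(1)]]
    by (simp only: action_quot_def) (simp add: ennreal_mult_top ennreal_eq_0_iff flip: not_less)
  then have "(\<Sum>(x, y)\<in>edgesQ X K. ennreal (dist x y / area K x y) *
      action_quot ((J x y)\<^sup>2) (mobE x y (m x / vol K x, m y / vol K y))) = \<infinity>"
    using sum.remove[OF finite_edgesQ e(1), of "\<lambda>(x, y). ennreal (dist x y / area K x y) *
      action_quot ((J x y)\<^sup>2) (mobE x y (m x / vol K x, m y / vol K y))"] by simp
  then show ?thesis by (simp add: discrete_energy_def ennreal_top_divide)
qed

text \<open>Reduces equality to an inequality for the weighted mean of the mobilities in the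
  nondegenerate case. If \<open>\<rho> = 0\<close> all densities vanish and lie on the diagonal; if
  \<open>mob \<rho> = 0\<close> with \<open>\<rho> > 0\<close>, all edge mobilities vanish
  identically on the quadrant.\<close>

lemma f_hom_eqI:
  assumes \<rho>: "\<rho> \<ge> 0"
    and H: "\<And>r. \<lbrakk>\<rho> > 0; mob \<rho> > 0; \<And>x. x \<in> X \<Longrightarrow> r x \<ge> 0;
        \<And>x z. x \<in> X \<Longrightarrow> z \<in> int_lattice \<Longrightarrow> r (x + z) = r x; (\<Sum>x\<in>cellsQ X. vol K x * r x) = \<rho>\<rbrakk> \<Longrightarrow>
      (\<Sum>(x, y)\<in>edgesQ X K. weight j x y * (mobE x y (r x, r y) - mob \<rho>)) \<le> 0"
  shows "f_hom X K mobE \<rho> j = action_density mob \<rho> j"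
proof (rule antisym)
  show "f_hom X K mobE \<rho> j \<le> action_density mob \<rho> j" by (rule f_hom_le[OF \<rho>])
  show "action_density mob \<rho> j \<le> f_hom X K mobE \<rho> j"
    unfolding f_hom_def
  proof (rule INF_greatest, clarify)
    fix m J assume c: "competitor X K \<rho> j m J"
    note c' = competitorD[OF c]
    define r where "r x = m x / vol K x" for x
    have r0: "r x \<ge> 0" if "x \<in> X" for x using c'(1)[OF that] vol_pos[OF that] by (simp add: r_def)
    have rp: "r (x + z) = r x" if "x \<in> X" "z \<in> int_lattice" for x z
      using c'(2)[OF that] vol_shift[OF that] by (simp add: r_def)
    have "(\<Sum>x\<in>cellsQ X. vol K x * r x) = (\<Sum>x\<in>cellsQ X. m x)"
      using vol_pos by (intro sum.cong) (force simp: r_def cellsQ_def)+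
    then have rs: "(\<Sum>x\<in>cellsQ X. vol K x * r x) = \<rho>" using c'(3) by simp
    have zero: "r x = 0" if "\<rho> = 0" "x \<in> X" for x
    proof -
      have "m q = 0" if "q \<in> cellsQ X" for q
      proof -
        have "\<forall>q\<in>cellsQ X. m q = 0"
          using c'(3) \<open>\<rho> = 0\<close> c'(1) finite_cellsQ by (subst sum_nonneg_eq_0_iff[symmetric]) (auto simp: cellsQ_def)
        then show ?thesis using that by blast
      qed
      then have "r (x - lattice_part x) = 0" using representative[OF that(2)] by (simp add: r_def)
      then show ?thesis
        using rp[of "x - lattice_part x" "lattice_part x"] point_shift_diff[OF that(2)] by simp
    qed
    have diag: "mobE x y (r x, r y) = mob 0" if "\<rho> = 0" "(x, y) \<in> edgesQ X K" for x y
      using zero[OF that(1)] edge_points[OF edgesQ_edges[OF that(2)]] mobE_props(3)[OF edgesQ_edges[OF that(2)], of 0] by simp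
    consider "mob \<rho> > 0" | "mob \<rho> = 0" "j \<noteq> 0" | "mob \<rho> = 0" "j = 0"
      using mob_nonneg[OF \<rho>] by fastforce
    then show "action_density mob \<rho> j \<le> discrete_energy X K mobE m J"
    proof cases
      case 1
      have "(\<Sum>(x, y)\<in>edgesQ X K. weight j x y * (mobE x y (r x, r y) - mob \<rho>)) \<le> 0"
      proof (cases "\<rho> = 0")
        case True
        then show ?thesis using diag by (intro sum_nonpos) auto
      next
        case False
        then show ?thesis using \<rho> 1 r0 rp rs by (intro H) auto
      qed
      then show ?thesis
        using energy_ge[OF c \<rho> 1] 1 by (simp add: r_def action_density_def action_quot_def)
    next
      case 2
      have "mobE x y (r x, r y) = 0" if e: "(x, y) \<in> edgesQ X K" for x y
      proof (cases "\<rho> = 0")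
        case True
        then show ?thesis using diag[OF True e] 2 by simp
      next
        case False
        note e' = edgesQ_edges[OF e]
        have q: "(r x, r y) \<in> quadrant"
          using r0 edge_points[OF e'] by (simp add: quadrant_def)
        have m0: "mobE x y (\<rho>, \<rho>) = 0" using mobE_props(3)[OF e' \<rho>] 2(1) by simp
        show ?thesis
          by (rule concave_zero_imp_zero[OF mobE_props(2)[OF e'] mobE_props(1)[OF e'] m0 _ _ q])
            (use False \<rho> in simp_all)
      qed
      then have "discrete_energy X K mobE m J = \<infinity>"
        unfolding r_def by (rule energy_infinite[OF c 2(2)])
      then show ?thesis by simp
    next
      case 3
      then show ?thesis by (simp add: action_density_def action_quot_def)
    qed
  qed
qed

end

section \<open>Averaging supergradients over lattice boxes\<close>

definition lattice_box :: "nat \<Rightarrow> (real ^ 'd) set" where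
  "lattice_box R = {z \<in> int_lattice. \<forall>i. \<bar>z $ i\<bar> \<le> real R}"

lemma lattice_box_eq_image:
  "lattice_box R = (\<lambda>f. \<chi> i. of_int (f i)) ` (UNIV \<rightarrow>\<^sub>E {- int R..int R})"
proof (intro set_eqI iffI)
  fix z :: "real ^ 'd" assume z: "z \<in> lattice_box R"
  have "of_int \<lfloor>z $ i\<rfloor> = z $ i" for i using z by (simp add: lattice_box_def int_lattice_def)
  then have "z = (\<chi> i. of_int \<lfloor>z $ i\<rfloor>)" by (simp only: vec_lambda_eta)
  moreover have "\<lfloor>z $ i\<rfloor> \<in> {- int R..int R}" for i
  proof -
    have "\<bar>z $ i\<bar> \<le> real R" using z by (simp add: lattice_box_def)
    then show ?thesis by (simp add: le_floor_iff floor_le_iff abs_le_iff)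
  qed
  ultimately show "z \<in> (\<lambda>f. \<chi> i. of_int (f i)) ` (UNIV \<rightarrow>\<^sub>E {- int R..int R})"
    by (intro image_eqI[of _ _ "\<lambda>i. \<lfloor>z $ i\<rfloor>"] PiE_I) simp_all
next
  fix z :: "real ^ 'd" assume "z \<in> (\<lambda>f. \<chi> i. of_int (f i)) ` (UNIV \<rightarrow>\<^sub>E {- int R..int R})"
  then obtain f :: "'d \<Rightarrow> int" where f: "z = (\<chi> i. of_int (f i))" "f \<in> UNIV \<rightarrow>\<^sub>E {- int R..int R}" by (rule imageE)
  have "\<bar>real_of_int (f i)\<bar> \<le> real R" for i
    using PiE_mem[OF f(2), of i] by (simp add: abs_le_iff)
  then show "z \<in> lattice_box R" by (simp add: lattice_box_def int_lattice_def f(1))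
qed

lemma finite_lattice_box: "finite (lattice_box R)"
  unfolding lattice_box_eq_image by (intro finite_imageI finite_PiE) auto

lemma card_lattice_box: "card (lattice_box R :: (real ^ 'd) set) = (2 * R + 1) ^ CARD('d)"
proof -
  have "inj_on (\<lambda>f :: 'd \<Rightarrow> int. \<chi> i. real_of_int (f i)) (UNIV \<rightarrow>\<^sub>E {- int R..int R})"
    by (auto simp: inj_on_def vec_eq_iff)
  then have "card (lattice_box R :: (real ^ 'd) set) = card ((UNIV :: 'd set) \<rightarrow>\<^sub>E {- int R..int R})"
    unfolding lattice_box_eq_image by (rule card_image)
  also have "\<dots> = (2 * R + 1) ^ CARD('d)"
    by (subst card_PiE) (auto simp: nat_add_distrib nat_mult_distrib)
  finally show ?thesis .
qed

text \<open>The box and its translate have equally many points and both lie in the enlarged box.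
  Each sum differs from the sum over the enlarged box by at most \<open>M\<close> for every missing
  point.\<close>

lemma lattice_box_translate_sum:
  fixes a :: "real ^ 'd \<Rightarrow> real" and v :: "real ^ 'd"
  assumes a: "\<And>z. z \<in> int_lattice \<Longrightarrow> \<bar>a z\<bar> \<le> M" and v: "v \<in> lattice_box V"
  shows "\<bar>(\<Sum>z\<in>lattice_box R. a (z + v)) - (\<Sum>z\<in>lattice_box R. a z)\<bar>
    \<le> 2 * M * (real (card (lattice_box (R + V) :: (real ^ 'd) set)) - real (card (lattice_box R :: (real ^ 'd) set)))"
proof -
  let ?T = "lattice_box (R + V) :: (real ^ 'd) set" and ?S = "lattice_box R :: (real ^ 'd) set"
  let ?S' = "(\<lambda>z. z + v) ` ?S"
  have rest: "\<bar>sum a ?T - sum a S\<bar> \<le> M * (real (card ?T) - real (card S))" if "S \<subseteq> ?T" for S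
  proof -
    have "sum a ?T - sum a S = sum a (?T - S)" using sum_diff[OF finite_lattice_box that, of a] by simp
    also have "\<bar>\<dots>\<bar> \<le> (\<Sum>z\<in>?T - S. \<bar>a z\<bar>)" by (rule sum_abs)
    also have "\<dots> \<le> real (card (?T - S)) * M"
      using a by (intro sum_bounded_above) (auto simp: lattice_box_def)
    also have "real (card (?T - S)) = real (card ?T) - real (card S)"
      using card_Diff_subset[OF finite_subset[OF that finite_lattice_box] that] card_mono[OF finite_lattice_box that]
      by (simp add: of_nat_diff)
    finally show ?thesis by (simp add: mult.commute)
  qed
  have "?S \<subseteq> ?T" unfolding lattice_box_def by (auto intro: order_trans)
  moreover have S'T: "?S' \<subseteq> ?T"
  proof
    fix w assume "w \<in> ?S'"
    then obtain z where z: "z \<in> ?S" "w = z + v" by auto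
    have "\<bar>(z + v) $ i\<bar> \<le> real (R + V)" for i
    proof -
      have "\<bar>z $ i\<bar> \<le> real R" "\<bar>v $ i\<bar> \<le> real V" using z(1) v by (simp_all add: lattice_box_def)
      then show ?thesis using abs_triangle_ineq[of "z $ i" "v $ i"] by simp
    qed
    then show "w \<in> ?T" using z v by (simp add: lattice_box_def int_lattice_add)
  qed
  moreover have "card ?S' = card ?S" by (intro card_image) (auto simp: inj_on_def)
  moreover have "(\<Sum>z\<in>?S. a (z + v)) = sum a ?S'"
    by (subst sum.reindex) (auto simp: inj_on_def)
  ultimately show ?thesis using rest[of ?S] rest[of ?S'] by (simp add: algebra_simps)
qed

text \<open>The boundary layer of fixed thickness \<open>V\<close> is negligible against the box:
  divide by the number of points of the box and let its side tend to infinity.\<close>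

lemma nonpos_of_boundary_growth:
  fixes D C :: real
  assumes le: "\<And>R. D * real ((2 * R + 1) ^ d) \<le> C * (real ((2 * (R + V) + 1) ^ d) - real ((2 * R + 1) ^ d))"
  shows "D \<le> 0"
proof -
  have "(\<lambda>R. inverse (real (Suc (2 * R)))) \<longlonglongrightarrow> 0"
    using LIMSEQ_subseq_LIMSEQ[OF LIMSEQ_inverse_real_of_nat, of "\<lambda>R. 2 * R"]
    by (auto simp: strict_mono_def comp_def)
  then have "(\<lambda>R. C * ((1 + 2 * real V * inverse (real (Suc (2 * R)))) ^ d - 1)) \<longlonglongrightarrow> C * ((1 + 2 * real V * 0) ^ d - 1)"
    by (intro tendsto_intros)
  moreover have "D \<le> C * ((1 + 2 * real V * inverse (real (Suc (2 * R)))) ^ d - 1)" for R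
  proof -
    let ?n = "real (2 * R + 1)"
    have n: "?n > 0" by simp
    have "(1 + 2 * real V * inverse (real (Suc (2 * R)))) = real (2 * (R + V) + 1) / ?n"
      using n by (simp add: field_simps)
    then have "C * ((1 + 2 * real V * inverse (real (Suc (2 * R)))) ^ d - 1) =
        C * (real ((2 * (R + V) + 1) ^ d) - real ((2 * R + 1) ^ d)) / ?n ^ d"
      using n by (simp add: power_divide diff_divide_distrib right_diff_distrib)
    moreover have "D \<le> C * (real ((2 * (R + V) + 1) ^ d) - real ((2 * R + 1) ^ d)) / ?n ^ d"
      using le[of R] by (simp only: pos_le_divide_eq[OF zero_less_power[OF n]] of_nat_power)
    ultimately show ?thesis by simp
  qed
  ultimately have "D \<le> C * ((1 + 2 * real V * 0) ^ d - 1)" by (intro LIMSEQ_le_const) auto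
  then show ?thesis by simp
qed

text \<open>The supporting affine function dominates \<open>g\<close>, hence is nonnegative on the
  quadrant. Moving one coordinate of \<open>(\<rho>, \<rho>)\<close> to 0 and to
  \<open>2 * \<rho>\<close> bounds its slope from above and from below.\<close>

lemma superdiff_bound:
  assumes q: "q \<in> superdiff g (\<rho>, \<rho>)" and g: "\<And>b. b \<in> quadrant \<Longrightarrow> g b \<ge> 0" and \<rho>: "\<rho> > 0"
  shows "\<bar>fst q\<bar> \<le> g (\<rho>, \<rho>) / \<rho>" "\<bar>snd q\<bar> \<le> g (\<rho>, \<rho>) / \<rho>"
proof -
  have *: "0 \<le> g (\<rho>, \<rho>) + (fst q * (s - \<rho>) + snd q * (t - \<rho>))" if "s \<ge> 0" "t \<ge> 0" for s t
  proof -
    have "(s, t) \<in> quadrant" using that by (simp add: quadrant_def)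
    then have "0 \<le> g (s, t)" "g (s, t) \<le> g (\<rho>, \<rho>) + q \<bullet> ((s, t) - (\<rho>, \<rho>))"
      using q g unfolding superdiff_def by blast+
    then show ?thesis by (cases q) simp
  qed
  show "\<bar>fst q\<bar> \<le> g (\<rho>, \<rho>) / \<rho>"
    using *[of 0 \<rho>] *[of "2 * \<rho>" \<rho>] \<rho> by (simp add: pos_le_divide_eq abs_le_iff algebra_simps abs_if split: if_splits)
  show "\<bar>snd q\<bar> \<le> g (\<rho>, \<rho>) / \<rho>"
    using *[of \<rho> 0] *[of \<rho> "2 * \<rho>"] \<rho> by (simp add: pos_le_divide_eq abs_le_iff algebra_simps abs_if split: if_splits)
qed

section \<open>The weighted mean of the mobilities under balanced supergradients\<close>

context fv_energy
begin

lemma nbrs_shift: "z \<in> int_lattice \<Longrightarrow> nbrs X K (x + z) = (\<lambda>y. y + z) ` nbrs X K x"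
proof (intro set_eqI iffI)
  fix y assume z: "z \<in> int_lattice" and "y \<in> nbrs X K (x + z)"
  then have "(x + z, y) \<in> edges X K" by (simp add: nbrs_def)
  from edges_shift[OF this int_lattice_minus[OF z]] have "y - z \<in> nbrs X K x" by (simp add: nbrs_def)
  then show "y \<in> (\<lambda>y. y + z) ` nbrs X K x" by (rule rev_image_eqI) simp
next
  fix y assume z: "z \<in> int_lattice" and "y \<in> (\<lambda>y. y + z) ` nbrs X K x"
  then show "y \<in> nbrs X K (x + z)" using edges_shift by (auto simp: nbrs_def)
qed

text \<open>The supergradient inequality may be used at any lattice translate of an edge, because
  \<open>r\<close> and the mobilities are periodic. Averaged with its reversed edge it has a term in
  \<open>u x\<close> and one in \<open>u y\<close>. The first sums to 0 by the balance at
  \<open>x\<close> and the zero mean of \<open>u\<close>. The second would follow by transport if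
  the supergradients were periodic; otherwise transport displaces the box of translates, at the cost
  of a boundary term.\<close>

lemma superdiff_mean_nonpos:
  assumes \<rho>: "\<rho> > 0"
    and p: "\<And>x y. (x, y) \<in> edges X K \<Longrightarrow> p x y \<in> superdiff (mobE x y) (\<rho>, \<rho>)"
    and c: "\<And>x. x \<in> X \<Longrightarrow> (\<Sum>y\<in>nbrs X K x. (fst (p x y) + snd (p y x)) * weight j x y) = c * vol K x"
    and r: "\<And>x. x \<in> X \<Longrightarrow> r x \<ge> 0" "\<And>x z. x \<in> X \<Longrightarrow> z \<in> int_lattice \<Longrightarrow> r (x + z) = r x"
    and rs: "(\<Sum>x\<in>cellsQ X. vol K x * r x) = \<rho>"
  shows "(\<Sum>(x, y)\<in>edgesQ X K. weight j x y * (mobE x y (r x, r y) - mob \<rho>)) \<le> 0" (is "?D \<le> 0")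
proof -
  define a where "a x y = (fst (p x y) + snd (p y x)) / 2" for x y
  define u where "u x = r x - \<rho>" for x
  define M where "M = mob \<rho> / \<rho>"
  have us: "(\<Sum>x\<in>cellsQ X. u x * vol K x) = 0"
  proof -
    have "(\<Sum>x\<in>cellsQ X. u x * vol K x) = (\<Sum>x\<in>cellsQ X. vol K x * r x) - \<rho> * (\<Sum>x\<in>cellsQ X. vol K x)"
      unfolding sum_distrib_left sum_subtractf[symmetric] by (intro sum.cong) (auto simp: u_def algebra_simps)
    then show ?thesis by (simp add: rs sum_vol)
  qed
  have bound: "\<bar>a x y\<bar> \<le> M" if e: "(x, y) \<in> edges X K" for x y
  proof -
    note e' = edges_sym[OF e]
    have "\<bar>fst (p x y)\<bar> \<le> M" "\<bar>snd (p y x)\<bar> \<le> M"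
      using superdiff_bound(1)[OF p[OF e] mobE_props(1)[OF e] \<rho>] superdiff_bound(2)[OF p[OF e'] mobE_props(1)[OF e'] \<rho>]
        mobE_props(3)[OF e, of \<rho>] mobE_props(3)[OF e', of \<rho>] \<rho> by (simp_all add: M_def)
    then show ?thesis unfolding a_def abs_le_iff by (simp add: field_simps)
  qed
  have key: "mobE x y (r x, r y) - mob \<rho> \<le> a (x + z) (y + z) * u x + a (y + z) (x + z) * u y"
    if e: "(x, y) \<in> edges X K" and z: "z \<in> int_lattice" for x y z
  proof -
    have one: "mobE x y (r x, r y) - mob \<rho> \<le> fst (p (x + z) (y + z)) * u x + snd (p (x + z) (y + z)) * u y"
      if e: "(x, y) \<in> edges X K" for x y
    proof -
      have q: "(r x, r y) \<in> quadrant" using r(1) edge_points[OF e] by (simp add: quadrant_def)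
      have "mobE (x + z) (y + z) (r x, r y) \<le> mobE (x + z) (y + z) (\<rho>, \<rho>) + p (x + z) (y + z) \<bullet> ((r x, r y) - (\<rho>, \<rho>))"
        using p[OF edges_shift[OF e z]] q unfolding superdiff_def by blast
      then show ?thesis
        using mobE_props(5)[OF e z q] mobE_props(3)[OF edges_shift[OF e z], of \<rho>] \<rho>
        by (cases "p (x + z) (y + z)") (simp add: u_def)
    qed
    have "mobE x y (r x, r y) = mobE y x (r y, r x)"
      using mobE_props(4)[OF e] r(1) edge_points[OF e] by simp
    then show ?thesis using one[OF e] one[OF edges_sym[OF e]] by (simp add: a_def field_simps)
  qed
  have balance: "(\<Sum>y\<in>nbrs X K x. weight j x y * a (x + z) (y + z)) = c / 2 * vol K x"
    if x: "x \<in> X" and z: "z \<in> int_lattice" for x z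
  proof -
    have "c * vol K x = (\<Sum>y\<in>nbrs X K (x + z). (fst (p (x + z) y) + snd (p y (x + z))) * weight j (x + z) y)"
      using c[OF point_shift[OF x z]] vol_shift[OF x z] by simp
    also have "\<dots> = (\<Sum>y\<in>nbrs X K x. (fst (p (x + z) (y + z)) + snd (p (y + z) (x + z))) * weight j (x + z) (y + z))"
      unfolding nbrs_shift[OF z] by (subst sum.reindex) (auto simp: inj_on_def)
    also have "\<dots> = (\<Sum>y\<in>nbrs X K x. 2 * (weight j x y * a (x + z) (y + z)))"
      using weight_shift[OF x _ z] edge_points(2) by (intro sum.cong) (auto simp: a_def nbrs_def)
    finally show ?thesis by (simp add: sum_distrib_left[symmetric])
  qed
  have S1: "(\<Sum>(x, y)\<in>edgesQ X K. weight j x y * u x * a (x + z) (y + z)) = 0" if z: "z \<in> int_lattice" for z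
  proof -
    have "(\<Sum>(x, y)\<in>edgesQ X K. weight j x y * u x * a (x + z) (y + z)) =
        (\<Sum>x\<in>cellsQ X. u x * (\<Sum>y\<in>nbrs X K x. weight j x y * a (x + z) (y + z)))"
      unfolding edgesQ_sum sum_distrib_left by (intro sum.cong refl) simp
    also have "\<dots> = (\<Sum>x\<in>cellsQ X. c / 2 * (u x * vol K x))"
      using balance[OF _ z] by (intro sum.cong) (auto simp: cellsQ_def)
    also have "\<dots> = 0" unfolding sum_distrib_left[symmetric] us by simp
    finally show ?thesis .
  qed
  have "bounded ((\<lambda>p. lattice_part (snd p)) ` edgesQ X K)"
    using finite_edgesQ by (intro finite_imp_bounded finite_imageI)
  then obtain B where B: "\<forall>v\<in>(\<lambda>p. lattice_part (snd p)) ` edgesQ X K. norm v \<le> B" unfolding bounded_iff by blast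
  define V where "V = nat \<lceil>B\<rceil>"
  have V: "- lattice_part y \<in> lattice_box V" if "(x, y) \<in> edgesQ X K" for x y
  proof -
    have "norm (lattice_part y) \<le> B" using B that by force
    then have "\<bar>lattice_part y $ i\<bar> \<le> real V" for i
      using component_le_norm_cart[of "lattice_part y" i] unfolding V_def by linarith
    then show ?thesis by (simp add: lattice_box_def int_lattice_minus)
  qed
  define C where "C = (\<Sum>(x, y)\<in>edgesQ X K. weight j x y * \<bar>u x\<bar>) * (2 * M)"
  have "?D * real ((2 * R + 1) ^ CARD('d)) \<le> C * (real ((2 * (R + V) + 1) ^ CARD('d)) - real ((2 * R + 1) ^ CARD('d)))" for R
  proof -
    let ?B = "lattice_box R :: (real ^ 'd) set"
    let ?G = "real (card (lattice_box (R + V) :: (real ^ 'd) set)) - real (card ?B)"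
    have BL: "z \<in> int_lattice" if "z \<in> ?B" for z using that by (simp add: lattice_box_def)
    \<comment> \<open>\<open>S1\<close> removes the terms with \<open>u x\<close> for each translate
      separately. For those with \<open>u y\<close> cancellation can be expected only on average,
      since \<open>a\<close> need not be periodic.\<close>
    have "?D \<le> (\<Sum>(x, y)\<in>edgesQ X K. weight j x y * u y * a (y + z) (x + z))" if z: "z \<in> ?B" for z
    proof -
      have "?D \<le> (\<Sum>(x, y)\<in>edgesQ X K. weight j x y * (a (x + z) (y + z) * u x + a (y + z) (x + z) * u y))"
        using key[OF edgesQ_edges BL[OF z]] weight_nonneg
        by (intro sum_mono) (auto intro!: mult_left_mono)
      also have "\<dots> = (\<Sum>(x, y)\<in>edgesQ X K. weight j x y * u x * a (x + z) (y + z))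
          + (\<Sum>(x, y)\<in>edgesQ X K. weight j x y * u y * a (y + z) (x + z))"
        unfolding sum.distrib[symmetric] by (intro sum.cong) (auto simp: algebra_simps)
      finally show ?thesis using S1[OF BL[OF z]] by simp
    qed
    then have "(\<Sum>z\<in>?B. ?D) \<le> (\<Sum>z\<in>?B. \<Sum>(x, y)\<in>edgesQ X K. weight j x y * u y * a (y + z) (x + z))"
      by (rule sum_mono)
    also have "\<dots> = (\<Sum>(x, y)\<in>edgesQ X K. weight j x y * u y * (\<Sum>z\<in>?B. a (y + z) (x + z)))"
      by (subst sum.swap) (simp add: sum_distrib_left case_prod_unfold)
    \<comment> \<open>\<open>lattice_part x\<close> is 0 on these edges; inserting it makes the
      summand lattice invariant, as \<open>edge_transport\<close> requires. After the exchange the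
      box appears shifted by \<open>- lattice_part y\<close>, which lies in
      \<open>lattice_box V\<close>.\<close>
    also have "\<dots> = (\<Sum>(x, y)\<in>edgesQ X K. weight j x y * u y * (\<Sum>z\<in>?B. a (y + (z - lattice_part x)) (x + (z - lattice_part x))))"
      by (intro sum.cong) (auto simp: edgesQ_def)
    also have "\<dots> = (\<Sum>(x, y)\<in>edgesQ X K. weight j y x * u x * (\<Sum>z\<in>?B. a (x + (z - lattice_part y)) (y + (z - lattice_part y))))"
    proof (rule edge_transport)
      fix x y z :: "real ^ 'd" assume e: "(x, y) \<in> edges X K" and z: "z \<in> int_lattice"
      note q = edge_points[OF e]
      show "weight j (x + z) (y + z) * u (y + z) *
          (\<Sum>z'\<in>?B. a (y + z + (z' - lattice_part (x + z))) (x + z + (z' - lattice_part (x + z)))) =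
        weight j x y * u y * (\<Sum>z\<in>?B. a (y + (z - lattice_part x)) (x + (z - lattice_part x)))"
        using weight_shift[OF q(1,2) z] r(2)[OF q(2) z] by (simp add: u_def lattice_part_add[OF z] algebra_simps)
    qed
    also have "\<dots> \<le> (\<Sum>(x, y)\<in>edgesQ X K. weight j x y * u x * (\<Sum>z\<in>?B. a (x + z) (y + z)) + weight j x y * \<bar>u x\<bar> * (2 * M * ?G))"
    proof (intro sum_mono, clarify)
      fix x y assume e: "(x, y) \<in> edgesQ X K"
      let ?s = "\<Sum>z\<in>?B. a (x + (z - lattice_part y)) (y + (z - lattice_part y))" and ?t = "\<Sum>z\<in>?B. a (x + z) (y + z)"
      have "\<bar>?s - ?t\<bar> \<le> 2 * M * ?G"
        using lattice_box_translate_sum[of "\<lambda>z. a (x + z) (y + z)" M "- lattice_part y" V R] V[OF e]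
          bound[OF edges_shift[OF edgesQ_edges[OF e]]] by simp
      then have "\<bar>u x\<bar> * \<bar>?s - ?t\<bar> \<le> \<bar>u x\<bar> * (2 * M * ?G)" by (rule mult_left_mono) simp
      then have "u x * (?s - ?t) \<le> \<bar>u x\<bar> * (2 * M * ?G)"
        using abs_ge_self[of "u x * (?s - ?t)"] by (simp only: abs_mult)
      then have "weight j x y * (u x * (?s - ?t)) \<le> weight j x y * (\<bar>u x\<bar> * (2 * M * ?G))"
        by (rule mult_left_mono) (rule weight_nonneg)
      then show "weight j y x * u x * ?s \<le> weight j x y * u x * ?t + weight j x y * \<bar>u x\<bar> * (2 * M * ?G)"
        unfolding weight_sym[of j y x] by (simp add: algebra_simps)
    qed
    also have "\<dots> = (\<Sum>z\<in>?B. \<Sum>(x, y)\<in>edgesQ X K. weight j x y * u x * a (x + z) (y + z)) + C * ?G"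
    proof -
      have "(\<Sum>z\<in>?B. \<Sum>(x, y)\<in>edgesQ X K. weight j x y * u x * a (x + z) (y + z)) =
          (\<Sum>(x, y)\<in>edgesQ X K. weight j x y * u x * (\<Sum>z\<in>?B. a (x + z) (y + z)))"
        by (subst sum.swap) (simp add: sum_distrib_left case_prod_unfold)
      moreover have "(\<Sum>(x, y)\<in>edgesQ X K. weight j x y * \<bar>u x\<bar> * (2 * M * ?G)) = C * ?G"
        unfolding C_def case_prod_unfold by (simp only: sum_distrib_right mult.assoc)
      ultimately show ?thesis by (simp add: sum.distrib case_prod_unfold)
    qed
    also have "(\<Sum>z\<in>?B. \<Sum>(x, y)\<in>edgesQ X K. weight j x y * u x * a (x + z) (y + z)) = 0"
      using S1 BL by (intro sum.neutral) blast
    finally show ?thesis by (simp add: card_lattice_box mult.commute)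
  qed
  then show ?thesis by (rule nonpos_of_boundary_growth)
qed

theorem f_hom_eq_of_superdiff:
  assumes \<rho>: "\<rho> \<ge> 0"
    and p: "\<rho> > 0 \<Longrightarrow> (\<And>x y. (x, y) \<in> edges X K \<Longrightarrow> p x y \<in> superdiff (mobE x y) (\<rho>, \<rho>))"
    and c: "\<And>x. \<rho> > 0 \<Longrightarrow> x \<in> X \<Longrightarrow> (\<Sum>y\<in>nbrs X K x. (fst (p x y) + snd (p y x)) * weight j x y) = c * vol K x"
  shows "f_hom X K mobE \<rho> j = action_density mob \<rho> j"
  using \<rho>
proof (rule f_hom_eqI)
  fix r assume "\<rho> > 0" "\<And>x. x \<in> X \<Longrightarrow> r x \<ge> 0" "\<And>x z. x \<in> X \<Longrightarrow> z \<in> int_lattice \<Longrightarrow> r (x + z) = r x"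
    "(\<Sum>x\<in>cellsQ X. vol K x * r x) = \<rho>"
  then show "(\<Sum>(x, y)\<in>edgesQ X K. weight j x y * (mobE x y (r x, r y) - mob \<rho>)) \<le> 0"
    using p c by (intro superdiff_mean_nonpos[of \<rho> p j c r]) blast+
qed

end

section \<open>Differentiable mobilities\<close>

text \<open>Polarisation: a symmetric matrix is determined by its quadratic form, so the matrix
  condition amounts to the scalar balance for every \<open>j\<close>.\<close>

lemma outer_prod_sum_eq_iff:
  fixes n :: "'b \<Rightarrow> real ^ 'd"
  shows "(\<Sum>y\<in>N. c y *\<^sub>R outer_prod (n y) (n y)) = v *\<^sub>R mat 1 \<longleftrightarrow>
    (\<forall>j. (\<Sum>y\<in>N. c y * (n y \<bullet> j)\<^sup>2) = v * (norm j)\<^sup>2)" (is "?M \<longleftrightarrow> ?Q")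
proof -
  have entry: "?M \<longleftrightarrow> (\<forall>i k. (\<Sum>y\<in>N. c y * (n y $ i * n y $ k)) = (if i = k then v else 0))"
    by (simp add: vec_eq_iff outer_prod_def mat_def if_distrib cong: if_cong)
  show ?thesis
  proof
    assume ?M
    then have ik: "(\<Sum>y\<in>N. c y * (n y $ i * n y $ k)) = (if i = k then v else 0)" for i k
      using entry by blast
    show ?Q
    proof
      fix j :: "real ^ 'd"
      have "(\<Sum>y\<in>N. c y * (n y \<bullet> j)\<^sup>2) = (\<Sum>y\<in>N. \<Sum>i\<in>UNIV. \<Sum>k\<in>UNIV. (j $ i * j $ k) * (c y * (n y $ i * n y $ k)))"
        by (simp add: inner_vec_def power2_eq_square sum_product sum_distrib_left mult_ac)
      also have "\<dots> = (\<Sum>i\<in>UNIV. \<Sum>y\<in>N. \<Sum>k\<in>UNIV. (j $ i * j $ k) * (c y * (n y $ i * n y $ k)))"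
        by (rule sum.swap)
      also have "\<dots> = (\<Sum>i\<in>UNIV. \<Sum>k\<in>UNIV. \<Sum>y\<in>N. (j $ i * j $ k) * (c y * (n y $ i * n y $ k)))"
        by (intro sum.cong refl sum.swap)
      also have "\<dots> = (\<Sum>i\<in>UNIV. \<Sum>k\<in>UNIV. (j $ i * j $ k) * (if i = k then v else 0))"
        by (simp only: sum_distrib_left[symmetric] ik)
      also have "\<dots> = (\<Sum>i\<in>UNIV. v * (j $ i * j $ i))"
        by (simp add: if_distrib mult_ac cong: if_cong)
      also have "\<dots> = v * (norm j)\<^sup>2"
        by (simp add: power2_norm_eq_inner inner_vec_def sum_distrib_left)
      finally show "(\<Sum>y\<in>N. c y * (n y \<bullet> j)\<^sup>2) = v * (norm j)\<^sup>2" .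
    qed
  next
    assume Q: ?Q
    have "(\<Sum>y\<in>N. c y * (n y $ i * n y $ k)) = (if i = k then v else 0)" for i k
    proof -
      let ?e = "\<lambda>i. axis i 1 :: real ^ 'd"
      \<comment> \<open>The entry at \<open>(i, k)\<close> is read off from the quadratic form at
        the two axis vectors and at their sum; the case \<open>i = k\<close> is included.\<close>
      have "2 * (\<Sum>y\<in>N. c y * (n y $ i * n y $ k)) = (\<Sum>y\<in>N. c y * (n y \<bullet> (?e i + ?e k))\<^sup>2)
          - (\<Sum>y\<in>N. c y * (n y \<bullet> ?e i)\<^sup>2) - (\<Sum>y\<in>N. c y * (n y \<bullet> ?e k)\<^sup>2)"
        unfolding sum_distrib_left sum_subtractf[symmetric]
        by (intro sum.cong refl) (simp add: inner_add_right inner_axis power2_eq_square algebra_simps)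
      also have "\<dots> = v * ((norm (?e i + ?e k))\<^sup>2 - (norm (?e i))\<^sup>2 - (norm (?e k))\<^sup>2)"
        using Q by (simp add: right_diff_distrib)
      also have "\<dots> = 2 * (v * (?e i \<bullet> ?e k))"
        by (simp add: power2_norm_eq_inner inner_add_left inner_add_right inner_commute algebra_simps)
      finally show ?thesis by (simp add: inner_axis_axis)
    qed
    then show ?M using entry by blast
  qed
qed

text \<open>Along the segment from \<open>a\<close> to \<open>b\<close> concavity bounds
  \<open>f b - f a\<close> by the difference quotients at \<open>a\<close>, and these tend to
  \<open>f' (b - a)\<close> from the right.\<close>

lemma concave_tangent:
  assumes f: "concave_on quadrant f" and D: "(f has_derivative f') (at a)"
    and a: "a \<in> quadrant" and b: "b \<in> quadrant"
  shows "f b \<le> f a + f' (b - a)"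
proof -
  define \<phi> where "\<phi> t = f (a + t *\<^sub>R (b - a))" for t
  interpret f': linear f' using D by (rule has_derivative_linear)
  have "((\<lambda>t. a + t *\<^sub>R (b - a)) has_derivative (\<lambda>t. t *\<^sub>R (b - a))) (at 0)"
    by (auto intro!: derivative_eq_intros)
  moreover have "(f has_derivative f') (at (a + 0 *\<^sub>R (b - a)))" using D by simp
  ultimately have "(\<phi> has_derivative (\<lambda>t. f' (t *\<^sub>R (b - a)))) (at 0)"
    unfolding \<phi>_def by (rule has_derivative_compose)
  then have "(\<phi> has_field_derivative f' (b - a)) (at 0)"
    by (simp add: has_field_derivative_def f'.scale mult.commute[of _ "f' (b - a)"])
  then have "((\<lambda>t. (\<phi> t - \<phi> 0) / (t - 0)) \<longlongrightarrow> f' (b - a)) (at 0)"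
    by (simp add: has_field_derivative_iff)
  then have lim: "((\<lambda>t. (\<phi> t - \<phi> 0) / (t - 0)) \<longlongrightarrow> f' (b - a)) (at_right 0)"
    by (rule tendsto_mono[rotated]) (simp add: at_le)
  have "\<forall>\<^sub>F t in at_right 0. t \<in> {0<..<1::real}"
    by (rule eventually_at_right_real) simp
  then have "\<forall>\<^sub>F t in at_right 0. f b - f a \<le> (\<phi> t - \<phi> 0) / (t - 0)"
  proof eventually_elim
    case (elim t)
    then have t: "0 < t" "t < 1" by auto
    have "(1 - t) * f a + t * f b \<le> f ((1 - t) *\<^sub>R a + t *\<^sub>R b)"
      using concave_onD[OF f, of t a b] t a b by simp
    also have "(1 - t) *\<^sub>R a + t *\<^sub>R b = a + t *\<^sub>R (b - a)" by (simp add: algebra_simps)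
    finally have "t * (f b - f a) \<le> \<phi> t - \<phi> 0" by (simp add: \<phi>_def algebra_simps)
    then show ?case using t by (simp add: pos_le_divide_eq mult.commute)
  qed
  then have "f b - f a \<le> f' (b - a)"
    using lim by (intro tendsto_lowerbound[of _ _ "at_right 0"]) auto
  then show ?thesis by simp
qed

lemma has_derivative_partials:
  fixes f :: "real \<times> real \<Rightarrow> real"
  assumes D: "(f has_derivative f') (at (a, b))"
  shows "((\<lambda>r. f (r, b)) has_field_derivative f' (1, 0)) (at a)"
    and "((\<lambda>r. f (a, r)) has_field_derivative f' (0, 1)) (at b)"
    and "f' h = f' (1, 0) * fst h + f' (0, 1) * snd h"
proof -
  interpret f': linear f' using D by (rule has_derivative_linear)
  have h: "f' (h, 0) = f' (1, 0) * h" "f' (0, h) = f' (0, 1) * h" for h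
    using f'.scale[of h "(1, 0)"] f'.scale[of h "(0, 1)"] by simp_all
  then have eq: "(\<lambda>h. f' (h, 0)) = (*) (f' (1, 0))" "(\<lambda>h. f' (0, h)) = (*) (f' (0, 1))" by blast+
  have "((\<lambda>r. (r, b)) has_derivative (\<lambda>h. (h, 0))) (at a)" by (auto intro!: derivative_eq_intros)
  from has_derivative_compose[OF this D] show "((\<lambda>r. f (r, b)) has_field_derivative f' (1, 0)) (at a)"
    by (simp only: has_field_derivative_def eq)
  have "((\<lambda>r. (a, r)) has_derivative (\<lambda>h. (0, h))) (at b)" by (auto intro!: derivative_eq_intros)
  from has_derivative_compose[OF this D] show "((\<lambda>r. f (a, r)) has_field_derivative f' (0, 1)) (at b)"
    by (simp only: has_field_derivative_def eq)
  show "f' h = f' (1, 0) * fst h + f' (0, 1) * snd h"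
    using f'.add[of "(fst h, 0)" "(0, snd h)"] h(1)[of "fst h"] h(2)[of "snd h"] by (simp only: add_Pair add_0 add_0_right prod.collapse)
qed

section \<open>Partial derivatives on the diagonal and the balance condition\<close>

context fv_energy
begin

definition partial1 :: "real \<Rightarrow> real ^ 'd \<Rightarrow> real ^ 'd \<Rightarrow> real" where
  "partial1 \<rho> x y = deriv (\<lambda>r. mobE x y (r, \<rho>)) \<rho>"

definition smooth_at :: "real \<Rightarrow> bool" where
  "smooth_at \<rho> \<longleftrightarrow> (\<forall>(x, y)\<in>edges X K. mobE x y differentiable (at (\<rho>, \<rho>)))"

lemma partial1_DERIV:
  assumes s: "smooth_at \<rho>" and e: "(x, y) \<in> edges X K"
  shows "((\<lambda>r. mobE x y (r, \<rho>)) has_field_derivative partial1 \<rho> x y) (at \<rho>)"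
proof -
  obtain f' where D: "(mobE x y has_derivative f') (at (\<rho>, \<rho>))"
    using s e unfolding smooth_at_def differentiable_def by blast
  from has_derivative_partials(1)[OF D]
  show ?thesis unfolding partial1_def by (simp add: DERIV_imp_deriv)
qed

text \<open>By the symmetry of the mobilities the second partial derivative for
  \<open>(x, y)\<close> is the first one for \<open>(y, x)\<close>. The symmetry is known for
  nonnegative arguments, which contain a neighbourhood of \<open>\<rho> > 0\<close>.\<close>

lemma gradient:
  assumes s: "smooth_at \<rho>" and \<rho>: "\<rho> > 0" and e: "(x, y) \<in> edges X K"
  shows "(mobE x y has_derivative (\<lambda>h. partial1 \<rho> x y * fst h + partial1 \<rho> y x * snd h)) (at (\<rho>, \<rho>))"
proof -
  obtain f' where D: "(mobE x y has_derivative f') (at (\<rho>, \<rho>))"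
    using s e unfolding smooth_at_def differentiable_def by blast
  have p1: "f' (1, 0) = partial1 \<rho> x y"
    using has_derivative_partials(1)[OF D] partial1_DERIV[OF s e] by (rule DERIV_unique)
  have "((\<lambda>r. mobE y x (r, \<rho>)) has_field_derivative f' (0, 1)) (at \<rho>)"
    using has_derivative_partials(2)[OF D]
    by (rule has_field_derivative_transform_within_open[of _ _ _ "{0<..}"])
      (use \<rho> mobE_props(4)[OF e] in auto)
  then have p2: "f' (0, 1) = partial1 \<rho> y x" using partial1_DERIV[OF s edges_sym[OF e]] by (rule DERIV_unique)
  have "f' h = partial1 \<rho> x y * fst h + partial1 \<rho> y x * snd h" for h
    using has_derivative_partials(3)[OF D, of h] by (simp only: p1 p2)
  then have "f' = (\<lambda>h. partial1 \<rho> x y * fst h + partial1 \<rho> y x * snd h)" by (rule ext)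
  then show ?thesis using D by simp
qed

lemma mob_deriv:
  assumes s: "smooth_at \<rho>" and \<rho>: "\<rho> > 0" and e: "(x, y) \<in> edges X K"
  shows "deriv mob \<rho> = partial1 \<rho> x y + partial1 \<rho> y x"
proof -
  have "((\<lambda>r. (r, r)) has_derivative (\<lambda>h. (h, h))) (at \<rho>)" by (auto intro!: derivative_eq_intros)
  from has_derivative_compose[OF this gradient[OF assms]]
  have "((\<lambda>r. mobE x y (r, r)) has_field_derivative (partial1 \<rho> x y + partial1 \<rho> y x)) (at \<rho>)"
    unfolding has_field_derivative_def by (rule has_derivative_eq_rhs) (simp add: fun_eq_iff algebra_simps)
  then have "(mob has_field_derivative (partial1 \<rho> x y + partial1 \<rho> y x)) (at \<rho>)"
    by (rule has_field_derivative_transform_within_open[of _ _ _ "{0<..}"])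
      (use \<rho> mobE_props(3)[OF e] in auto)
  then show ?thesis by (rule DERIV_imp_deriv)
qed

lemma gradient_superdiff:
  assumes s: "smooth_at \<rho>" and \<rho>: "\<rho> > 0" and e: "(x, y) \<in> edges X K"
  shows "(partial1 \<rho> x y, partial1 \<rho> y x) \<in> superdiff (mobE x y) (\<rho>, \<rho>)"
proof -
  have "(\<rho>, \<rho>) \<in> quadrant" using \<rho> by (simp add: quadrant_def)
  from concave_tangent[OF mobE_props(2)[OF e] gradient[OF assms] this]
  show ?thesis by (auto simp: superdiff_def)
qed

text \<open>A nonnegative concave function on a half-line cannot decrease: with a negative slope its
  tangent would become negative far out.\<close>

lemma partial1_nonneg:
  assumes s: "smooth_at \<rho>" and \<rho>: "\<rho> > 0" and e: "(x, y) \<in> edges X K"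
  shows "partial1 \<rho> x y \<ge> 0"
proof (rule ccontr)
  let ?g = "partial1 \<rho> x y"
  assume neg: "\<not> ?g \<ge> 0"
  \<comment> \<open>Chosen so that the tangent takes the value -1 at
    \<open>(\<rho> + t, \<rho>)\<close>.\<close>
  define t where "t = (mob \<rho> + 1) / (- ?g)"
  have t: "t \<ge> 0" unfolding t_def using neg mob_nonneg[of \<rho>] \<rho> by (intro divide_nonneg_pos) simp_all
  then have b: "(\<rho> + t, \<rho>) \<in> quadrant" using \<rho> by (simp add: quadrant_def)
  have "0 \<le> mobE x y (\<rho> + t, \<rho>)" by (rule mobE_props(1)[OF e b])
  also have "\<dots> \<le> mobE x y (\<rho>, \<rho>) + (partial1 \<rho> x y, partial1 \<rho> y x) \<bullet> ((\<rho> + t, \<rho>) - (\<rho>, \<rho>))"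
    using gradient_superdiff[OF assms] b unfolding superdiff_def by blast
  also have "\<dots> = mob \<rho> + ?g * t" using mobE_props(3)[OF e, of \<rho>] \<rho> by simp
  also have "\<dots> = - 1" using neg by (simp add: t_def)
  finally show False by simp
qed

lemma partial1_shift:
  assumes s: "smooth_at \<rho>" and \<rho>: "\<rho> > 0" and e: "(x, y) \<in> edges X K" and z: "z \<in> int_lattice"
  shows "partial1 \<rho> (x + z) (y + z) = partial1 \<rho> x y"
proof -
  have "((\<lambda>r. mobE (x + z) (y + z) (r, \<rho>)) has_field_derivative partial1 \<rho> x y) (at \<rho>)"
    using partial1_DERIV[OF s e]
    by (rule has_field_derivative_transform_within_open[of _ _ _ "{0<..}"])
      (use \<rho> mobE_props(5)[OF e z] in \<open>auto simp: quadrant_def\<close>)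
  then show ?thesis unfolding partial1_def by (rule DERIV_imp_deriv)
qed

text \<open>The gradient is a supergradient, and its first component on \<open>(x, y)\<close> equals
  the second on \<open>(y, x)\<close>, which doubles the sum. Where
  \<open>deriv mob \<rho> = 0\<close>, the two partial derivatives on an edge are nonnegative with
  sum 0, so the balance holds with both sides 0.\<close>

lemma f_hom_eq_of_balance:
  assumes s: "\<And>\<rho>. \<rho> > 0 \<Longrightarrow> smooth_at \<rho>"
    and bal: "\<And>x \<rho>. x \<in> X \<Longrightarrow> \<rho> > 0 \<Longrightarrow> deriv mob \<rho> \<noteq> 0 \<Longrightarrow>
      (\<Sum>y\<in>nbrs X K x. partial1 \<rho> x y * weight j x y) = deriv mob \<rho> * (norm j)\<^sup>2 * vol K x"
    and \<rho>: "\<rho> \<ge> 0"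
  shows "f_hom X K mobE \<rho> j = action_density mob \<rho> j"
proof (rule f_hom_eq_of_superdiff[OF \<rho>, where p = "\<lambda>x y. (partial1 \<rho> x y, partial1 \<rho> y x)" and c = "2 * (deriv mob \<rho> * (norm j)\<^sup>2)"])
  fix x assume pos: "\<rho> > 0" and x: "x \<in> X"
  have "(\<Sum>y\<in>nbrs X K x. partial1 \<rho> x y * weight j x y) = deriv mob \<rho> * (norm j)\<^sup>2 * vol K x"
  proof (cases "deriv mob \<rho> = 0")
    case True
    have "partial1 \<rho> x y = 0" if "y \<in> nbrs X K x" for y
    proof -
      have e: "(x, y) \<in> edges X K" using that by (simp add: nbrs_def)
      show ?thesis
        using mob_deriv[OF s[OF pos] pos e] True partial1_nonneg[OF s[OF pos] pos e]
          partial1_nonneg[OF s[OF pos] pos edges_sym[OF e]] by linarith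
    qed
    then show ?thesis using True by simp
  qed (rule bal[OF x pos])
  then have "(\<Sum>y\<in>nbrs X K x. 2 * (partial1 \<rho> x y * weight j x y)) = 2 * (deriv mob \<rho> * (norm j)\<^sup>2) * vol K x"
    unfolding sum_distrib_left[symmetric] by simp
  then show "(\<Sum>y\<in>nbrs X K x. (fst (partial1 \<rho> x y, partial1 \<rho> y x) + snd (partial1 \<rho> y x, partial1 \<rho> x y)) * weight j x y) =
      2 * (deriv mob \<rho> * (norm j)\<^sup>2) * vol K x"
    by (simp add: mult.assoc flip: mult_2)
qed (rule gradient_superdiff[OF s])

text \<open>Without edges \<open>flux_identity\<close> for a unit vector would read 0 = 2. An edge
  is wanted in order to transfer \<open>concave_zero_imp_zero\<close> to \<open>mob\<close> along
  the diagonal.\<close>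

lemma edgesQ_nonempty: "edgesQ X K \<noteq> {}"
proof
  assume "edgesQ X K = {}"
  then have "(axis undefined 1 :: real ^ 'd) \<bullet> axis undefined 1 = 0"
    using flux_identity[of "axis undefined 1" "axis undefined 1"] by simp
  then show False by (simp add: inner_axis_axis)
qed

lemma mob_zero_imp_deriv_zero:
  assumes \<rho>: "\<rho> > 0" and z: "mob \<rho> = 0"
  shows "deriv mob \<rho> = 0"
proof -
  obtain x y where "(x, y) \<in> edgesQ X K" using edgesQ_nonempty by auto
  then have e: "(x, y) \<in> edges X K" by (rule edgesQ_edges)
  have m0: "mobE x y (\<rho>, \<rho>) = 0" using mobE_props(3)[OF e, of \<rho>] \<rho> z by simp
  have "mob r = 0" if "r > 0" for r
  proof -
    have q: "(r, r) \<in> quadrant" using that by (simp add: quadrant_def)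
    have "mobE x y (r, r) = 0"
      by (rule concave_zero_imp_zero[OF mobE_props(2)[OF e] mobE_props(1)[OF e] m0 _ _ q]) (use \<rho> in simp_all)
    then show ?thesis using mobE_props(3)[OF e, of r] that by simp
  qed
  then have "(mob has_field_derivative 0) (at \<rho>)"
    using \<rho> by (intro has_field_derivative_transform_within_open[OF DERIV_const[of 0], of "{0<..}"]) auto
  then show ?thesis by (rule DERIV_imp_deriv)
qed

lemma mobE_pos:
  assumes e: "(x, y) \<in> edges X K" and \<rho>: "\<rho> \<ge> 0" "mob \<rho> > 0" and ab: "a > 0" "b > 0"
  shows "mobE x y (a, b) > 0"
proof -
  have q: "(\<rho>, \<rho>) \<in> quadrant" "(a, b) \<in> quadrant" using \<rho> ab by (simp_all add: quadrant_def)
  have "mobE x y (a, b) \<noteq> 0"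
  proof
    assume z: "mobE x y (a, b) = 0"
    have "mobE x y (\<rho>, \<rho>) = 0"
      by (rule concave_zero_imp_zero[OF mobE_props(2)[OF e] mobE_props(1)[OF e] z _ _ q(1)]) (use ab in simp_all)
    then show False using mobE_props(3)[OF e \<rho>(1)] \<rho>(2) by simp
  qed
  then show ?thesis using mobE_props(1)[OF e q(2)] by simp
qed

text \<open>Equality means that the uniform flux at constant density is optimal. The same flux is
  admissible for the densities \<open>\<rho> + t * u x\<close> when \<open>u\<close> has mean 0, so
  the energy along this family has a local minimum at \<open>t = 0\<close> and its derivative there
  vanishes.\<close>

lemma balance_of_f_hom_eq:
  assumes s: "smooth_at \<rho>" and \<rho>: "\<rho> > 0" "mob \<rho> > 0"
    and eq: "f_hom X K mobE \<rho> j = action_density mob \<rho> j" and x: "x \<in> X"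
  shows "(\<Sum>y\<in>nbrs X K x. partial1 \<rho> x y * weight j x y) = deriv mob \<rho> * (norm j)\<^sup>2 * vol K x"
proof -
  let ?g = "partial1 \<rho>"
  define G where "G x = (\<Sum>y\<in>nbrs X K x. ?g x y * weight j x y)" for x
  \<comment> \<open>The volumes of a period sum to 1, so \<open>l\<close> is the volume-weighted
    mean of \<open>G x / vol K x\<close>, and \<open>u\<close> below has mean 0.\<close>
  define l where "l = (\<Sum>x\<in>cellsQ X. G x)"
  define u where "u x = G x / vol K x - l" for x
  have Q: "x \<in> X" if "x \<in> cellsQ X" for x using that by (simp add: cellsQ_def)
  have Gp: "G (x + z) = G x" if x: "x \<in> X" and z: "z \<in> int_lattice" for x z
  proof -
    have "G (x + z) = (\<Sum>y\<in>nbrs X K x. ?g (x + z) (y + z) * weight j (x + z) (y + z))"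
      unfolding G_def nbrs_shift[OF z] by (subst sum.reindex) (auto simp: inj_on_def)
    also have "\<dots> = G x"
      unfolding G_def
    proof (rule sum.cong)
      fix y assume "y \<in> nbrs X K x"
      then have e: "(x, y) \<in> edges X K" by (simp add: nbrs_def)
      show "?g (x + z) (y + z) * weight j (x + z) (y + z) = ?g x y * weight j x y"
        by (simp add: partial1_shift[OF s \<rho>(1) e z] weight_shift[OF x edge_points(2)[OF e] z])
    qed simp
    finally show ?thesis .
  qed
  have up: "u (x + z) = u x" if "x \<in> X" "z \<in> int_lattice" for x z
    using Gp[OF that] vol_shift[OF that] by (simp add: u_def)
  have vu: "vol K x * u x = G x - l * vol K x" if "x \<in> X" for x
    using vol_pos[OF that] by (simp add: u_def field_simps)
  have us: "(\<Sum>x\<in>cellsQ X. vol K x * u x) = 0"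
  proof -
    have "(\<Sum>x\<in>cellsQ X. vol K x * u x) = (\<Sum>x\<in>cellsQ X. G x) - l * (\<Sum>x\<in>cellsQ X. vol K x)"
      unfolding sum_distrib_left sum_subtractf[symmetric] using vu Q by (intro sum.cong) auto
    then show ?thesis by (simp add: sum_vol l_def)
  qed
  \<comment> \<open>A bound for all values of \<open>u\<close>, positive even if \<open>u\<close>
    vanishes; for times below \<open>\<rho> / B\<close> the perturbed densities remain
    positive.\<close>
  define B where "B = 1 + (\<Sum>x\<in>cellsQ X. \<bar>u x\<bar>)"
  have B: "B > 0" by (simp add: B_def add_pos_nonneg sum_nonneg)
  have uB: "\<bar>u x\<bar> \<le> B" if x: "x \<in> X" for x
  proof -
    have "u x = u (x - lattice_part x)"
      using up[OF point_shift_diff[OF x lattice_part_in] lattice_part_in, of x x] by simp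
    moreover have "\<bar>u (x - lattice_part x)\<bar> \<le> (\<Sum>x\<in>cellsQ X. \<bar>u x\<bar>)"
      using representative[OF x] finite_cellsQ by (intro member_le_sum) auto
    ultimately show ?thesis by (simp add: B_def)
  qed
  define F where "F t = (\<Sum>(x, y)\<in>edgesQ X K. weight j x y / mobE x y (\<rho> + t * u x, \<rho> + t * u y)) / 2" for t
  have pos: "\<rho> + t * u x > 0" if "\<bar>t\<bar> < \<rho> / B" "x \<in> X" for t x
  proof -
    have "\<bar>t * u x\<bar> \<le> \<bar>t\<bar> * B" unfolding abs_mult using uB[OF that(2)] by (intro mult_left_mono) auto
    also have "\<dots> < \<rho>" using that(1) B by (simp add: pos_less_divide_eq)
    finally show ?thesis by linarith
  qed
  have mp: "mobE x y (\<rho> + t * u x, \<rho> + t * u y) > 0" if "\<bar>t\<bar> < \<rho> / B" "(x, y) \<in> edgesQ X K" for t x y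
  proof -
    note e = edgesQ_edges[OF that(2)]
    show ?thesis using pos[OF that(1)] edge_points[OF e] \<rho> by (intro mobE_pos[OF e, of \<rho>]) auto
  qed
  have F0: "F 0 = (norm j)\<^sup>2 / mob \<rho>"
  proof -
    have "(\<Sum>(x, y)\<in>edgesQ X K. weight j x y / mobE x y (\<rho> + 0 * u x, \<rho> + 0 * u y)) =
        (\<Sum>(x, y)\<in>edgesQ X K. weight j x y) / mob \<rho>"
      unfolding sum_divide_distrib using mobE_props(3)[OF edgesQ_edges, of _ _ \<rho>] \<rho>(1)
      by (intro sum.cong) auto
    then show ?thesis by (simp add: F_def sum_weight)
  qed
  have min: "F 0 \<le> F t" if t: "\<bar>0 - t\<bar> < \<rho> / B" for t
  proof -
    have t': "\<bar>t\<bar> < \<rho> / B" using t by simp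
    have "(\<Sum>x\<in>cellsQ X. vol K x * (\<rho> + t * u x)) = \<rho> * (\<Sum>x\<in>cellsQ X. vol K x) + t * (\<Sum>x\<in>cellsQ X. vol K x * u x)"
      unfolding sum_distrib_left sum.distrib[symmetric] by (intro sum.cong) (auto simp: algebra_simps)
    then have sum: "(\<Sum>x\<in>cellsQ X. vol K x * (\<rho> + t * u x)) = \<rho>" by (simp add: us sum_vol)
    have "f_hom X K mobE \<rho> j \<le> ennreal (F t)"
      unfolding F_def
    proof (rule f_hom_uniform_le)
      show "0 \<le> \<rho> + t * u x" if "x \<in> X" for x using pos[OF t' that] by simp
      show "\<rho> + t * u (x + z) = \<rho> + t * u x" if "x \<in> X" "z \<in> int_lattice" for x z
        by (simp add: up[OF that])
    qed (fact sum, fact mp[OF t'])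
    then have "ennreal (F 0) \<le> ennreal (F t)"
      using \<rho>(2) by (simp add: eq F0 action_density_def action_quot_def)
    moreover have "F t \<ge> 0"
      unfolding F_def using mp[OF t'] weight_nonneg
      by (intro divide_nonneg_pos sum_nonneg) (auto intro!: divide_nonneg_pos)
    ultimately show ?thesis by simp
  qed
  have "(F has_field_derivative
      (\<Sum>(x, y)\<in>edgesQ X K. - (weight j x y * (?g x y * u x + ?g y x * u y)) / (mob \<rho> * mob \<rho>)) / 2) (at 0)"
  proof -
    have "((\<lambda>t. \<Sum>p\<in>edgesQ X K. weight j (fst p) (snd p) / mobE (fst p) (snd p) (\<rho> + t * u (fst p), \<rho> + t * u (snd p)))
      has_field_derivative (\<Sum>p\<in>edgesQ X K. - (weight j (fst p) (snd p) *
        (?g (fst p) (snd p) * u (fst p) + ?g (snd p) (fst p) * u (snd p))) / (mob \<rho> * mob \<rho>))) (at 0)"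
    proof (rule DERIV_sum)
      fix p assume "p \<in> edgesQ X K"
      then obtain x y where p: "p = (x, y)" and eQ: "(x, y) \<in> edgesQ X K" by (cases p) auto
      note e = edgesQ_edges[OF eQ]
      have "((\<lambda>t. (\<rho> + t * u x, \<rho> + t * u y)) has_derivative (\<lambda>h. (h * u x, h * u y))) (at 0)"
        by (auto intro!: derivative_eq_intros)
      moreover have "(mobE x y has_derivative (\<lambda>h. ?g x y * fst h + ?g y x * snd h)) (at (\<rho> + 0 * u x, \<rho> + 0 * u y))"
        using gradient[OF s \<rho>(1) e] by simp
      ultimately have "((\<lambda>t. mobE x y (\<rho> + t * u x, \<rho> + t * u y)) has_derivative
          (\<lambda>h. ?g x y * fst (h * u x, h * u y) + ?g y x * snd (h * u x, h * u y))) (at 0)"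
        by (rule has_derivative_compose)
      then have D: "((\<lambda>t. mobE x y (\<rho> + t * u x, \<rho> + t * u y)) has_field_derivative (?g x y * u x + ?g y x * u y)) (at 0)"
        unfolding has_field_derivative_def by (rule has_derivative_eq_rhs) (simp add: fun_eq_iff algebra_simps)
      have m: "mobE x y (\<rho> + 0 * u x, \<rho> + 0 * u y) = mob \<rho>" using mobE_props(3)[OF e, of \<rho>] \<rho>(1) by simp
      have "((\<lambda>t. weight j x y / mobE x y (\<rho> + t * u x, \<rho> + t * u y)) has_field_derivative
          (0 * mobE x y (\<rho> + 0 * u x, \<rho> + 0 * u y) - weight j x y * (?g x y * u x + ?g y x * u y)) /
          (mobE x y (\<rho> + 0 * u x, \<rho> + 0 * u y) * mobE x y (\<rho> + 0 * u x, \<rho> + 0 * u y))) (at 0)"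
        using \<rho>(2) m by (intro DERIV_divide DERIV_const D) simp
      then show "((\<lambda>t. weight j (fst p) (snd p) / mobE (fst p) (snd p) (\<rho> + t * u (fst p), \<rho> + t * u (snd p)))
        has_field_derivative - (weight j (fst p) (snd p) *
        (?g (fst p) (snd p) * u (fst p) + ?g (snd p) (fst p) * u (snd p))) / (mob \<rho> * mob \<rho>)) (at 0)"
        unfolding p m by simp
    qed
    then show ?thesis unfolding F_def[abs_def] case_prod_unfold by (rule DERIV_cdivide)
  qed
  then have "(\<Sum>(x, y)\<in>edgesQ X K. - (weight j x y * (?g x y * u x + ?g y x * u y)) / (mob \<rho> * mob \<rho>)) / 2 = 0"
    using min B \<rho>(1) by (intro DERIV_local_min[of F _ 0 "\<rho> / B"]) auto
  moreover have "(\<Sum>(x, y)\<in>edgesQ X K. - (weight j x y * (?g x y * u x + ?g y x * u y)) / (mob \<rho> * mob \<rho>)) =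
      - (\<Sum>(x, y)\<in>edgesQ X K. weight j x y * (?g x y * u x + ?g y x * u y)) / (mob \<rho> * mob \<rho>)"
    unfolding sum_negf[symmetric] sum_divide_distrib by (intro sum.cong) auto
  ultimately have crit: "(\<Sum>(x, y)\<in>edgesQ X K. weight j x y * (?g x y * u x + ?g y x * u y)) = 0"
    using \<rho>(2) by simp
  \<comment> \<open>The terms of the first variation at the two ends of an edge have equal sums over
    a period, so the criticality condition becomes a statement about the sum of
    \<open>u x * G x\<close> over cells.\<close>
  have swap: "(\<Sum>(x, y)\<in>edgesQ X K. weight j x y * (?g y x * v y)) = (\<Sum>(x, y)\<in>edgesQ X K. weight j x y * (?g x y * v x))"
    if v: "\<And>x z. x \<in> X \<Longrightarrow> z \<in> int_lattice \<Longrightarrow> v (x + z) = v x" for v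
  proof -
    have "(\<Sum>(x, y)\<in>edgesQ X K. weight j x y * (?g y x * v y)) = (\<Sum>(x, y)\<in>edgesQ X K. weight j y x * (?g x y * v x))"
    proof (rule edge_transport)
      fix x y z :: "real ^ 'd" assume e: "(x, y) \<in> edges X K" and z: "z \<in> int_lattice"
      note q = edge_points[OF e]
      show "weight j (x + z) (y + z) * (?g (y + z) (x + z) * v (y + z)) = weight j x y * (?g y x * v y)"
        by (simp add: weight_shift[OF q(1,2) z] partial1_shift[OF s \<rho>(1) edges_sym[OF e] z] v[OF q(2) z])
    qed
    then show ?thesis by (simp add: weight_sym)
  qed
  have cells: "(\<Sum>(x, y)\<in>edgesQ X K. weight j x y * (?g x y * v x)) = (\<Sum>x\<in>cellsQ X. v x * G x)" for v
    unfolding edgesQ_sum G_def sum_distrib_left by (intro sum.cong refl) (simp add: mult_ac)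
  have "(\<Sum>(x, y)\<in>edgesQ X K. weight j x y * (?g x y * u x + ?g y x * u y)) =
      (\<Sum>(x, y)\<in>edgesQ X K. weight j x y * (?g x y * u x)) + (\<Sum>(x, y)\<in>edgesQ X K. weight j x y * (?g y x * u y))"
    unfolding sum.distrib[symmetric] by (intro sum.cong) (auto simp: distrib_left)
  then have uG: "(\<Sum>x\<in>cellsQ X. u x * G x) = 0"
    using crit swap[of u, OF up] cells[of u] by simp
  \<comment> \<open>Since \<open>vol K x * u x\<close> is \<open>G x - l * vol K x\<close>, testing
    the variation with \<open>u\<close> itself leaves a sum of nonnegative squares.\<close>
  have "(\<Sum>x\<in>cellsQ X. vol K x * (u x)\<^sup>2) = (\<Sum>x\<in>cellsQ X. u x * G x) - l * (\<Sum>x\<in>cellsQ X. vol K x * u x)"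
    unfolding sum_distrib_left sum_subtractf[symmetric]
  proof (intro sum.cong refl)
    fix x assume "x \<in> cellsQ X"
    then have "vol K x * (u x)\<^sup>2 = u x * (G x - l * vol K x)"
      using vu[OF Q] by (simp add: power2_eq_square mult.left_commute)
    then show "vol K x * (u x)\<^sup>2 = u x * G x - l * (vol K x * u x)" by (simp add: algebra_simps)
  qed
  then have "(\<Sum>x\<in>cellsQ X. vol K x * (u x)\<^sup>2) = 0" by (simp add: uG us)
  then have u0: "\<forall>x\<in>cellsQ X. vol K x * (u x)\<^sup>2 = 0"
    using finite_cellsQ vol_pos Q by (subst (asm) sum_nonneg_eq_0_iff) (auto simp: less_imp_le)
  have "u (x - lattice_part x) = 0"
    using u0 representative[OF x] vol_pos[OF Q[OF representative[OF x]]] by force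
  then have "u x = 0"
    using up[OF point_shift_diff[OF x lattice_part_in] lattice_part_in, of x x] by simp
  then have "G x = l * vol K x" using vu[OF x] by simp
  moreover have "l = deriv mob \<rho> * (norm j)\<^sup>2"
  proof -
    \<comment> \<open>The mean is found with the constant test function: on each edge the two
      partial derivatives add up to \<open>deriv mob \<rho>\<close>.\<close>
    have "2 * l = (\<Sum>(x, y)\<in>edgesQ X K. weight j x y * (?g x y * 1)) + (\<Sum>(x, y)\<in>edgesQ X K. weight j x y * (?g y x * 1))"
      using swap[of "\<lambda>_. 1"] cells[of "\<lambda>_. 1"] by (simp add: l_def)
    also have "\<dots> = (\<Sum>(x, y)\<in>edgesQ X K. deriv mob \<rho> * weight j x y)"
      unfolding sum.distrib[symmetric]
    proof (intro sum.cong refl, clarify)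
      fix x y assume "(x, y) \<in> edgesQ X K"
      then show "weight j x y * (?g x y * 1) + weight j x y * (?g y x * 1) = deriv mob \<rho> * weight j x y"
        by (simp add: mob_deriv[OF s \<rho>(1) edgesQ_edges] algebra_simps)
    qed
    also have "\<dots> = deriv mob \<rho> * (\<Sum>(x, y)\<in>edgesQ X K. weight j x y)"
      by (simp add: sum_distrib_left case_prod_unfold)
    finally show ?thesis by (simp add: sum_weight)
  qed
  ultimately show ?thesis by (simp add: G_def)
qed

lemma balance_iff_outer_prod:
  assumes "deriv mob \<rho> \<noteq> 0"
  shows "(\<Sum>y\<in>nbrs X K x. (deriv (\<lambda>r. mobE x y (r, \<rho>)) \<rho> / deriv mob \<rho> * dist x y * area K x y) *\<^sub>R
      outer_prod (normal x y) (normal x y)) = vol K x *\<^sub>R mat 1 \<longleftrightarrow>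
    (\<forall>j. (\<Sum>y\<in>nbrs X K x. partial1 \<rho> x y * weight j x y) = deriv mob \<rho> * (norm j)\<^sup>2 * vol K x)"
proof -
  have "(\<Sum>y\<in>nbrs X K x. (deriv (\<lambda>r. mobE x y (r, \<rho>)) \<rho> / deriv mob \<rho> * dist x y * area K x y) * (normal x y \<bullet> j)\<^sup>2)
      = (\<Sum>y\<in>nbrs X K x. partial1 \<rho> x y * weight j x y) / deriv mob \<rho>" for j
    unfolding sum_divide_distrib by (intro sum.cong) (auto simp: partial1_def weight_def)
  then show ?thesis
    unfolding outer_prod_sum_eq_iff using assms by (simp add: divide_eq_eq mult_ac)
qed

end

theorem proposition9p3:
  fixes X :: "(real ^ 'd) set"
    and K :: "real ^ 'd \<Rightarrow> (real ^ 'd) set"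
    and mob :: "real \<Rightarrow> real"
    and mobE :: "real ^ 'd \<Rightarrow> real ^ 'd \<Rightarrow> real \<times> real \<Rightarrow> real"
  assumes "fv_partition X K" and "outward_oriented X K"
    and "mobility mob" and "admissible_mobilities X K mob mobE"
  shows
    "(\<forall>\<rho>\<ge>0. \<forall>j. f_hom X K mobE \<rho> j \<le> action_density mob \<rho> j) \<and>
     ((\<forall>\<rho>\<ge>0. \<forall>j :: real ^ 'd. \<exists>p :: real ^ 'd \<Rightarrow> real ^ 'd \<Rightarrow> real \<times> real.
         (\<forall>(x, y)\<in>edges X K. p x y \<in> superdiff (mobE x y) (\<rho>, \<rho>)) \<and>
         (\<exists>c. \<forall>x\<in>X. 1 / vol K x * (\<Sum>y\<in>nbrs X K x.
            (fst (p x y) + snd (p y x)) * dist x y * area K x y * (normal x y \<bullet> j)\<^sup>2) = c))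
       \<longrightarrow> (\<forall>\<rho>\<ge>0. \<forall>j. f_hom X K mobE \<rho> j = action_density mob \<rho> j)) \<and>
     ((\<forall>(x, y)\<in>edges X K. \<exists>U. open U \<and> (\<forall>\<rho>>0. (\<rho>, \<rho>) \<in> U) \<and> U \<subseteq> {0<..} \<times> {0<..} \<and>
         mobE x y differentiable_on U)
       \<longrightarrow> ((\<forall>\<rho>\<ge>0. \<forall>j. f_hom X K mobE \<rho> j = action_density mob \<rho> j) \<longleftrightarrow>
            (\<forall>x\<in>X. \<forall>\<rho>>0. deriv mob \<rho> \<noteq> 0 \<longrightarrow>
               (\<Sum>y\<in>nbrs X K x.
                  (deriv (\<lambda>r. mobE x y (r, \<rho>)) \<rho> / deriv mob \<rho> * dist x y * area K x y) *\<^sub>R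
                    outer_prod (normal x y) (normal x y)) = vol K x *\<^sub>R mat 1)))"
proof -
  interpret fv_energy X K mob mobE by unfold_locales (rule assms)+
  have ii: "f_hom X K mobE \<rho> j = action_density mob \<rho> j"
    if H: "\<exists>p. (\<forall>(x, y)\<in>edges X K. p x y \<in> superdiff (mobE x y) (\<rho>, \<rho>)) \<and>
         (\<exists>c. \<forall>x\<in>X. 1 / vol K x * (\<Sum>y\<in>nbrs X K x.
            (fst (p x y) + snd (p y x)) * dist x y * area K x y * (normal x y \<bullet> j)\<^sup>2) = c)"
      and \<rho>: "\<rho> \<ge> 0" for \<rho> and j :: "real ^ 'd"
  proof -
    obtain p c where p: "\<forall>(x, y)\<in>edges X K. p x y \<in> superdiff (mobE x y) (\<rho>, \<rho>)"
      and c: "\<forall>x\<in>X. 1 / vol K x * (\<Sum>y\<in>nbrs X K x.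
            (fst (p x y) + snd (p y x)) * dist x y * area K x y * (normal x y \<bullet> j)\<^sup>2) = c"
      using H by blast
    show ?thesis
    proof (rule f_hom_eq_of_superdiff[OF \<rho>])
      show "p x y \<in> superdiff (mobE x y) (\<rho>, \<rho>)" if "(x, y) \<in> edges X K" for x y using p that by blast
      show "(\<Sum>y\<in>nbrs X K x. (fst (p x y) + snd (p y x)) * weight j x y) = c * vol K x" if "x \<in> X" for x
      proof -
        have "1 / vol K x * (\<Sum>y\<in>nbrs X K x. (fst (p x y) + snd (p y x)) * weight j x y) = c"
          using bspec[OF c that] by (simp add: weight_def mult.assoc)
        then show ?thesis using vol_pos[OF that] by (simp add: field_simps)
      qed
    qed
  qed
  have iii: "(\<forall>\<rho>\<ge>0. \<forall>j. f_hom X K mobE \<rho> j = action_density mob \<rho> j) \<longleftrightarrow>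
      (\<forall>x\<in>X. \<forall>\<rho>>0. deriv mob \<rho> \<noteq> 0 \<longrightarrow>
        (\<Sum>y\<in>nbrs X K x. (deriv (\<lambda>r. mobE x y (r, \<rho>)) \<rho> / deriv mob \<rho> * dist x y * area K x y) *\<^sub>R
          outer_prod (normal x y) (normal x y)) = vol K x *\<^sub>R mat 1)" (is "?L \<longleftrightarrow> ?R")
    if H: "\<forall>(x, y)\<in>edges X K. \<exists>U. open U \<and> (\<forall>\<rho>>0. (\<rho>, \<rho>) \<in> U) \<and> U \<subseteq> {0<..} \<times> {0<..} \<and>
         mobE x y differentiable_on U"
  proof -
    have s: "smooth_at \<rho>" if "\<rho> > 0" for \<rho>
      unfolding smooth_at_def
    proof clarify
      fix x y assume "(x, y) \<in> edges X K"
      from bspec[OF H this] obtain U where U: "open U" "\<forall>\<rho>>0. (\<rho>, \<rho>) \<in> U" "mobE x y differentiable_on U"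
        by auto
      have "(\<rho>, \<rho>) \<in> U" using U(2) that by simp
      then show "mobE x y differentiable (at (\<rho>, \<rho>))"
        using U(3) unfolding differentiable_on_eq_differentiable_at[OF U(1)] by (rule bspec[rotated])
    qed
    show ?thesis
    proof
      assume L: ?L
      show ?R
      proof (intro ballI allI impI)
        fix x \<rho> assume x: "x \<in> X" and \<rho>: "0 < \<rho>" and d: "deriv mob \<rho> \<noteq> 0"
        \<comment> \<open>The variation divides by \<open>mob \<rho>\<close>; where
          \<open>mob\<close> vanishes at a positive density so does its derivative, which
          \<open>d\<close> excludes.\<close>
        have "mob \<rho> > 0" using mob_zero_imp_deriv_zero[OF \<rho>] d mob_nonneg[of \<rho>] \<rho> by fastforce
        then have "(\<Sum>y\<in>nbrs X K x. partial1 \<rho> x y * weight j x y) = deriv mob \<rho> * (norm j)\<^sup>2 * vol K x" for j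
          using L \<rho> x by (intro balance_of_f_hom_eq s) auto
        then show "(\<Sum>y\<in>nbrs X K x. (deriv (\<lambda>r. mobE x y (r, \<rho>)) \<rho> / deriv mob \<rho> * dist x y * area K x y) *\<^sub>R
          outer_prod (normal x y) (normal x y)) = vol K x *\<^sub>R mat 1"
          unfolding balance_iff_outer_prod[OF d] by blast
      qed
    next
      assume R: ?R
      show ?L
      proof (intro allI impI)
        fix \<rho> :: real and j :: "real ^ 'd" assume \<rho>: "0 \<le> \<rho>"
        show "f_hom X K mobE \<rho> j = action_density mob \<rho> j"
        proof (rule f_hom_eq_of_balance[OF s _ \<rho>])
          fix x and \<rho> :: real assume "x \<in> X" "0 < \<rho>" and d: "deriv mob \<rho> \<noteq> 0"
          then show "(\<Sum>y\<in>nbrs X K x. partial1 \<rho> x y * weight j x y) = deriv mob \<rho> * (norm j)\<^sup>2 * vol K x"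
            using R balance_iff_outer_prod[OF d, of x] by simp
        qed
      qed
    qed
  qed
  show ?thesis
  proof (intro conjI impI)
    show "\<forall>\<rho>\<ge>0. \<forall>j. f_hom X K mobE \<rho> j \<le> action_density mob \<rho> j" using f_hom_le by simp
  qed (use ii in simp, rule iii)
qed

end
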